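(* Let $n\geq 2$ and $m\geq n+1$ be integers, let $\mathbb{K}$ be an infinite field whose characteristic does not divide $m$, let $R=\mathbb{K}[x_1,\ldots,x_n]$ and $\mathfrak{m}=\langle x_1,\ldots,x_n\rangle$. Let $f=l_1l_2\cdots l_m$ be the defining polynomial of a generic central hyperplane arrangement in $\mathbb{K}^n$, let $J_f$ be the ideal generated by the partial derivatives of $f$, and let $\mathbb{I}=\langle f/l_1,\ldots,f/l_m\rangle$. Then: (i) $[\mathbb{I}]_{2m-n-1}=[J_f]_{2m-n-1}$. (ii) If $n\geq 3$ then $(J_f)^{\rm sat}=\mathbb{I}$. In particular, $J_f$ and $\mathbb{I}$ coincide locally everywhere on the punctured spectrum $\mathrm{Spec}(R)\setminus\{\mathfrak{m}\}$. (iii) ${\rm reg}(J_f)={\rm sat}(J_f)=2m-n-1$.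
   Context: A central hyperplane arrangement of size $m$ in $\mathbb{K}^n$ is given by nonzero, pairwise non-proportional linear forms $l_1,\ldots,l_m\in R$; its defining polynomial is $f=l_1\cdots l_m$. It is generic if any $n$ of the forms are $\mathbb{K}$-linearly independent. For a homogeneous ideal $I\subset R$: $[I]_d$ is its degree-$d$ graded component; $I^{\rm sat}=I:\mathfrak{m}^\infty$ is its saturation with respect to $\mathfrak{m}$; ${\rm sat}(I)$, the saturation exponent (satiety), is the least integer $s$ such that $[I]_d=[I^{\rm sat}]_d$ for all $d\geq s$; ${\rm reg}(I)$ is the Castelnuovo–Mumford regularity of $I$, i.e. the maximum of $\beta_k-k$, where $\beta_k$ is the maximal shift in homological degree $k$ of the minimal graded free resolution of $I$ (generators of $I$ being in homological degree $0$). *)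

theory Defs
  imports Complex_Main "HOL-Library.Poly_Mapping" "HOL-Library.Cardinality"
begin

section \<open>The polynomial ring\<close>

text \<open>
  A polynomial ring over \<open>'k\<close> in the variables \<open>x\<^sub>i\<close>, \<open>i :: 'n\<close>, with \<open>'n\<close> a finite type.
  It is the monoid algebra of the exponent vectors \<open>'n \<Rightarrow>\<^sub>0 nat\<close>, and the number of variables
  is \<open>CARD('n)\<close>.
\<close>

type_synonym ('n, 'k) mpoly = "('n \<Rightarrow>\<^sub>0 nat) \<Rightarrow>\<^sub>0 'k"

definition const_mpoly :: "'k::field \<Rightarrow> ('n::finite, 'k) mpoly" where
  "const_mpoly c = Poly_Mapping.single 0 c"

definition var_mpoly :: "'n::finite \<Rightarrow> ('n, 'k::field) mpoly" where
  "var_mpoly i = Poly_Mapping.single (Poly_Mapping.single i 1) 1"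

definition smult_mpoly :: "'k::field \<Rightarrow> ('n::finite, 'k) mpoly \<Rightarrow> ('n, 'k) mpoly" where
  "smult_mpoly c p = const_mpoly c * p"

interpretation mpoly: vector_space
  "smult_mpoly :: 'k::field \<Rightarrow> ('n::finite, 'k) mpoly \<Rightarrow> ('n, 'k) mpoly"
  by unfold_locales
    (simp_all add: smult_mpoly_def const_mpoly_def algebra_simps single_add mult_single
      flip: mult.assoc)

definition monom_deg :: "('n::finite \<Rightarrow>\<^sub>0 nat) \<Rightarrow> nat" where
  "monom_deg t = (\<Sum>i\<in>UNIV. Poly_Mapping.lookup t i)"

text \<open>The zero polynomial is homogeneous of every degree, and it is the only homogeneous
  polynomial of negative degree.\<close>

definition homogeneous :: "int \<Rightarrow> ('n::finite, 'k::field) mpoly \<Rightarrow> bool" where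
  "homogeneous d p \<longleftrightarrow> (\<forall>t\<in>Poly_Mapping.keys p. int (monom_deg t) = d)"

text \<open>The term \<open>c \<cdot> x\<^sup>t\<close> is sent to \<open>(t\<^sub>i c) \<cdot> x\<^sup>t / x\<^sub>i\<close>. If \<open>t\<^sub>i = 0\<close>, the subtraction of exponents
  truncates, but then the coefficient is zero.\<close>

definition partial_deriv :: "'n::finite \<Rightarrow> ('n, 'k::field) mpoly \<Rightarrow> ('n, 'k) mpoly" where
  "partial_deriv i p =
    (\<Sum>t\<in>Poly_Mapping.keys p. Poly_Mapping.single (t - Poly_Mapping.single i 1)
                    (of_nat (Poly_Mapping.lookup t i) * Poly_Mapping.lookup p t))"


section \<open>Ideals\<close>

text \<open>Ideals of a commutative ring are the submodules of the ring over itself: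
  \<open>ideal.subspace I\<close> says that \<open>I\<close> is an ideal and \<open>ideal.span S\<close> is the ideal generated by \<open>S\<close>.\<close>

interpretation ideal: module "(*) :: 'a::comm_ring_1 \<Rightarrow> 'a \<Rightarrow> 'a"
  by unfold_locales (simp_all add: algebra_simps)

definition ideal_prod :: "'a::comm_ring_1 set \<Rightarrow> 'a set \<Rightarrow> 'a set" where
  "ideal_prod I J = ideal.span {a * b | a b. a \<in> I \<and> b \<in> J}"

fun ideal_power :: "'a::comm_ring_1 set \<Rightarrow> nat \<Rightarrow> 'a set" where
  "ideal_power I 0 = UNIV"
| "ideal_power I (Suc k) = ideal_prod I (ideal_power I k)"

definition ideal_colon :: "'a::comm_ring_1 set \<Rightarrow> 'a set \<Rightarrow> 'a set" where
  "ideal_colon I J = {p. \<forall>q\<in>J. p * q \<in> I}"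

definition prime_ideal :: "'a::comm_ring_1 set \<Rightarrow> bool" where
  "prime_ideal P \<longleftrightarrow> ideal.subspace P \<and> P \<noteq> UNIV \<and> (\<forall>a b. a * b \<in> P \<longrightarrow> a \<in> P \<or> b \<in> P)"

definition irrelevant_ideal :: "('n::finite, 'k::field) mpoly set" where
  "irrelevant_ideal = ideal.span {var_mpoly i | i. True}"

definition saturation :: "('n::finite, 'k::field) mpoly set \<Rightarrow> ('n, 'k) mpoly set" where
  "saturation I = (\<Union>k. ideal_colon I (ideal_power irrelevant_ideal k))"

definition graded_component ::
    "int \<Rightarrow> ('n::finite, 'k::field) mpoly set \<Rightarrow> ('n, 'k) mpoly set" where
  "graded_component d I = {p \<in> I. homogeneous d p}"

definition satiety :: "('n::finite, 'k::field) mpoly set \<Rightarrow> int" where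
  "satiety I =
    (LEAST s. \<forall>d\<ge>s. graded_component d I = graded_component d (saturation I))"


section \<open>Localization at a prime ideal\<close>

text \<open>\<open>loc_rel P\<close> is the equivalence of pairs (numerator, denominator) whose classes are the elements
  of the local ring at \<open>P\<close>, and \<open>localized_ideal P I\<close> is the extension of \<open>I\<close> to that ring,
  i.e. the set of all fractions \<open>a / s\<close> with \<open>a\<close> in \<open>I\<close> and \<open>s\<close> outside \<open>P\<close>.\<close>

definition loc_rel :: "'a::comm_ring_1 set \<Rightarrow> (('a \<times> 'a) \<times> ('a \<times> 'a)) set" where
  "loc_rel P = {((a, s), (b, t)) | a s b t.
     s \<notin> P \<and> t \<notin> P \<and> (\<exists>u. u \<notin> P \<and> u * (a * t) = u * (b * s))}"

definition localized_ideal :: "'a::comm_ring_1 set \<Rightarrow> 'a set \<Rightarrow> ('a \<times> 'a) set set" where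
  "localized_ideal P I = {loc_rel P `` {(a, s)} | a s. a \<in> I \<and> s \<notin> P}"


section \<open>Minimal graded free resolutions and regularity\<close>

text \<open>
  A complex \<open>\<dots> \<rightarrow> F\<^sub>2 \<rightarrow> F\<^sub>1 \<rightarrow> F\<^sub>0\<close> of graded free modules of finite rank, with a map from \<open>F\<^sub>0\<close> to
  the polynomial ring, in coordinates. The module \<open>F\<^sub>k\<close> is the direct sum of the \<open>R(-shift k j)\<close>
  for \<open>j < rk k\<close>. The matrix \<open>diff k\<close> is that of the map from \<open>F\<close> at \<open>k + 1\<close> to \<open>F\<close> at \<open>k\<close>, with row
  index first, and \<open>aug j\<close> is the image of the \<open>j\<close>-th basis element of \<open>F\<^sub>0\<close>.
  Values at indices outside the ranks are ignored.
\<close>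

record 'r graded_free_complex =
  rk :: "nat \<Rightarrow> nat"
  shift :: "nat \<Rightarrow> nat \<Rightarrow> int"
  diff :: "nat \<Rightarrow> nat \<Rightarrow> nat \<Rightarrow> 'r"
  aug :: "nat \<Rightarrow> 'r"

definition degree_preserving :: "('n::finite, 'k::field) mpoly graded_free_complex \<Rightarrow> bool" where
  "degree_preserving F \<longleftrightarrow>
    (\<forall>j<rk F 0. homogeneous (shift F 0 j) (aug F j)) \<and>
    (\<forall>k. \<forall>i<rk F k. \<forall>j<rk F (Suc k).
       homogeneous (shift F (Suc k) j - shift F k i) (diff F k i j))"

text \<open>Exactness of \<open>\<dots> \<rightarrow> F\<^sub>1 \<rightarrow> F\<^sub>0 \<rightarrow> I \<rightarrow> 0\<close>: the map onto \<open>I\<close> is surjective, and at \<open>F\<^sub>0\<close> and at each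
  further \<open>F\<close> the kernel equals the image.\<close>

definition exact_over :: "('n::finite, 'k::field) mpoly graded_free_complex \<Rightarrow> ('n, 'k) mpoly set \<Rightarrow> bool"
  where
  "exact_over F I \<longleftrightarrow>
    ideal.span (aug F ` {..<rk F 0}) = I \<and>
    (\<forall>v. (\<Sum>j<rk F 0. aug F j * v j) = 0 \<longleftrightarrow>
       (\<exists>w. \<forall>i<rk F 0. v i = (\<Sum>j<rk F 1. diff F 0 i j * w j))) \<and>
    (\<forall>k. \<forall>v. (\<forall>i<rk F k. (\<Sum>j<rk F (Suc k). diff F k i j * v j) = 0) \<longleftrightarrow>
       (\<exists>w. \<forall>i<rk F (Suc k).
          v i = (\<Sum>j<rk F (Suc (Suc k)). diff F (Suc k) i j * w j)))"

definition minimal_complex :: "('n::finite, 'k::field) mpoly graded_free_complex \<Rightarrow> bool" where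
  "minimal_complex F \<longleftrightarrow>
    (\<forall>k. \<forall>i<rk F k. \<forall>j<rk F (Suc k). diff F k i j \<in> irrelevant_ideal)"

definition minimal_graded_free_resolution ::
    "('n::finite, 'k::field) mpoly graded_free_complex \<Rightarrow> ('n, 'k) mpoly set \<Rightarrow> bool" where
  "minimal_graded_free_resolution F I \<longleftrightarrow>
    degree_preserving F \<and> exact_over F I \<and> minimal_complex F"

definition max_shift :: "('n::finite, 'k::field) mpoly graded_free_complex \<Rightarrow> nat \<Rightarrow> int" where
  "max_shift F k = Max (shift F k ` {..<rk F k})"

text \<open>The maximum is over the homological degrees \<open>k\<close> with \<open>F\<^sub>k \<noteq> 0\<close>. It does not depend on the
  resolution, as minimal graded free resolutions are unique up to isomorphism.\<close>

definition regularity :: "('n::finite, 'k::field) mpoly set \<Rightarrow> int" where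
  "regularity I = (THE r. \<exists>F. minimal_graded_free_resolution F I \<and>
     (\<exists>k. rk F k > 0 \<and> r = max_shift F k - int k) \<and>
     (\<forall>k. rk F k > 0 \<longrightarrow> max_shift F k - int k \<le> r))"


section \<open>Hyperplane arrangements\<close>

definition central_arrangement :: "nat \<Rightarrow> (nat \<Rightarrow> ('n::finite, 'k::field) mpoly) \<Rightarrow> bool" where
  "central_arrangement m l \<longleftrightarrow>
    (\<forall>i\<in>{1..m}. homogeneous 1 (l i) \<and> l i \<noteq> 0) \<and>
    (\<forall>i\<in>{1..m}. \<forall>j\<in>{1..m}. i \<noteq> j \<longrightarrow> (\<nexists>c. l i = smult_mpoly c (l j)))"

text \<open>Independence is that of the family \<open>(l\<^sub>i)\<close> for \<open>i\<close> in \<open>S\<close>, hence the injectivity.\<close>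

definition generic_arrangement :: "nat \<Rightarrow> (nat \<Rightarrow> ('n::finite, 'k::field) mpoly) \<Rightarrow> bool" where
  "generic_arrangement m l \<longleftrightarrow> central_arrangement m l \<and>
    (\<forall>S\<subseteq>{1..m}. card S = CARD('n) \<longrightarrow> inj_on l S \<and> mpoly.independent (l ` S))"

definition defining_poly :: "nat \<Rightarrow> (nat \<Rightarrow> ('n::finite, 'k::field) mpoly) \<Rightarrow> ('n, 'k) mpoly" where
  "defining_poly m l = (\<Prod>i\<in>{1..m}. l i)"

definition jacobian_ideal :: "('n::finite, 'k::field) mpoly \<Rightarrow> ('n, 'k) mpoly set" where
  "jacobian_ideal f = ideal.span {partial_deriv i f | i. True}"

text \<open>The quotient of the defining polynomial by \<open>l\<^sub>i\<close> is the product of the other forms.\<close>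

definition cofactor_ideal :: "nat \<Rightarrow> (nat \<Rightarrow> ('n::finite, 'k::field) mpoly) \<Rightarrow> ('n, 'k) mpoly set"
  where
  "cofactor_ideal m l = ideal.span {(\<Prod>j\<in>{1..m} - {i}. l j) | i. i \<in> {1..m}}"

end

theory Submission
  imports Defs "HOL-Library.Function_Algebras" "HOL-Library.Countable"
    "HOL-Computational_Algebra.Polynomial"
begin

text \<open>
  Write \<open>P\<^sub>j = f / l\<^sub>j\<close>, \<open>\<I> = \<langle>P\<^sub>1, \<dots>, P\<^sub>m\<rangle>\<close> and \<open>r = 2m - n - 1\<close>. The derivative of \<open>f\<close> along a constant
  vector field \<open>\<theta>\<close> is \<open>\<Sum>\<^sub>j \<theta>(l\<^sub>j) P\<^sub>j\<close>, and \<open>f \<in> J\<^sub>f\<close> by Euler's formula. Choosing \<open>\<theta>\<close> to kill \<open>n - 1\<close> of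
  the forms puts \<open>l\<^sub>B P\<^sub>j\<close> into \<open>J\<^sub>f\<close> for every product \<open>l\<^sub>B\<close> of \<open>m - n\<close> forms other than \<open>l\<^sub>j\<close>; modulo \<open>l\<^sub>j\<close> these
  products span all polynomials of degree \<open>m - n\<close>, so \<open>\<I>\<close> and \<open>J\<^sub>f\<close> agree in degrees at least \<open>r\<close>.
  They differ in degree \<open>r - 1\<close>: otherwise some vector field of degree \<open>m - n - 1\<close> would be tangent to too
  many lines of a planar section of the arrangement. Hence \<open>R / J\<^sub>f\<close> has a nonzero socle element of degree
  \<open>r - 1\<close>.

  The ideal \<open>\<I>\<close> has the free resolution \<open>0 \<rightarrow> R(-m)\<^bsup>m-1\<^esup> \<rightarrow> R(-(m-1))\<^bsup>m\<^esup> \<rightarrow> \<I>\<close>, so it is saturated for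
  \<open>n \<ge> 3\<close> and has regularity \<open>m - 1\<close>. The shifts of a minimal resolution are the degrees of the nonzero
  Koszul homology, by dimension shifting along the resolution. Koszul homology of \<open>J\<^sub>f\<close> in homological degree
  \<open>k\<close> vanishes above degree \<open>r + k\<close> since \<open>J\<^sub>f\<close> and \<open>\<I>\<close> agree from degree \<open>r\<close> on, and the socle element
  gives a nonzero class for \<open>k = n - 1\<close> in degree \<open>r + k\<close>.
\<close>

abbreviation lookup :: "('a \<Rightarrow>\<^sub>0 'b::zero) \<Rightarrow> 'a \<Rightarrow> 'b" where "lookup \<equiv> Poly_Mapping.lookup"
abbreviation keys :: "('a \<Rightarrow>\<^sub>0 'b::zero) \<Rightarrow> 'a set" where "keys \<equiv> Poly_Mapping.keys"
abbreviation single :: "'a \<Rightarrow> 'b::zero \<Rightarrow> 'a \<Rightarrow>\<^sub>0 'b" where "single \<equiv> Poly_Mapping.single"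

text \<open>As a simplification rule, this instance of \<open>scale_scale\<close> is associativity to the left; it
  loops together with the AC rules of multiplication.\<close>

declare ideal.scale_scale [simp del]

section \<open>Homogeneous components\<close>

lemma poly_mapping_sum_single:
  assumes "finite A" "keys p \<subseteq> A"
  shows "(p :: 'a \<Rightarrow>\<^sub>0 'b::comm_monoid_add) = (\<Sum>t\<in>A. single t (lookup p t))"
proof (rule poly_mapping_eqI)
  fix t
  have "lookup (\<Sum>t\<in>A. single t (lookup p t)) t = (\<Sum>s\<in>A. if s = t then lookup p s else 0)"
    by (simp add: lookup_sum lookup_single when_def)
  also have "\<dots> = lookup p t"
    using assms by (auto simp: in_keys_iff)
  finally show "lookup p t = lookup (\<Sum>t\<in>A. single t (lookup p t)) t" ..
qed

lemma monom_deg_0 [simp]: "monom_deg 0 = 0"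
  by (simp add: monom_deg_def)

lemma monom_deg_add: "monom_deg (s + t) = monom_deg s + monom_deg t"
  by (simp add: monom_deg_def lookup_add sum.distrib)

lemma monom_deg_single [simp]: "monom_deg (single i c) = c"
  by (simp add: monom_deg_def lookup_single when_def)

lemma monom_deg_eq_0_iff: "monom_deg t = 0 \<longleftrightarrow> t = 0"
  by (auto simp: monom_deg_def intro: poly_mapping_eqI)

lemma monom_deg_eq_1:
  assumes "monom_deg t = 1"
  obtains i where "t = single i 1"
proof -
  have "\<exists>i. lookup t i = 1 \<and> (\<forall>j\<in>UNIV. i \<noteq> j \<longrightarrow> lookup t j = 0)"
    using assms unfolding monom_deg_def by (subst (asm) sum_eq_1_iff) simp_all
  then obtain i where "lookup t i = 1" "\<And>j. i \<noteq> j \<Longrightarrow> lookup t j = 0"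
    by blast
  then have "t = single i 1"
    by (intro poly_mapping_eqI) (auto simp: lookup_single when_def)
  then show thesis by (rule that)
qed

lemma homogeneous_alt: "homogeneous d p \<longleftrightarrow> (\<forall>t. lookup p t \<noteq> 0 \<longrightarrow> int (monom_deg t) = d)"
  by (auto simp: homogeneous_def in_keys_iff)

lemma homogeneous_0 [simp]: "homogeneous d 0"
  by (simp add: homogeneous_def)

lemma homogeneous_add: "homogeneous d p \<Longrightarrow> homogeneous d q \<Longrightarrow> homogeneous d (p + q)"
  unfolding homogeneous_def by (meson UnE keys_add subsetD)

lemma homogeneous_uminus [simp]: "homogeneous d (- p) \<longleftrightarrow> homogeneous d p"
  by (simp add: homogeneous_alt)

lemma homogeneous_diff: "homogeneous d p \<Longrightarrow> homogeneous d q \<Longrightarrow> homogeneous d (p - q)"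
  using homogeneous_add[of d p "- q"] by simp

lemma homogeneous_sum: "(\<And>i. i \<in> A \<Longrightarrow> homogeneous d (p i)) \<Longrightarrow> homogeneous d (\<Sum>i\<in>A. p i)"
  by (induction A rule: infinite_finite_induct) (auto intro: homogeneous_add)

lemma homogeneous_mult:
  assumes "homogeneous d p" "homogeneous e q"
  shows "homogeneous (d + e) (p * q)"
  unfolding homogeneous_def
proof
  fix t assume "t \<in> keys (p * q)"
  then obtain a b where "t = a + b" "a \<in> keys p" "b \<in> keys q"
    using keys_mult[of p q] by blast
  then show "int (monom_deg t) = d + e"
    using assms by (simp add: homogeneous_def monom_deg_add)
qed

lemma homogeneous_mult_eq:
  "homogeneous d p \<Longrightarrow> homogeneous e q \<Longrightarrow> d + e = c \<Longrightarrow> homogeneous c (p * q)"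
  using homogeneous_mult by blast

lemma homogeneous_prod:
  "(\<And>i. i \<in> A \<Longrightarrow> homogeneous (d i) (p i)) \<Longrightarrow> homogeneous (\<Sum>i\<in>A. d i) (\<Prod>i\<in>A. p i)"
proof (induction A rule: infinite_finite_induct)
  case (insert x F)
  then show ?case by (auto intro: homogeneous_mult)
qed (auto simp: homogeneous_def)

lemma homogeneous_single: "homogeneous (int (monom_deg t)) (single t c)"
  by (simp add: homogeneous_def)

lemma homogeneous_const [simp]: "homogeneous 0 (const_mpoly c)"
  using homogeneous_single[of 0] by (simp add: const_mpoly_def)

lemma homogeneous_1 [simp]: "homogeneous 0 1"
  by (simp add: homogeneous_def)

lemma homogeneous_var [simp]: "homogeneous 1 (var_mpoly i)"
  using homogeneous_single[of "single i 1"] by (simp add: var_mpoly_def)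

lemma homogeneous_var_power: "homogeneous (int e) (var_mpoly i ^ e)"
proof (induction e)
  case (Suc e)
  show ?case using homogeneous_mult[OF homogeneous_var Suc, of i] by simp
qed (simp add: homogeneous_def)

lemma homogeneous_neg: "homogeneous d p \<Longrightarrow> d < 0 \<Longrightarrow> p = 0"
  by (intro poly_mapping_eqI) (fastforce simp: homogeneous_alt)

lemma homogeneous_degree_0:
  assumes "homogeneous 0 p"
  shows "p = const_mpoly (lookup p 0)"
  using assms by (intro poly_mapping_eqI)
    (fastforce simp: homogeneous_alt const_mpoly_def lookup_single when_def monom_deg_eq_0_iff)

definition hcomp :: "int \<Rightarrow> ('n::finite, 'k::field) mpoly \<Rightarrow> ('n, 'k) mpoly" where
  "hcomp d p = Poly_Mapping.mapp (\<lambda>t c. c when int (monom_deg t) = d) p"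

lemma lookup_hcomp: "lookup (hcomp d p) t = (if int (monom_deg t) = d then lookup p t else 0)"
  by (auto simp: hcomp_def lookup_mapp when_def in_keys_iff)

lemma homogeneous_hcomp [simp]: "homogeneous d (hcomp d p)"
  by (simp add: homogeneous_alt lookup_hcomp)

lemma hcomp_0 [simp]: "hcomp d 0 = 0"
  by (rule poly_mapping_eqI) (simp add: lookup_hcomp)

lemma hcomp_add: "hcomp d (p + q) = hcomp d p + hcomp d q"
  by (rule poly_mapping_eqI) (simp add: lookup_hcomp lookup_add)

lemma hcomp_uminus: "hcomp d (- p) = - hcomp d p"
  by (rule poly_mapping_eqI) (simp add: lookup_hcomp)

lemma hcomp_sum: "hcomp d (\<Sum>i\<in>A. p i) = (\<Sum>i\<in>A. hcomp d (p i))"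
  by (induction A rule: infinite_finite_induct) (simp_all add: hcomp_add)

lemma hcomp_homogeneous: "homogeneous d p \<Longrightarrow> hcomp e p = (if e = d then p else 0)"
  by (rule poly_mapping_eqI) (auto simp: lookup_hcomp homogeneous_alt)

lemma hcomp_decompose:
  assumes "finite D" "(\<lambda>t. int (monom_deg t)) ` keys p \<subseteq> D"
  shows "(\<Sum>d\<in>D. hcomp d p) = p"
proof (rule poly_mapping_eqI)
  fix t
  have "lookup (\<Sum>d\<in>D. hcomp d p) t = (\<Sum>d\<in>D. if int (monom_deg t) = d then lookup p t else 0)"
    by (simp add: lookup_sum lookup_hcomp)
  also have "\<dots> = lookup p t"
    using assms by (auto simp: in_keys_iff image_subset_iff)
  finally show "lookup (\<Sum>d\<in>D. hcomp d p) t = lookup p t" .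
qed

lemma hcomp_mult:
  assumes "homogeneous d q"
  shows "hcomp e (q * p) = q * hcomp (e - d) p"
proof -
  define D where "D = insert (e - d) ((\<lambda>t. int (monom_deg t)) ` keys p)"
  have D: "finite D" "(\<Sum>c\<in>D. hcomp c p) = p"
    by (auto simp: D_def intro!: hcomp_decompose)
  have "hcomp e (q * p) = hcomp e (\<Sum>c\<in>D. q * hcomp c p)"
    by (simp add: D(2) flip: sum_distrib_left)
  also have "\<dots> = (\<Sum>c\<in>D. hcomp e (q * hcomp c p))"
    by (rule hcomp_sum)
  also have "\<dots> = (\<Sum>c\<in>D. if c = e - d then q * hcomp c p else 0)"
    by (intro sum.cong refl)
      (auto simp: hcomp_homogeneous[OF homogeneous_mult[OF assms homogeneous_hcomp]])
  also have "\<dots> = q * hcomp (e - d) p"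
    using D(1) by (simp add: D_def)
  finally show ?thesis .
qed

lemma lookup_mult_0: "lookup (p * q) (0 :: 'n \<Rightarrow>\<^sub>0 nat) = lookup p 0 * lookup (q :: ('n::finite, 'k::field) mpoly) 0"
proof -
  have "lookup (p * q) 0 = lookup (hcomp 0 (p * q)) 0"
    by (simp add: lookup_hcomp)
  define D where "D = insert 0 ((\<lambda>t. int (monom_deg t)) ` keys p)"
  have D: "finite D" "(\<Sum>c\<in>D. hcomp c p) = p"
    by (auto simp: D_def intro!: hcomp_decompose)
  have Dnn: "d \<ge> 0" if "d \<in> D" for d using that by (auto simp: D_def)
  have "hcomp 0 (p * q) = (\<Sum>c\<in>D. hcomp c p * hcomp (0 - c) q)"
    by (subst D(2)[symmetric]) (simp add: sum_distrib_right hcomp_sum hcomp_mult[OF homogeneous_hcomp] del: diff_0)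
  also have "\<dots> = (\<Sum>c\<in>D. if c = 0 then hcomp 0 p * hcomp 0 q else 0)"
  proof (intro sum.cong refl)
    fix c assume "c \<in> D"
    then show "hcomp c p * hcomp (0 - c) q = (if c = 0 then hcomp 0 p * hcomp 0 q else 0)"
      using Dnn[of c] homogeneous_neg[OF homogeneous_hcomp[of "- c" q]] by auto
  qed
  also have "\<dots> = hcomp 0 p * hcomp 0 q"
    using D(1) by (simp add: D_def)
  also have "\<dots> = single 0 (lookup p 0) * single 0 (lookup q 0)"
    using homogeneous_degree_0[OF homogeneous_hcomp[of 0 p]] homogeneous_degree_0[OF homogeneous_hcomp[of 0 q]]
    by (simp add: lookup_hcomp const_mpoly_def)
  also have "\<dots> = single 0 (lookup p 0 * lookup q 0)"
    by (simp add: mult_single)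
  finally show ?thesis
    by (metis lookup_hcomp lookup_single_eq monom_deg_0 of_nat_0)
qed

section \<open>Variables and linear forms\<close>

lemma const_mpoly_add: "const_mpoly (a + b) = const_mpoly a + const_mpoly b"
  by (simp add: const_mpoly_def single_add)

lemma const_mpoly_mult: "const_mpoly (a * b) = const_mpoly a * const_mpoly b"
  by (simp add: const_mpoly_def mult_single)

lemma const_mpoly_0 [simp]: "const_mpoly 0 = 0"
  by (simp add: const_mpoly_def)

lemma const_mpoly_1 [simp]: "const_mpoly 1 = 1"
  by (simp add: const_mpoly_def)

lemma const_mpoly_sum: "const_mpoly (\<Sum>i\<in>A. c i) = (\<Sum>i\<in>A. const_mpoly (c i))"
  by (induction A rule: infinite_finite_induct) (simp_all add: const_mpoly_add)

lemma const_mpoly_of_nat: "const_mpoly (of_nat k) = of_nat k"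
  by (induction k) (simp_all add: const_mpoly_add)

lemma const_mpoly_inverse: "c \<noteq> 0 \<Longrightarrow> const_mpoly (inverse c) * const_mpoly c = 1"
  by (simp flip: const_mpoly_mult)

lemma split_var:
  "\<exists>a b. p = a + var_mpoly v * b \<and> (\<forall>t\<in>keys a. t \<in> keys p \<and> lookup t v = 0)"
proof -
  define a where "a = (\<Sum>t\<in>{t\<in>keys p. lookup t v = 0}. single t (lookup p t))"
  define b where "b = (\<Sum>t\<in>{t\<in>keys p. lookup t v \<noteq> 0}. single (t - single v 1) (lookup p t))"
  have vb: "var_mpoly v * b = (\<Sum>t\<in>{t\<in>keys p. lookup t v \<noteq> 0}. single t (lookup p t))"
    unfolding b_def sum_distrib_left
  proof (intro sum.cong refl)
    fix t assume "t \<in> {t \<in> keys p. lookup t v \<noteq> 0}"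
    then have "single v 1 + (t - single v 1) = t"
      by (intro poly_mapping_eqI) (auto simp: lookup_add lookup_minus lookup_single when_def)
    then show "var_mpoly v * single (t - single v 1) (lookup p t) = single t (lookup p t)"
      by (simp add: var_mpoly_def mult_single)
  qed
  have "p = (\<Sum>t\<in>keys p. single t (lookup p t))"
    by (rule poly_mapping_sum_single) auto
  also have "\<dots> = a + var_mpoly v * b"
    unfolding vb a_def
    by (subst sum.union_disjoint[symmetric]) (auto intro!: sum.cong)
  finally have "p = a + var_mpoly v * b" .
  moreover have "lookup t v = 0 \<and> t \<in> keys p" if "t \<in> keys a" for t
  proof -
    have "keys a \<subseteq> (\<Union>t\<in>{t\<in>keys p. lookup t v = 0}. keys (single t (lookup p t)))"
      unfolding a_def by (rule keys_sum)
    also have "\<dots> \<subseteq> {t\<in>keys p. lookup t v = 0}" by (auto split: if_splits)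
    finally show ?thesis using that by auto
  qed
  ultimately show ?thesis by blast
qed

lemma lookup_var_mult:
  "lookup (var_mpoly v * p) t = (if lookup t v = 0 then 0 else lookup p (t - single v 1))"
proof -
  have eq: "lookup (\<Sum>s\<in>keys p. single (single v 1 + s) (lookup p s)) t =
      (\<Sum>s\<in>keys p. if single v 1 + s = t then lookup p s else 0)"
    by (simp add: lookup_sum lookup_single when_def)
  have "var_mpoly v * p = (\<Sum>s\<in>keys p. single (single v 1 + s) (lookup p s))"
    by (subst poly_mapping_sum_single[of "keys p" p])
      (simp_all add: var_mpoly_def sum_distrib_left mult_single)
  then have "lookup (var_mpoly v * p) t = (\<Sum>s\<in>keys p. if single v 1 + s = t then lookup p s else 0)"
    using eq by simp
  also have "\<dots> = (if lookup t v = 0 then 0 else lookup p (t - single v 1))"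
  proof (cases "lookup t v = 0")
    case True
    have "single v 1 + s \<noteq> t" for s
      using True by (auto simp: lookup_add)
    then show ?thesis using True by simp
  next
    case False
    then have "single v 1 + s = t \<longleftrightarrow> s = t - single v 1" for s
      by (auto intro!: poly_mapping_eqI simp: lookup_add lookup_minus lookup_single when_def)
    then show ?thesis using False by (simp add: in_keys_iff)
  qed
  finally show ?thesis .
qed

lemma linear_form_expand:
  assumes "homogeneous 1 p"
  shows "p = (\<Sum>i\<in>UNIV. const_mpoly (lookup p (single i 1)) * var_mpoly i)"
proof (rule poly_mapping_eqI)
  fix t
  have "lookup (\<Sum>i\<in>UNIV. const_mpoly (lookup p (single i 1)) * var_mpoly i) t =
    (\<Sum>i\<in>UNIV. if t = single i 1 then lookup p t else 0)"
    by (auto simp: lookup_sum const_mpoly_def var_mpoly_def mult_single lookup_single when_def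
        intro!: sum.cong)
  also have "\<dots> = lookup p t"
  proof (cases "\<exists>i. t = single i 1")
    case True
    then obtain i where i: "t = single i 1" by blast
    have "(t = single j 1) = (i = j)" for j
      unfolding i by (metis lookup_single_eq lookup_single_not_eq zero_neq_one)
    then show ?thesis by simp
  next
    case False
    then have "lookup p t = 0"
      using assms monom_deg_eq_1[of t] by (auto simp: homogeneous_alt)
    then show ?thesis by (auto intro!: sum.neutral)
  qed
  finally show "lookup p t = lookup (\<Sum>i\<in>UNIV. const_mpoly (lookup p (single i 1)) * var_mpoly i) t" ..
qed

lemma lookup_var_0 [simp]: "lookup (var_mpoly (i :: 'n::finite)) 0 = 0"
proof -
  have "single i 1 \<noteq> (0 :: 'n \<Rightarrow>\<^sub>0 nat)"
    by (metis lookup_single_eq lookup_zero zero_neq_one)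
  then show ?thesis by (simp add: var_mpoly_def lookup_single)
qed

lemma irrelevant_ideal_iff: "p \<in> irrelevant_ideal \<longleftrightarrow> lookup p 0 = 0"
proof
  assume "p \<in> irrelevant_ideal"
  then show "lookup p 0 = 0"
    unfolding irrelevant_ideal_def
  proof (induction rule: ideal.span_induct_alt)
    case (step c x y)
    then show ?case
      by (auto simp: lookup_add lookup_mult_0 lookup_var_0)
  qed simp
next
  have *: "p \<in> irrelevant_ideal" if "finite V" "\<And>t. t \<in> keys p \<Longrightarrow> \<exists>v\<in>V. lookup t v \<noteq> 0"
    for V and p :: "('n::finite, 'k::field) mpoly"
    using that
  proof (induction V arbitrary: p rule: finite_induct)
    case empty
    then have "p = 0" using keys_eq_empty by fastforce
    then show ?case by (simp add: irrelevant_ideal_def ideal.span_zero)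
  next
    case (insert v V)
    obtain a b where ab: "p = a + var_mpoly v * b"
      "\<forall>t\<in>keys a. t \<in> keys p \<and> lookup t v = 0"
      using split_var[of p v] by metis
    have "a \<in> irrelevant_ideal"
      by (rule insert.IH) (use insert.prems ab(2) in fastforce)
    moreover have "var_mpoly v \<in> irrelevant_ideal"
      unfolding irrelevant_ideal_def by (rule ideal.span_base) auto
    ultimately show ?case
      unfolding irrelevant_ideal_def ab(1) mult.commute[of "var_mpoly v"]
      by (intro ideal.span_add ideal.span_scale)
  qed
  assume p: "lookup p 0 = 0"
  show "p \<in> irrelevant_ideal"
  proof (rule *[of UNIV])
    fix t assume "t \<in> keys p"
    then have "t \<noteq> 0" using p by (auto simp: in_keys_iff)
    then show "\<exists>v\<in>UNIV. lookup t v \<noteq> 0"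
      by (metis UNIV_I lookup_zero poly_mapping_eqI)
  qed simp
qed

section \<open>Substitution homomorphisms\<close>

definition subst_mpoly ::
    "('k::field \<Rightarrow> 'a::comm_ring_1) \<Rightarrow> ('n::finite \<Rightarrow> 'a) \<Rightarrow> ('n, 'k) mpoly \<Rightarrow> 'a" where
  "subst_mpoly \<phi> \<sigma> p = (\<Sum>t\<in>keys p. \<phi> (lookup p t) * (\<Prod>i\<in>UNIV. \<sigma> i ^ lookup t i))"

locale coeff_hom =
  fixes \<phi> :: "'k::field \<Rightarrow> 'a::comm_ring_1"
  assumes hom_add: "\<phi> (a + b) = \<phi> a + \<phi> b"
    and hom_mult: "\<phi> (a * b) = \<phi> a * \<phi> b"
    and hom_one: "\<phi> 1 = 1"
begin

lemma hom_zero: "\<phi> 0 = 0"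
  using hom_add[of 0 0] by simp

lemma subst_superset:
  assumes "finite A" "keys p \<subseteq> A"
  shows "subst_mpoly \<phi> \<sigma> p = (\<Sum>t\<in>A. \<phi> (lookup p t) * (\<Prod>i\<in>UNIV. \<sigma> i ^ lookup t i))"
  unfolding subst_mpoly_def
  by (rule sum.mono_neutral_left) (use assms in \<open>auto simp: in_keys_iff hom_zero\<close>)

lemma subst_zero: "subst_mpoly \<phi> \<sigma> 0 = 0"
  by (simp add: subst_mpoly_def)

lemma subst_add: "subst_mpoly \<phi> \<sigma> (p + q) = subst_mpoly \<phi> \<sigma> p + subst_mpoly \<phi> \<sigma> q"
proof -
  have "finite (keys p \<union> keys q)" by simp
  note s = subst_superset[OF this]
  show ?thesis
    using keys_add[of p q]
    by (simp add: s lookup_add hom_add distrib_right sum.distrib)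
qed

lemma subst_sum: "subst_mpoly \<phi> \<sigma> (\<Sum>i\<in>A. p i) = (\<Sum>i\<in>A. subst_mpoly \<phi> \<sigma> (p i))"
  by (induction A rule: infinite_finite_induct) (simp_all add: subst_zero subst_add)

lemma subst_uminus: "subst_mpoly \<phi> \<sigma> (- p) = - subst_mpoly \<phi> \<sigma> p"
  using subst_add[of \<sigma> p "- p"] by (simp add: subst_zero eq_neg_iff_add_eq_0 add.commute)

lemma subst_diff: "subst_mpoly \<phi> \<sigma> (p - q) = subst_mpoly \<phi> \<sigma> p - subst_mpoly \<phi> \<sigma> q"
  using subst_add[of \<sigma> p "- q"] by (simp add: subst_uminus)

lemma subst_single: "subst_mpoly \<phi> \<sigma> (single t c) = \<phi> c * (\<Prod>i\<in>UNIV. \<sigma> i ^ lookup t i)"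
  by (subst subst_superset[of "{t}"]) auto

lemma subst_const: "subst_mpoly \<phi> \<sigma> (const_mpoly c) = \<phi> c"
  by (simp add: const_mpoly_def subst_single)

lemma subst_one: "subst_mpoly \<phi> \<sigma> 1 = 1"
  using subst_const[of \<sigma> 1] by (simp add: hom_one)

lemma subst_var: "subst_mpoly \<phi> \<sigma> (var_mpoly i) = \<sigma> i"
proof -
  have "(\<Prod>j\<in>UNIV. \<sigma> j ^ lookup (single i (Suc 0)) j) = (\<Prod>j\<in>UNIV. if j = i then \<sigma> i else 1)"
    by (intro prod.cong) (auto simp: lookup_single when_def)
  then show ?thesis by (simp add: var_mpoly_def subst_single hom_one)
qed

lemma subst_mult: "subst_mpoly \<phi> \<sigma> (p * q) = subst_mpoly \<phi> \<sigma> p * subst_mpoly \<phi> \<sigma> q"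
proof -
  have "p * q = (\<Sum>s\<in>keys p. single s (lookup p s)) * (\<Sum>t\<in>keys q. single t (lookup q t))"
    by (intro arg_cong2[where f="(*)"] poly_mapping_sum_single) auto
  also have "\<dots> = (\<Sum>s\<in>keys p. \<Sum>t\<in>keys q. single (s + t) (lookup p s * lookup q t))"
    by (simp add: sum_product mult_single)
  finally have "subst_mpoly \<phi> \<sigma> (p * q) =
      subst_mpoly \<phi> \<sigma> (\<Sum>s\<in>keys p. \<Sum>t\<in>keys q. single (s + t) (lookup p s * lookup q t))"
    by (rule arg_cong)
  also have "\<dots> = (\<Sum>s\<in>keys p. \<Sum>t\<in>keys q.
      (\<phi> (lookup p s) * \<phi> (lookup q t)) * (\<Prod>i\<in>UNIV. \<sigma> i ^ lookup s i * \<sigma> i ^ lookup t i))"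
    by (simp only: subst_sum subst_single hom_mult lookup_add power_add)
  also have "\<dots> = subst_mpoly \<phi> \<sigma> p * subst_mpoly \<phi> \<sigma> q"
    unfolding subst_mpoly_def sum_product prod.distrib
    by (intro sum.cong refl) (simp only: ac_simps)
  finally show ?thesis .
qed

lemma subst_power: "subst_mpoly \<phi> \<sigma> (p ^ e) = subst_mpoly \<phi> \<sigma> p ^ e"
  by (induction e) (simp_all add: subst_one subst_mult)

lemma subst_linear_form:
  assumes "homogeneous 1 p"
  shows "subst_mpoly \<phi> \<sigma> p = (\<Sum>i\<in>UNIV. \<phi> (lookup p (single i 1)) * \<sigma> i)"
  by (subst linear_form_expand[OF assms]) (simp add: subst_sum subst_mult subst_const subst_var)

lemma subst_cong_dvd:
  assumes "\<And>i. l dvd \<sigma> i - \<tau> i"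
  shows "l dvd subst_mpoly \<phi> \<sigma> p - subst_mpoly \<phi> \<tau> p"
proof -
  have mult: "l dvd a * b - c * d" if "l dvd a - c" "l dvd b - d" for a b c d :: 'a
  proof -
    have "a * b - c * d = (a - c) * b + c * (b - d)" by (simp add: algebra_simps)
    then show ?thesis using that by simp
  qed
  have pow: "l dvd \<sigma> i ^ e - \<tau> i ^ e" for i e
    by (induction e) (auto intro: mult assms)
  have prod: "l dvd (\<Prod>i\<in>A. \<sigma> i ^ e i) - (\<Prod>i\<in>A. \<tau> i ^ e i)" for A e
    by (induction A rule: infinite_finite_induct) (auto intro: mult pow)
  show ?thesis
    unfolding subst_mpoly_def
    by (simp flip: sum_subtractf right_diff_distrib) (intro dvd_sum dvd_mult prod)
qed

end

interpretation const_mpoly: coeff_hom const_mpoly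
  by unfold_locales (simp_all add: const_mpoly_add const_mpoly_mult)

lemma single_power: "(single s 1 :: 'a::comm_monoid_add \<Rightarrow>\<^sub>0 'b::comm_semiring_1) ^ e = single (\<Sum>_<e. s) 1"
proof (induction e)
  case (Suc e)
  then show ?case by (simp add: mult_single lessThan_Suc)
qed simp

lemma prod_single_1: "(\<Prod>i\<in>A. single (s i) (1::'b::comm_semiring_1)) = single (\<Sum>i\<in>A. s i :: 'a::comm_monoid_add) 1"
proof (induction A rule: infinite_finite_induct)
  case (insert x F)
  then show ?case by (simp add: mult_single)
qed simp_all

lemma sum_single_1: "(\<Sum>_\<in>{..<e::nat}. single i (1::nat)) = single i e"
  by (rule poly_mapping_eqI) (simp add: lookup_sum lookup_single when_def)

lemma subst_var_id: "subst_mpoly const_mpoly var_mpoly p = p"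
proof -
  have "const_mpoly (lookup p t) * (\<Prod>i\<in>UNIV. var_mpoly i ^ lookup t i) = single t (lookup p t)" for t
  proof -
    have "(\<Sum>i\<in>UNIV. single i (lookup t i)) = t"
      by (rule poly_mapping_eqI) (simp add: lookup_sum lookup_single when_def)
    then show ?thesis
      unfolding var_mpoly_def single_power sum_single_1 prod_single_1
      by (simp add: const_mpoly_def mult_single)
  qed
  then show ?thesis
    unfolding subst_mpoly_def using poly_mapping_sum_single[of "keys p" p] by simp
qed

text \<open>The library shows that polynomials over linearly ordered variables form a domain; the general
  case is embedded into that of variables indexed by natural numbers.\<close>

lemma mpoly_mult_eq_0:
  fixes p q :: "('n::finite, 'k::field) mpoly"
  assumes "p * q = 0"
  shows "p = 0 \<or> q = 0"
proof -
  define E :: "('n \<Rightarrow>\<^sub>0 nat) \<Rightarrow> (nat \<Rightarrow>\<^sub>0 nat)" where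
    "E t = (\<Sum>i\<in>UNIV. single (to_nat i) (lookup t i))" for t
  have lookup_E: "lookup (E t) (to_nat i) = lookup t i" for t i
    by (simp add: E_def lookup_sum lookup_single when_def inj_eq[OF inj_to_nat])
  have inj_E: "E s = E t \<longleftrightarrow> s = t" for s t
    using lookup_E[of s] lookup_E[of t] by (auto intro!: poly_mapping_eqI)
  interpret coeff_hom "\<lambda>c::'k. single (0 :: nat \<Rightarrow>\<^sub>0 nat) c"
    by unfold_locales (simp_all add: single_add mult_single)
  define S where "S = subst_mpoly (single (0 :: nat \<Rightarrow>\<^sub>0 nat)) (\<lambda>i::'n. single (single (to_nat i) 1) (1::'k))"
  have "S p = (\<Sum>t\<in>keys p. single (E t) (lookup p t))" for p
    unfolding S_def subst_mpoly_def single_power sum_single_1 prod_single_1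
    by (simp add: E_def mult_single)
  then have "lookup (S p) (E t) = (\<Sum>s\<in>keys p. if s = t then lookup p s else 0)" for p t
    by (simp add: lookup_sum lookup_single when_def inj_E)
  then have "lookup (S p) (E t) = lookup p t" for p t
    by (simp add: in_keys_iff)
  then have S0: "p = 0" if "S p = 0" for p
    using that by (intro poly_mapping_eqI) (metis lookup_zero)
  have "S p * S q = S (p * q)"
    unfolding S_def by (simp only: subst_mult)
  also have "\<dots> = 0"
    unfolding S_def assms by (rule subst_zero)
  finally have "S p * S q = 0" .
  then show ?thesis using S0 by auto
qed

lemma mpoly_prod_nonzero:
  "(\<And>i. i \<in> A \<Longrightarrow> p i \<noteq> 0) \<Longrightarrow> (\<Prod>i\<in>A. p i) \<noteq> (0 :: ('n::finite, 'k::field) mpoly)"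
  by (induction A rule: infinite_finite_induct) (auto dest: mpoly_mult_eq_0)

text \<open>Eliminating one of the variables that occur in a linear form \<open>l\<close> is a ring endomorphism with
  kernel \<open>\<langle>l\<rangle>\<close>.\<close>

lemma linear_form_prime:
  fixes l :: "('n::finite, 'k::field) mpoly"
  assumes l: "homogeneous 1 l" "l \<noteq> 0" and dvd: "l dvd p * q"
  shows "l dvd p \<or> l dvd q"
proof -
  obtain i where i: "lookup l (single i 1) \<noteq> 0"
  proof (rule ccontr)
    assume "\<not> thesis"
    then have "\<And>i. lookup l (single i 1) = 0" using that by blast
    then have "l = 0" by (subst linear_form_expand[OF l(1)]) simp
    then show False using l(2) by simp
  qed
  define c where "c = lookup l (single i 1)"
  define \<sigma> where "\<sigma> j = (if j = i then var_mpoly i - const_mpoly (inverse c) * l else var_mpoly j)" for j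
  define s where "s = subst_mpoly const_mpoly \<sigma>"
  have "s l = (\<Sum>j\<in>UNIV. const_mpoly (lookup l (single j 1)) * var_mpoly j
      - (if j = i then const_mpoly c * (const_mpoly (inverse c) * l) else 0))"
    unfolding s_def const_mpoly.subst_linear_form[OF l(1)]
    by (rule sum.cong) (simp_all add: \<sigma>_def c_def right_diff_distrib)
  also have "\<dots> = 0"
    using i linear_form_expand[OF l(1)]
    by (simp add: sum_subtractf c_def flip: const_mpoly_mult mult.assoc)
  finally have sl: "s l = 0" .
  have "l dvd var_mpoly j - \<sigma> j" for j
    by (simp add: \<sigma>_def)
  then have "l dvd subst_mpoly const_mpoly var_mpoly p - s p" for p
    unfolding s_def by (rule const_mpoly.subst_cong_dvd)
  then have diff: "l dvd p - s p" for p
    by (simp add: subst_var_id)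
  have "l dvd p" if "s p = 0" for p
    using diff[of p] that by simp
  moreover have "s p * s q = 0"
    using dvd sl unfolding s_def by (metis const_mpoly.subst_mult dvdE mult_zero_left)
  ultimately show ?thesis using mpoly_mult_eq_0 by blast
qed

lemma linear_form_dvd_prod:
  assumes "homogeneous 1 l" "l \<noteq> 0" "l dvd (\<Prod>i\<in>A. p i)" "\<not> l dvd 1"
  shows "\<exists>i\<in>A. l dvd p i"
  using assms(3)
  by (induction A rule: infinite_finite_induct) (use assms in \<open>auto dest: linear_form_prime\<close>)

section \<open>Partial derivatives\<close>

lemma partial_deriv_superset:
  assumes "finite A" "keys p \<subseteq> A"
  shows "partial_deriv i p =
    (\<Sum>t\<in>A. single (t - single i 1) (of_nat (lookup t i) * lookup p t))"
  unfolding partial_deriv_def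
  by (rule sum.mono_neutral_left) (use assms in \<open>auto simp: in_keys_iff\<close>)

lemma partial_deriv_0 [simp]: "partial_deriv i 0 = 0"
  by (simp add: partial_deriv_def)

lemma partial_deriv_add: "partial_deriv i (p + q) = partial_deriv i p + partial_deriv i q"
proof -
  have "finite (keys p \<union> keys q)" by simp
  note s = partial_deriv_superset[OF this]
  show ?thesis
    using keys_add[of p q]
    by (simp add: s lookup_add distrib_left single_add sum.distrib)
qed

lemma partial_deriv_sum: "partial_deriv i (\<Sum>j\<in>A. p j) = (\<Sum>j\<in>A. partial_deriv i (p j))"
  by (induction A rule: infinite_finite_induct) (simp_all add: partial_deriv_add)

lemma partial_deriv_single:
  "partial_deriv i (single t c) = single (t - single i 1) (of_nat (lookup t i) * c)"
  by (subst partial_deriv_superset[of "{t}"]) auto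

lemma partial_deriv_mult:
  "partial_deriv i (p * q) = partial_deriv i p * q + p * partial_deriv i q"
proof -
  have shift: "single (s + t - single i 1) (of_nat (lookup s i) * c) =
      single (s - single i 1 + t) (of_nat (lookup s i) * c)" for s t :: "'a \<Rightarrow>\<^sub>0 nat" and c :: 'b
  proof (cases "lookup s i = 0")
    case False
    then have "s + t - single i 1 = s - single i 1 + t"
      by (intro poly_mapping_eqI) (auto simp: lookup_add lookup_minus lookup_single when_def)
    then show ?thesis by simp
  qed simp
  have single: "partial_deriv i (single s a * single t b) =
      partial_deriv i (single s a) * single t b + single s a * partial_deriv i (single t b)"
    for s t :: "'a \<Rightarrow>\<^sub>0 nat" and a b :: 'b
  proof -
    have 1: "single (s + t - single i 1) (of_nat (lookup s i) * (a * b)) =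
        partial_deriv i (single s a) * single t b"
      by (simp only: shift partial_deriv_single mult_single mult.assoc)
    have "single (t + s - single i 1) (of_nat (lookup t i) * (b * a)) =
        partial_deriv i (single t b) * single s a"
      by (simp only: shift partial_deriv_single mult_single mult.assoc)
    then have 2: "single (s + t - single i 1) (of_nat (lookup t i) * (a * b)) =
        single s a * partial_deriv i (single t b)"
      by (simp only: mult.commute[of b a] add.commute[of t s] mult.commute[of "single s a"])
    show ?thesis
      unfolding 1[symmetric] 2[symmetric]
      by (simp only: partial_deriv_single mult_single lookup_add of_nat_add distrib_right single_add)
  qed
  have pq: "p = (\<Sum>s\<in>keys p. single s (lookup p s))" "q = (\<Sum>t\<in>keys q. single t (lookup q t))"
    by (rule poly_mapping_sum_single; simp)+
  define P where "P = (\<Sum>s\<in>keys p. single s (lookup p s))"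
  define Q where "Q = (\<Sum>t\<in>keys q. single t (lookup q t))"
  have "partial_deriv i (P * Q) = partial_deriv i P * Q + P * partial_deriv i Q"
    unfolding P_def Q_def by (simp add: sum_product partial_deriv_sum single sum.distrib)
  then show ?thesis
    using pq by (simp add: P_def Q_def)
qed

lemma partial_deriv_1 [simp]: "partial_deriv i 1 = 0"
  using partial_deriv_mult[of i 1 1] by simp

lemma partial_deriv_prod:
  assumes "finite S"
  shows "partial_deriv i (\<Prod>j\<in>S. p j) = (\<Sum>j\<in>S. partial_deriv i (p j) * (\<Prod>k\<in>S - {j}. p k))"
  using assms
proof (induction S rule: finite_induct)
  case (insert x F)
  have "(\<Prod>k\<in>insert x F - {j}. p k) = p x * (\<Prod>k\<in>F - {j}. p k)" if "j \<in> F" for j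
  proof -
    have "insert x F - {j} = insert x (F - {j})" using insert.hyps that by auto
    then show ?thesis using insert.hyps by simp
  qed
  then show ?case
    using insert.hyps
    by (simp add: partial_deriv_mult insert.IH sum_distrib_left mult_ac cong: sum.cong)
qed simp

lemma partial_deriv_linear_form:
  assumes "homogeneous 1 l"
  shows "partial_deriv i l = const_mpoly (lookup l (single i 1))"
proof -
  have const: "partial_deriv i (const_mpoly c) = 0" for c :: 'b
    by (simp add: const_mpoly_def partial_deriv_single)
  have var: "partial_deriv i (var_mpoly j) = (if j = i then 1 else (0 :: ('a, 'b) mpoly))" for j
    by (simp add: var_mpoly_def partial_deriv_single lookup_single when_def)
  show ?thesis
    by (subst linear_form_expand[OF assms])
      (simp add: partial_deriv_sum partial_deriv_mult const var if_distrib cong: if_cong)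
qed

section \<open>Koszul complexes\<close>

text \<open>A chain of the Koszul complex on variables \<open>v\<^sub>1, \<dots>, v\<^sub>n\<close> assigns a coefficient to each subset of
  the variables, given as a list of Booleans. The recursion presents the complex as the iterated
  mapping cone of multiplication by the variables, which takes care of the signs.\<close>

fun koszul :: "'n list \<Rightarrow> (bool list \<Rightarrow> ('n::finite, 'k::field) mpoly) \<Rightarrow> bool list \<Rightarrow> ('n, 'k) mpoly" where
  "koszul (v # vs) c (True # bs) = - koszul vs (\<lambda>b. c (True # b)) bs"
| "koszul (v # vs) c (False # bs) = koszul vs (\<lambda>b. c (False # b)) bs + var_mpoly v * c (True # bs)"
| "koszul _ _ _ = 0"

lemma koszul_Nil [simp]: "koszul vs c [] = 0"
  by (cases vs) auto

lemma koszul_add: "koszul vs (\<lambda>b. c b + c' b) bs = koszul vs c bs + koszul vs c' bs"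
  by (induction vs c bs arbitrary: c' rule: koszul.induct) (simp_all, simp_all add: algebra_simps)

lemma koszul_mult: "koszul vs (\<lambda>b. q * c b) bs = q * koszul vs c bs"
  by (induction vs c bs rule: koszul.induct) (simp_all add: algebra_simps)

lemma koszul_0 [simp]: "koszul vs (\<lambda>b. 0) bs = 0"
  using koszul_mult[of vs 0 "\<lambda>b. 0" bs] by simp

lemma koszul_uminus: "koszul vs (\<lambda>b. - c b) bs = - koszul vs c bs"
  using koszul_mult[of vs "- 1" c bs] by simp

lemma koszul_diff: "koszul vs (\<lambda>b. c b - c' b) bs = koszul vs c bs - koszul vs c' bs"
  using koszul_add[of vs c "\<lambda>b. - c' b" bs] by (simp add: koszul_uminus)

lemma koszul_sum: "koszul vs (\<lambda>b. \<Sum>j\<in>A. c j b) bs = (\<Sum>j\<in>A. koszul vs (c j) bs)"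
  by (induction A rule: infinite_finite_induct) (simp_all add: koszul_add)

lemma koszul_koszul [simp]: "koszul vs (koszul vs c) bs = 0"
proof (induction vs arbitrary: c bs)
  case (Cons v vs)
  show ?case
  proof (cases bs)
    case (Cons b bs')
    then show ?thesis
      using Cons.IH
      by (cases b) (simp_all add: koszul_uminus koszul_add koszul_mult)
  qed simp
qed simp

text \<open>The differential does not see the coefficient at the empty set.\<close>

lemma koszul_cong:
  assumes "\<And>b. length b = length vs \<Longrightarrow> True \<in> set b \<Longrightarrow> c b = c' b" "length bs = length vs"
  shows "koszul vs c bs = koszul vs c' bs"
  using assms
proof (induction vs arbitrary: c c' bs)
  case (Cons v vs)
  then obtain b bs' where bs: "bs = b # bs'" by (cases bs) auto
  have "koszul vs (\<lambda>x. c (b # x)) bs' = koszul vs (\<lambda>x. c' (b # x)) bs'"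
    by (rule Cons.IH) (use Cons.prems bs in auto)
  moreover have "c (True # bs') = c' (True # bs')"
    by (rule Cons.prems(1)) (use Cons.prems(2) bs in auto)
  ultimately show ?case by (cases b) (simp_all add: bs)
qed simp

definition weight :: "bool list \<Rightarrow> int" where
  "weight bs = int (length (filter id bs))"

lemma weight_simps [simp]:
  "weight [] = 0" "weight (True # bs) = weight bs + 1" "weight (False # bs) = weight bs"
  by (simp_all add: weight_def)

lemma weight_nonneg [simp]: "weight bs \<ge> 0"
  by (simp add: weight_def)

lemma weight_replicate_False [simp]: "weight (replicate n False) = 0"
  by (induction n) auto

lemma weight_eq_0: "weight bs = 0 \<longleftrightarrow> bs = replicate (length bs) False"
proof (induction bs)
  case (Cons b bs)
  have "weight bs + 1 \<noteq> 0" using weight_nonneg[of bs] by linarith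
  then show ?case using Cons by (cases b) auto
qed simp

definition koszul_part :: "int \<Rightarrow> int \<Rightarrow> (bool list \<Rightarrow> ('n::finite, 'k::field) mpoly) \<Rightarrow> bool list \<Rightarrow> ('n, 'k) mpoly"
  where "koszul_part p d c bs = (if weight bs = p then hcomp (d - p) (c bs) else 0)"

lemma koszul_koszul_part:
  "koszul vs (koszul_part (p + 1) d c) bs = koszul_part p d (koszul vs c) bs"
proof (induction vs arbitrary: c bs p d)
  case Nil
  then show ?case by (simp add: koszul_part_def)
next
  case (Cons v vs)
  have T: "(\<lambda>b. koszul_part (p + 1) d c (True # b)) = koszul_part (p - 1 + 1) (d - 1) (\<lambda>b. c (True # b))"
    by (auto simp: koszul_part_def fun_eq_iff algebra_simps)
  have F: "(\<lambda>b. koszul_part (p + 1) d c (False # b)) = koszul_part (p + 1) d (\<lambda>b. c (False # b))"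
    by (auto simp: koszul_part_def fun_eq_iff)
  show ?case
  proof (cases bs)
    case Nil
    then show ?thesis by (simp add: koszul_part_def)
  next
    case (Cons b bs')
    show ?thesis
    proof (cases b)
      case True
      have "koszul vs (\<lambda>b. koszul_part (p + 1) d c (True # b)) bs' =
          koszul_part (p - 1) (d - 1) (koszul vs (\<lambda>b. c (True # b))) bs'"
        unfolding T by (rule Cons.IH)
      then show ?thesis
        by (auto simp: Cons True koszul_part_def hcomp_uminus algebra_simps)
    next
      case False
      have "koszul vs (\<lambda>b. koszul_part (p + 1) d c (False # b)) bs' =
          koszul_part p d (koszul vs (\<lambda>b. c (False # b))) bs'"
        unfolding F by (rule Cons.IH)
      then show ?thesis
        by (auto simp: Cons False koszul_part_def hcomp_add hcomp_mult[OF homogeneous_var] algebra_simps)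
    qed
  qed
qed

definition in_var_ideal :: "'n set \<Rightarrow> ('n::finite, 'k::field) mpoly \<Rightarrow> bool" where
  "in_var_ideal V p \<longleftrightarrow> (\<forall>t. lookup p t \<noteq> 0 \<longrightarrow> (\<exists>v\<in>V. lookup t v \<noteq> 0))"

lemma in_var_ideal_0 [simp]: "in_var_ideal V 0"
  by (simp add: in_var_ideal_def)

lemma in_var_ideal_empty: "in_var_ideal {} p \<longleftrightarrow> p = 0"
  by (auto simp: in_var_ideal_def intro: poly_mapping_eqI)

lemma in_var_ideal_UNIV: "in_var_ideal UNIV p \<longleftrightarrow> lookup p 0 = 0"
proof
  assume p: "lookup p 0 = 0"
  show "in_var_ideal UNIV p"
    unfolding in_var_ideal_def
  proof (intro allI impI)
    fix t assume "lookup p t \<noteq> 0"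
    then have "t \<noteq> 0" using p by auto
    then show "\<exists>v\<in>UNIV. lookup t v \<noteq> 0"
      by (metis UNIV_I lookup_zero poly_mapping_eqI)
  qed
qed (auto simp: in_var_ideal_def)

lemma in_var_ideal_add:
  assumes "in_var_ideal V p" "in_var_ideal V q"
  shows "in_var_ideal V (p + q)"
  unfolding in_var_ideal_def
proof (intro allI impI)
  fix t assume "lookup (p + q) t \<noteq> 0"
  then have "lookup p t \<noteq> 0 \<or> lookup q t \<noteq> 0" by (auto simp: lookup_add)
  then show "\<exists>v\<in>V. lookup t v \<noteq> 0" using assms by (auto simp: in_var_ideal_def)
qed

lemma in_var_ideal_uminus: "in_var_ideal V (- p) \<longleftrightarrow> in_var_ideal V p"
  by (simp add: in_var_ideal_def)

lemma in_var_ideal_mono: "in_var_ideal V p \<Longrightarrow> V \<subseteq> W \<Longrightarrow> in_var_ideal W p"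
  by (auto simp: in_var_ideal_def)

lemma in_var_ideal_var_mult: "v \<in> V \<Longrightarrow> in_var_ideal V (var_mpoly v * p)"
  by (auto simp: in_var_ideal_def lookup_var_mult split: if_splits)

lemma in_var_ideal_var_mult_cancel:
  assumes "v \<notin> V" "in_var_ideal V (var_mpoly v * p)"
  shows "in_var_ideal V p"
  unfolding in_var_ideal_def
proof (intro allI impI)
  fix t assume t: "lookup p t \<noteq> 0"
  have "lookup (var_mpoly v * p) (t + single v 1) = lookup p t"
    by (simp add: lookup_var_mult lookup_add)
  then have "lookup (var_mpoly v * p) (t + single v 1) \<noteq> 0" using t by simp
  then obtain w where w: "w \<in> V" "lookup (t + single v 1) w \<noteq> 0"
    using assms(2) unfolding in_var_ideal_def by blast
  then have "w \<noteq> v" using assms(1) by auto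
  then show "\<exists>v\<in>V. lookup t v \<noteq> 0"
    using w by (auto simp: lookup_add lookup_single when_def)
qed

lemma in_var_ideal_koszul: "in_var_ideal (set vs) (koszul vs c (replicate (length vs) False))"
proof (induction vs arbitrary: c)
  case (Cons v vs)
  have "in_var_ideal (set (v # vs)) (koszul vs (\<lambda>b. c (False # b)) (replicate (length vs) False))"
    using Cons.IH by (rule in_var_ideal_mono) auto
  then show ?case
    by (simp add: in_var_ideal_add in_var_ideal_var_mult)
qed simp

lemma koszul_exact:
  assumes "distinct vs" "\<And>bs. length bs = length vs \<Longrightarrow> koszul vs c bs = 0"
    "in_var_ideal (set vs) (c (replicate (length vs) False))"
  shows "\<exists>u. \<forall>bs. length bs = length vs \<longrightarrow> koszul vs u bs = c bs"
  using assms
proof (induction vs arbitrary: c)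
  case Nil
  then show ?case by (auto simp: in_var_ideal_empty)
next
  case (Cons v vs)
  let ?n = "length vs"
  define z where "z = replicate ?n False"
  define cT cF where "cT = (\<lambda>b. c (True # b))" and "cF = (\<lambda>b. c (False # b))"
  have T: "koszul vs cT bs = 0" if "length bs = ?n" for bs
    using Cons.prems(2)[of "True # bs"] that by (simp add: cT_def)
  have F: "koszul vs cF bs + var_mpoly v * cT bs = 0" if "length bs = ?n" for bs
    using Cons.prems(2)[of "False # bs"] that by (simp add: cT_def cF_def)
  have "var_mpoly v * cT z = - koszul vs cF z"
    using F[of z] by (simp add: z_def eq_neg_iff_add_eq_0 add.commute)
  then have "in_var_ideal (set vs) (var_mpoly v * cT z)"
    by (simp add: in_var_ideal_uminus in_var_ideal_koszul z_def)
  then have "in_var_ideal (set vs) (cT z)"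
    by (rule in_var_ideal_var_mult_cancel[rotated]) (use Cons.prems in auto)
  then obtain w where w: "\<And>bs. length bs = ?n \<Longrightarrow> koszul vs w bs = cT bs"
    using Cons.IH[of cT] T Cons.prems(1) by (auto simp: z_def)
  obtain a b where ab: "cF z = a + var_mpoly v * b" "\<And>t. t \<in> keys a \<Longrightarrow> t \<in> keys (cF z) \<and> lookup t v = 0"
    using split_var[of "cF z" v] by metis
  have a: "in_var_ideal (set vs) a"
    unfolding in_var_ideal_def
  proof (intro allI impI)
    fix t assume "lookup a t \<noteq> 0"
    then have t: "lookup (cF z) t \<noteq> 0" "lookup t v = 0"
      using ab(2)[of t] by (auto simp: in_keys_iff)
    moreover have "in_var_ideal (set (v # vs)) (cF z)"
      using Cons.prems(3) by (simp add: cF_def z_def)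
    ultimately have "\<exists>w\<in>set (v # vs). lookup t w \<noteq> 0"
      unfolding in_var_ideal_def by blast
    then show "\<exists>w\<in>set vs. lookup t w \<noteq> 0" using t(2) by auto
  qed
  define uT where "uT = (\<lambda>bs. if True \<in> set bs then - w bs else b)"
  have uT: "koszul vs uT bs = - cT bs" if "length bs = ?n" for bs
  proof -
    have "koszul vs uT bs = koszul vs (\<lambda>b. - w b) bs"
      by (rule koszul_cong) (auto simp: uT_def that)
    then show ?thesis using w[OF that] by (simp add: koszul_uminus)
  qed
  have "\<exists>u. \<forall>bs. length bs = ?n \<longrightarrow> koszul vs u bs = cF bs - var_mpoly v * uT bs"
  proof (rule Cons.IH)
    show "koszul vs (\<lambda>bs. cF bs - var_mpoly v * uT bs) bs = 0" if "length bs = ?n" for bs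
      using F[OF that] uT[OF that] by (simp add: koszul_diff koszul_mult)
    have "cF z - var_mpoly v * uT z = a"
      using ab(1) by (simp add: uT_def z_def)
    then show "in_var_ideal (set vs) (cF (replicate ?n False) - var_mpoly v * uT (replicate ?n False))"
      using a by (simp add: z_def)
  qed (use Cons.prems in auto)
  then obtain uF where uF: "\<And>bs. length bs = ?n \<Longrightarrow> koszul vs uF bs = cF bs - var_mpoly v * uT bs"
    by blast
  define u where "u = (\<lambda>bs. if hd bs then uT (tl bs) else uF (tl bs))"
  have "koszul (v # vs) u bs = c bs" if len: "length bs = length (v # vs)" for bs
  proof -
    obtain b bs' where bs: "bs = b # bs'" "length bs' = ?n" using len by (cases bs) auto
    show ?thesis
      using uT[OF bs(2)] uF[OF bs(2)] by (cases b) (simp_all add: bs(1) u_def cT_def cF_def)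
  qed
  then show ?case by blast
qed

section \<open>Koszul homology of graded submodules of free modules\<close>

text \<open>The elements of a free module are functions on natural numbers that vanish outside the rank. A
  graded submodule is the family of its graded components.\<close>

type_synonym ('n, 'k) gmod = "int \<Rightarrow> (nat \<Rightarrow> ('n, 'k) mpoly) set"

definition graded_submodule :: "('n::finite, 'k::field) gmod \<Rightarrow> bool" where
  "graded_submodule Z \<longleftrightarrow> (\<forall>d. 0 \<in> Z d \<and> (\<forall>v\<in>Z d. \<forall>w\<in>Z d. v - w \<in> Z d) \<and>
    (\<forall>v\<in>Z d. \<forall>e p. homogeneous e p \<longrightarrow> (\<lambda>i. p * v i) \<in> Z (d + e)))"

lemma graded_submoduleD:
  assumes "graded_submodule Z"
  shows "0 \<in> Z d" "v \<in> Z d \<Longrightarrow> w \<in> Z d \<Longrightarrow> v - w \<in> Z d"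
    "v \<in> Z d \<Longrightarrow> (\<lambda>i. var_mpoly x * v i) \<in> Z (d + 1)"
    "v \<in> Z d \<Longrightarrow> - v \<in> Z d" "v \<in> Z d \<Longrightarrow> w \<in> Z d \<Longrightarrow> v + w \<in> Z d"
    "v \<in> Z d \<Longrightarrow> homogeneous e p \<Longrightarrow> (\<lambda>i. p * v i) \<in> Z (d + e)"
proof -
  show z: "0 \<in> Z d" and d: "v \<in> Z d \<Longrightarrow> w \<in> Z d \<Longrightarrow> v - w \<in> Z d"
    and m: "v \<in> Z d \<Longrightarrow> homogeneous e p \<Longrightarrow> (\<lambda>i. p * v i) \<in> Z (d + e)" for v w e p
    using assms by (auto simp: graded_submodule_def)
  show "v \<in> Z d \<Longrightarrow> (\<lambda>i. var_mpoly x * v i) \<in> Z (d + 1)"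
    using m by simp
  show m: "v \<in> Z d \<Longrightarrow> - v \<in> Z d" for v
    using d[OF z, of v] by simp
  show "v \<in> Z d \<Longrightarrow> w \<in> Z d \<Longrightarrow> v + w \<in> Z d"
    using d[OF _ m, of v w] by simp
qed

definition var_list :: "'n::finite list" where
  "var_list = (SOME vs. distinct vs \<and> set vs = UNIV)"

lemma var_list: "distinct (var_list :: 'n::finite list)" "set (var_list :: 'n list) = UNIV"
proof -
  have "\<exists>vs :: 'n list. distinct vs \<and> set vs = UNIV"
    by (metis finite finite_distinct_list)
  then have "distinct (var_list :: 'n list) \<and> set (var_list :: 'n list) = UNIV"
    unfolding var_list_def by (rule someI_ex)
  then show "distinct (var_list :: 'n::finite list)" "set (var_list :: 'n list) = UNIV"
    by auto
qed

definition koszul_mod ::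
    "'n list \<Rightarrow> (bool list \<Rightarrow> nat \<Rightarrow> ('n::finite, 'k::field) mpoly) \<Rightarrow> bool list \<Rightarrow> nat \<Rightarrow> ('n, 'k) mpoly" where
  "koszul_mod vs c bs = (\<lambda>i. koszul vs (\<lambda>b. c b i) bs)"

definition koszul_chain ::
    "'n list \<Rightarrow> int \<Rightarrow> int \<Rightarrow> ('n::finite, 'k::field) gmod \<Rightarrow> (bool list \<Rightarrow> nat \<Rightarrow> ('n, 'k) mpoly) \<Rightarrow> bool" where
  "koszul_chain vs p d Z c \<longleftrightarrow>
    (\<forall>bs. if length bs = length vs \<and> weight bs = p then c bs \<in> Z (d - p) else c bs = 0)"

lemma koszul_chainI:
  "(\<And>bs. length bs = length vs \<Longrightarrow> weight bs = p \<Longrightarrow> c bs \<in> Z (d - p)) \<Longrightarrow>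
   (\<And>bs. \<not> (length bs = length vs \<and> weight bs = p) \<Longrightarrow> c bs = 0) \<Longrightarrow> koszul_chain vs p d Z c"
  by (auto simp: koszul_chain_def)

lemma koszul_chainD1: "koszul_chain vs p d Z c \<Longrightarrow> length bs = length vs \<Longrightarrow> weight bs = p \<Longrightarrow> c bs \<in> Z (d - p)"
  by (auto simp: koszul_chain_def)

lemma koszul_chainD2: "koszul_chain vs p d Z c \<Longrightarrow> \<not> (length bs = length vs \<and> weight bs = p) \<Longrightarrow> c bs = 0"
  unfolding koszul_chain_def by presburger

lemma koszul_chain_diff:
  "graded_submodule Z \<Longrightarrow> koszul_chain vs p d Z c \<Longrightarrow> koszul_chain vs p d Z c' \<Longrightarrow>
    koszul_chain vs p d Z (\<lambda>bs. c bs - c' bs)"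
  by (rule koszul_chainI) (simp_all add: koszul_chainD1 koszul_chainD2 graded_submoduleD(2))

lemma koszul_chain_koszul_mod:
  assumes Z: "graded_submodule Z" and "koszul_chain vs (p + 1) d Z c"
  shows "koszul_chain vs p d Z (koszul_mod vs c)"
  using assms(2)
proof (induction vs arbitrary: c p d)
  case Nil
  have "koszul_mod [] c bs = 0" for bs by (simp add: koszul_mod_def fun_eq_iff)
  then show ?case
    by (intro koszul_chainI) (simp_all only: graded_submoduleD(1)[OF Z])
next
  case (Cons v vs)
  have "koszul_chain vs (p - 1 + 1) (d - 1) Z (\<lambda>b. c (True # b))"
    using koszul_chainD1[OF Cons.prems, of "True # _"] koszul_chainD2[OF Cons.prems, of "True # _"]
    by (intro koszul_chainI) (auto simp: algebra_simps)
  then have T: "koszul_chain vs (p - 1) (d - 1) Z (koszul_mod vs (\<lambda>b. c (True # b)))"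
    by (rule Cons.IH)
  have "koszul_chain vs (p + 1) d Z (\<lambda>b. c (False # b))"
    using koszul_chainD1[OF Cons.prems, of "False # _"] koszul_chainD2[OF Cons.prems, of "False # _"]
    by (intro koszul_chainI) (auto simp: algebra_simps)
  then have F: "koszul_chain vs p d Z (koszul_mod vs (\<lambda>b. c (False # b)))"
    by (rule Cons.IH)
  have simps: "koszul_mod (v # vs) c (True # bs) = - koszul_mod vs (\<lambda>b. c (True # b)) bs"
    "koszul_mod (v # vs) c (False # bs) = koszul_mod vs (\<lambda>b. c (False # b)) bs + (\<lambda>i. var_mpoly v * c (True # bs) i)"
    "koszul_mod (v # vs) c [] = 0" for bs
    by (simp_all add: koszul_mod_def fun_eq_iff)
  show ?case
  proof (rule koszul_chainI)
    fix bs :: "bool list" assume bs: "length bs = length (v # vs)" "weight bs = p"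
    then obtain b bs' where b: "bs = b # bs'" "length bs' = length vs" by (cases bs) auto
    show "koszul_mod (v # vs) c bs \<in> Z (d - p)"
    proof (cases b)
      case True
      have "koszul_mod vs (\<lambda>b. c (True # b)) bs' \<in> Z (d - 1 - (p - 1))"
        by (rule koszul_chainD1[OF T]) (use b bs True in auto)
      then show ?thesis using True b by (simp add: simps graded_submoduleD(4)[OF Z])
    next
      case False
      have "koszul_mod vs (\<lambda>b. c (False # b)) bs' \<in> Z (d - p)"
        by (rule koszul_chainD1[OF F]) (use b bs False in auto)
      moreover have "c (True # bs') \<in> Z (d - (p + 1))"
        by (rule koszul_chainD1[OF Cons.prems]) (use b bs False in auto)
      then have "(\<lambda>i. var_mpoly v * c (True # bs') i) \<in> Z (d - (p + 1) + 1)"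
        by (rule graded_submoduleD(3)[OF Z])
      ultimately show ?thesis using False b by (simp add: simps graded_submoduleD(5)[OF Z])
    qed
  next
    fix bs :: "bool list" assume bs: "\<not> (length bs = length (v # vs) \<and> weight bs = p)"
    show "koszul_mod (v # vs) c bs = 0"
    proof (cases bs)
      case (Cons b bs')
      show ?thesis
      proof (cases b)
        case True
        have "koszul_mod vs (\<lambda>b. c (True # b)) bs' = 0"
          by (rule koszul_chainD2[OF T]) (use Cons bs True in auto)
        then show ?thesis using True Cons by (simp add: simps)
      next
        case False
        have "koszul_mod vs (\<lambda>b. c (False # b)) bs' = 0"
          by (rule koszul_chainD2[OF F]) (use Cons bs False in auto)
        moreover have "c (True # bs') = 0"
          by (rule koszul_chainD2[OF Cons.prems]) (use Cons bs False in auto)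
        ultimately show ?thesis using False Cons by (simp add: simps fun_eq_iff)
      qed
    qed (simp add: simps)
  qed
qed

lemma koszul_mod_koszul_mod: "koszul_mod vs (koszul_mod vs c) bs = 0"
  by (simp add: koszul_mod_def fun_eq_iff)

lemma koszul_mod_diff: "koszul_mod vs (\<lambda>b. c b - c' b) bs = koszul_mod vs c bs - koszul_mod vs c' bs"
  by (simp add: koszul_mod_def fun_eq_iff koszul_diff)

text \<open>\<open>koszul_vanishing p d Z\<close> says that the Koszul homology of \<open>Z\<close> in homological degree \<open>p\<close> and
  internal degree \<open>d\<close> is zero.\<close>

definition koszul_vanishing :: "int \<Rightarrow> int \<Rightarrow> ('n::finite, 'k::field) gmod \<Rightarrow> bool" where
  "koszul_vanishing p d Z \<longleftrightarrow> (\<forall>c. koszul_chain var_list p d Z c \<longrightarrow> (\<forall>bs. koszul_mod var_list c bs = 0) \<longrightarrow>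
    (\<exists>u. koszul_chain var_list (p + 1) d Z u \<and> (\<forall>bs. koszul_mod var_list u bs = c bs)))"

definition free_gmod :: "nat \<Rightarrow> (nat \<Rightarrow> int) \<Rightarrow> ('n::finite, 'k::field) gmod" where
  "free_gmod b s d = {v. \<forall>j. if j < b then homogeneous (d - s j) (v j) else v j = 0}"

definition mat_vec :: "nat \<Rightarrow> (nat \<Rightarrow> nat \<Rightarrow> 'a::comm_ring_1) \<Rightarrow> (nat \<Rightarrow> 'a) \<Rightarrow> nat \<Rightarrow> 'a" where
  "mat_vec b g v = (\<lambda>i. \<Sum>j<b. g i j * v j)"

definition ker_gmod :: "nat \<Rightarrow> (nat \<Rightarrow> int) \<Rightarrow> (nat \<Rightarrow> nat \<Rightarrow> ('n::finite, 'k::field) mpoly) \<Rightarrow> ('n, 'k) gmod" where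
  "ker_gmod b s g d = {v \<in> free_gmod b s d. mat_vec b g v = 0}"

lemma mat_vec_diff: "mat_vec b g (v - w) = mat_vec b g v - mat_vec b g w"
  by (simp add: mat_vec_def fun_eq_iff right_diff_distrib sum_subtractf)

lemma mat_vec_0 [simp]: "mat_vec b g 0 = 0"
  by (simp add: mat_vec_def fun_eq_iff)

lemma mat_vec_mult: "mat_vec b g (\<lambda>i. x * v i) = (\<lambda>i. x * mat_vec b g v i)"
  by (simp add: mat_vec_def fun_eq_iff sum_distrib_left mult_ac)

lemma koszul_mod_mat_vec: "koszul_mod vs (\<lambda>bs. mat_vec b g (c bs)) bs = mat_vec b g (koszul_mod vs c bs)"
  by (simp add: koszul_mod_def mat_vec_def fun_eq_iff koszul_sum koszul_mult)

lemma graded_submodule_free: "graded_submodule (free_gmod b s)"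
  unfolding graded_submodule_def free_gmod_def
  by (auto intro: homogeneous_diff homogeneous_mult_eq)

lemma graded_submodule_ker: "graded_submodule (ker_gmod b s g)"
proof -
  note f = graded_submoduleD[OF graded_submodule_free[of b s]]
  show ?thesis
    unfolding graded_submodule_def ker_gmod_def
    using f by (auto simp: mat_vec_diff mat_vec_mult fun_eq_iff)
qed

lemma koszul_chain_mono:
  "koszul_chain vs p d Z c \<Longrightarrow> (\<And>v. v \<in> Z (d - p) \<Longrightarrow> v \<in> Z' (d - p)) \<Longrightarrow> koszul_chain vs p d Z' c"
  by (auto simp: koszul_chain_def)

lemma free_exact:
  assumes c: "koszul_chain var_list p d (free_gmod b s) c" "\<And>bs. koszul_mod var_list c bs = 0"
    and p: "p = 0 \<Longrightarrow> (\<And>j. j < b \<Longrightarrow> lookup (c (replicate (length (var_list :: 'n list)) False) j) 0 = 0)"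
  shows "\<exists>u. koszul_chain var_list (p + 1) d (free_gmod b s) u \<and>
    (\<forall>bs. koszul_mod var_list u bs = (c bs :: nat \<Rightarrow> ('n::finite, 'k::field) mpoly))"
proof -
  let ?vs = "var_list :: 'n list"
  have "\<exists>u. \<forall>bs. length bs = length ?vs \<longrightarrow> koszul ?vs u bs = c bs j" if "j < b" for j
  proof (rule koszul_exact)
    show "koszul ?vs (\<lambda>bs. c bs j) bs = 0" for bs
      using c(2)[of bs] by (simp add: koszul_mod_def fun_eq_iff)
    show "in_var_ideal (set ?vs) (c (replicate (length ?vs) False) j)"
    proof (cases "p = 0")
      case True
      then show ?thesis using p that by (simp add: var_list in_var_ideal_UNIV)
    next
      case False
      then show ?thesis using koszul_chainD2[OF c(1)] by simp
    qed
  qed (rule var_list)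
  then obtain u where u: "\<And>j bs. j < b \<Longrightarrow> length bs = length ?vs \<Longrightarrow> koszul ?vs (u j) bs = c bs j"
    by metis
  define w where "w bs j = (if length bs = length ?vs \<and> j < b then koszul_part (p + 1) (d - s j) (u j) bs else 0)" for bs j
  have w: "koszul_chain ?vs (p + 1) d (free_gmod b s) w"
  proof (rule koszul_chainI)
    fix bs assume "length bs = length ?vs" "weight bs = p + 1"
    moreover have "d - (p + 1) - s j = d - s j - (p + 1)" for j by simp
    ultimately show "w bs \<in> free_gmod b s (d - (p + 1))"
      unfolding w_def free_gmod_def koszul_part_def by (auto simp: algebra_simps)
  qed (auto simp: w_def koszul_part_def fun_eq_iff)
  have "koszul_mod ?vs w bs = c bs" for bs
  proof (cases "length bs = length ?vs")
    case True
    show ?thesis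
    proof
      fix j
      show "koszul_mod ?vs w bs j = c bs j"
      proof (cases "j < b")
        case j: True
        have "koszul_mod ?vs w bs j = koszul ?vs (koszul_part (p + 1) (d - s j) (u j)) bs"
          unfolding koszul_mod_def by (rule koszul_cong) (use True j in \<open>auto simp: w_def\<close>)
        also have "\<dots> = koszul_part p (d - s j) (\<lambda>bs. c bs j) bs"
          using u[OF j True] by (simp add: koszul_koszul_part koszul_part_def)
        also have "\<dots> = c bs j"
        proof (cases "weight bs = p")
          case wt: True
          have "homogeneous (d - p - s j) (c bs j)"
            using koszul_chainD1[OF c(1) True wt] j unfolding free_gmod_def
            by (auto dest!: spec[of _ j])
          moreover have "d - p - s j = d - s j - p" by simp
          ultimately show ?thesis
            using wt by (simp add: koszul_part_def hcomp_homogeneous)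
        next
          case False
          then show ?thesis using koszul_chainD2[OF c(1), of bs] by (simp add: koszul_part_def)
        qed
        finally show ?thesis .
      next
        case False
        then have "c bs j = 0"
        proof (cases "weight bs = p")
          case wt: True
          then show ?thesis
            using koszul_chainD1[OF c(1) True wt] False unfolding free_gmod_def
            by (auto dest!: spec[of _ j])
        qed (use koszul_chainD2[OF c(1), of bs] in simp)
        then show ?thesis using False by (simp add: w_def koszul_mod_def)
      qed
    qed
  next
    case False
    then show ?thesis
      using koszul_chainD2[OF koszul_chain_koszul_mod[OF graded_submodule_free w], of bs]
        koszul_chainD2[OF c(1), of bs] by simp
  qed
  with w show ?thesis by blast
qed

lemma koszul_chain_neg: "koszul_chain vs p d Z c \<Longrightarrow> p < 0 \<Longrightarrow> c bs = 0"
  by (erule koszul_chainD2) (metis weight_nonneg linorder_not_less)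

lemma koszul_vanishing_0D:
  fixes Z :: "('n::finite, 'k::field) gmod"
  assumes Z: "graded_submodule Z" and van: "koszul_vanishing 0 d Z" and z: "z \<in> Z d"
  shows "\<exists>u. koszul_chain var_list 1 d Z u \<and>
    koszul_mod var_list u (replicate (length (var_list :: 'n list)) False) = z"
proof -
  let ?vs = "var_list :: 'n list"
  define c where "c bs = (if bs = replicate (length ?vs) False then z else 0)" for bs
  have c: "koszul_chain ?vs 0 d Z c"
    using z by (auto simp: koszul_chain_def c_def weight_eq_0)
  have "koszul_chain ?vs (- 1) d Z (koszul_mod ?vs c)"
    by (rule koszul_chain_koszul_mod[OF Z]) (use c in simp)
  then have "koszul_mod ?vs c bs = 0" for bs
    by (rule koszul_chain_neg) simp
  then obtain u where "koszul_chain ?vs (0 + 1) d Z u" "\<And>bs. koszul_mod ?vs u bs = c bs"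
    using van c unfolding koszul_vanishing_def by blast
  then show ?thesis by (intro exI[of _ u]) (simp add: c_def)
qed

text \<open>A homogeneous generating system of a graded submodule \<open>Z\<close>: the \<open>b\<close> columns of the matrix \<open>g\<close>,
  of degrees \<open>s\<close>.\<close>

locale presentation =
  fixes b :: nat and s :: "nat \<Rightarrow> int" and g :: "nat \<Rightarrow> nat \<Rightarrow> ('n::finite, 'k::field) mpoly"
    and Z :: "('n, 'k) gmod"
  assumes Z: "graded_submodule Z"
    and cover: "mat_vec b g ` free_gmod b s d = Z d"
begin

abbreviation "\<phi> \<equiv> mat_vec b g"
abbreviation "F \<equiv> free_gmod b s"
abbreviation "K \<equiv> ker_gmod b s g"
abbreviation "vs \<equiv> (var_list :: 'n list)"
abbreviation "\<delta> \<equiv> koszul_mod vs"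

lemma push: "koszul_chain vs p d F c \<Longrightarrow> koszul_chain vs p d Z (\<lambda>bs. \<phi> (c bs))"
  using cover[of "d - p"]
  by (intro koszul_chainI) (auto dest: koszul_chainD1 koszul_chainD2)

lemma lift:
  assumes c: "koszul_chain vs p d Z c"
  shows "\<exists>u. koszul_chain vs p d F u \<and> (\<forall>bs. \<phi> (u bs) = c bs)"
proof -
  define u where "u bs = (if length bs = length vs \<and> weight bs = p
    then SOME v. v \<in> F (d - p) \<and> \<phi> v = c bs else 0)" for bs
  have *: "u bs \<in> F (d - p) \<and> \<phi> (u bs) = c bs" if "length bs = length vs" "weight bs = p" for bs
  proof -
    have "c bs \<in> \<phi> ` F (d - p)"
      unfolding cover using koszul_chainD1[OF c that] .
    then have "\<exists>v. v \<in> F (d - p) \<and> \<phi> v = c bs" by auto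
    from someI_ex[OF this] show ?thesis using that by (simp add: u_def)
  qed
  have 0: "u bs = 0" if "\<not> (length bs = length vs \<and> weight bs = p)" for bs
    using that unfolding u_def by (rule if_not_P)
  have "koszul_chain vs p d F u"
    by (rule koszul_chainI) (use * 0 in blast)+
  moreover have "\<phi> (u bs) = c bs" for bs
  proof (cases "length bs = length vs \<and> weight bs = p")
    case False
    show ?thesis by (simp only: 0[OF False] koszul_chainD2[OF c False] mat_vec_0)
  qed (use * in blast)
  ultimately show ?thesis by blast
qed

lemma ker_chain:
  "koszul_chain vs p d F c \<Longrightarrow> (\<And>bs. \<phi> (c bs) = 0) \<Longrightarrow> koszul_chain vs p d K c"
  by (intro koszul_chainI) (auto simp: ker_gmod_def dest: koszul_chainD1 koszul_chainD2)

lemma ker_chainD: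
  assumes "koszul_chain vs p d K c"
  shows "koszul_chain vs p d F c" "\<phi> (c bs) = 0"
proof -
  show "koszul_chain vs p d F c"
    by (rule koszul_chain_mono[OF assms]) (simp add: ker_gmod_def)
  show "\<phi> (c bs) = 0"
    by (cases "length bs = length vs \<and> weight bs = p")
      (use koszul_chainD1[OF assms] koszul_chainD2[OF assms] in \<open>auto simp: ker_gmod_def\<close>)
qed

lemma koszul_vanishing_Suc:
  assumes p: "p \<ge> 0" and K: "koszul_vanishing p d K"
  shows "koszul_vanishing (p + 1) d Z"
  unfolding koszul_vanishing_def
proof (intro allI impI)
  fix z assume z: "koszul_chain vs (p + 1) d Z z" "\<forall>bs. \<delta> z bs = 0"
  obtain u where u: "koszul_chain vs (p + 1) d F u" "\<And>bs. \<phi> (u bs) = z bs"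
    using lift[OF z(1)] by blast
  have "koszul_chain vs p d K (\<delta> u)"
  proof (rule ker_chain)
    show "koszul_chain vs p d F (\<delta> u)"
      by (rule koszul_chain_koszul_mod[OF graded_submodule_free u(1)])
    show "\<phi> (\<delta> u bs) = 0" for bs
      using z(2) by (simp add: u(2) flip: koszul_mod_mat_vec)
  qed
  then obtain w where w: "koszul_chain vs (p + 1) d K w" "\<And>bs. \<delta> w bs = \<delta> u bs"
    using K unfolding koszul_vanishing_def by (metis koszul_mod_koszul_mod)
  have "\<exists>v. koszul_chain vs (p + 1 + 1) d F v \<and> (\<forall>bs. \<delta> v bs = u bs - w bs)"
  proof (rule free_exact)
    show "koszul_chain vs (p + 1) d F (\<lambda>bs. u bs - w bs)"
      by (intro koszul_chain_diff graded_submodule_free u(1) ker_chainD(1)[OF w(1)])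
    show "\<delta> (\<lambda>bs. u bs - w bs) bs = 0" for bs
      by (simp add: koszul_mod_diff w(2))
  qed (use p in auto)
  then obtain v where v: "koszul_chain vs (p + 1 + 1) d F v" "\<And>bs. \<delta> v bs = u bs - w bs"
    by blast
  show "\<exists>u. koszul_chain vs (p + 1 + 1) d Z u \<and> (\<forall>bs. \<delta> u bs = z bs)"
  proof (intro exI conjI allI)
    show "koszul_chain vs (p + 1 + 1) d Z (\<lambda>bs. \<phi> (v bs))"
      by (rule push[OF v(1)])
    show "\<delta> (\<lambda>bs. \<phi> (v bs)) bs = z bs" for bs
      by (simp add: koszul_mod_mat_vec v(2) mat_vec_diff u(2) ker_chainD(2)[OF w(1)])
  qed
qed

lemma koszul_vanishing_0:
  assumes "\<And>j. j < b \<Longrightarrow> s j \<noteq> d"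
  shows "koszul_vanishing 0 d Z"
  unfolding koszul_vanishing_def
proof (intro allI impI)
  fix z assume z: "koszul_chain vs 0 d Z z" "\<forall>bs. \<delta> z bs = 0"
  obtain u where u: "koszul_chain vs 0 d F u" "\<And>bs. \<phi> (u bs) = z bs"
    using lift[OF z(1)] by blast
  have "\<exists>v. koszul_chain vs (0 + 1) d F v \<and> (\<forall>bs. \<delta> v bs = u bs)"
  proof (rule free_exact[OF u(1)])
    have "koszul_chain vs (- 1) d F (\<delta> u)"
      by (rule koszul_chain_koszul_mod[OF graded_submodule_free]) (use u(1) in simp)
    then show "\<delta> u bs = 0" for bs
      by (rule koszul_chain_neg) simp
    fix j assume j: "j < b"
    have "u (replicate (length vs) False) \<in> F (d - 0)"
      by (rule koszul_chainD1[OF u(1)]) auto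
    then have "homogeneous (d - s j) (u (replicate (length vs) False) j)"
      using j unfolding free_gmod_def by (auto dest!: spec[of _ j])
    then show "lookup (u (replicate (length vs) False) j) 0 = 0"
      using assms[OF j] by (auto simp: homogeneous_alt)
  qed
  then obtain v where v: "koszul_chain vs (0 + 1) d F v" "\<And>bs. \<delta> v bs = u bs"
    by blast
  show "\<exists>u. koszul_chain vs (0 + 1) d Z u \<and> (\<forall>bs. \<delta> u bs = z bs)"
  proof (intro exI conjI allI)
    show "koszul_chain vs (0 + 1) d Z (\<lambda>bs. \<phi> (v bs))"
      by (rule push[OF v(1)])
    show "\<delta> (\<lambda>bs. \<phi> (v bs)) bs = z bs" for bs
      by (simp add: koszul_mod_mat_vec v(2) u(2))
  qed
qed

end

locale minimal_presentation = presentation +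
  assumes minimal: "v \<in> ker_gmod b s g d \<Longrightarrow> j < b \<Longrightarrow> lookup (v j) 0 = 0"
begin

lemma koszul_vanishing_ker:
  assumes p: "p \<ge> 0" and van: "koszul_vanishing (p + 1) d Z"
  shows "koszul_vanishing p d K"
  unfolding koszul_vanishing_def
proof (intro allI impI)
  fix c assume c: "koszul_chain vs p d K c" "\<forall>bs. \<delta> c bs = 0"
  have "\<exists>u. koszul_chain vs (p + 1) d F u \<and> (\<forall>bs. \<delta> u bs = c bs)"
  proof (rule free_exact[OF ker_chainD(1)[OF c(1)]])
    show "\<delta> c bs = 0" for bs using c(2) by simp
    fix j assume "p = 0" "j < b"
    then show "lookup (c (replicate (length vs) False) j) 0 = 0"
      by (intro minimal[of _ "d - p"] koszul_chainD1[OF c(1)]) auto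
  qed
  then obtain u where u: "koszul_chain vs (p + 1) d F u" "\<And>bs. \<delta> u bs = c bs" by blast
  have "\<delta> (\<lambda>bs. \<phi> (u bs)) bs = 0" for bs
    by (simp add: koszul_mod_mat_vec u(2) ker_chainD(2)[OF c(1)])
  then obtain v where v: "koszul_chain vs (p + 1 + 1) d Z v" "\<And>bs. \<delta> v bs = \<phi> (u bs)"
    using van push[OF u(1)] unfolding koszul_vanishing_def by blast
  obtain v' where v': "koszul_chain vs (p + 1 + 1) d F v'" "\<And>bs. \<phi> (v' bs) = v bs"
    using lift[OF v(1)] by blast
  show "\<exists>u. koszul_chain vs (p + 1) d K u \<and> (\<forall>bs. \<delta> u bs = c bs)"
  proof (intro exI conjI allI)
    show "koszul_chain vs (p + 1) d K (\<lambda>bs. u bs - \<delta> v' bs)"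
    proof (rule ker_chain)
      show "koszul_chain vs (p + 1) d F (\<lambda>bs. u bs - \<delta> v' bs)"
        by (intro koszul_chain_diff graded_submodule_free u(1) koszul_chain_koszul_mod v'(1))
      have "\<phi> (\<delta> v' bs) = \<phi> (u bs)" for bs
        by (simp add: v'(2) v(2) flip: koszul_mod_mat_vec)
      then show "\<phi> (u bs - \<delta> v' bs) = 0" for bs
        by (simp add: mat_vec_diff)
    qed
    show "\<delta> (\<lambda>bs. u bs - \<delta> v' bs) bs = c bs" for bs
      by (simp add: koszul_mod_diff koszul_mod_koszul_mod u(2))
  qed
qed

lemma no_generator:
  assumes van: "koszul_vanishing 0 d Z" and j: "j < b"
  shows "s j \<noteq> d"
proof
  assume sj: "s j = d"
  let ?z = "replicate (length vs) False"
  define e where "e i = (if i = j then 1 else 0 :: ('a, 'b) mpoly)" for i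
  have e: "e \<in> F d" using j sj by (auto simp: free_gmod_def e_def)
  obtain u where u: "koszul_chain vs 1 d Z u" "\<delta> u ?z = \<phi> e"
    using koszul_vanishing_0D[OF Z van] e cover by blast
  obtain w where w: "koszul_chain vs (0 + 1) d F w" "\<And>bs. \<phi> (w bs) = u bs"
    using lift[OF u(1)] by auto
  have "koszul_chain vs 0 d F (\<delta> w)"
    by (rule koszul_chain_koszul_mod[OF graded_submodule_free w(1)])
  from koszul_chainD1[OF this, of ?z] have wF: "\<delta> w ?z \<in> F d" by simp
  have "\<phi> (\<delta> w ?z) = \<phi> e"
    by (simp add: w(2) u(2) flip: koszul_mod_mat_vec)
  then have "e - \<delta> w ?z \<in> K d"
    using graded_submoduleD(2)[OF graded_submodule_free e wF] by (simp add: ker_gmod_def mat_vec_diff)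
  from minimal[OF this j] have "lookup (\<delta> w ?z j) 0 = 1"
    by (simp add: e_def lookup_minus)
  moreover have "lookup (\<delta> w ?z j) 0 = 0"
    using in_var_ideal_koszul[of vs "\<lambda>b. w b j"]
    by (simp add: koszul_mod_def var_list in_var_ideal_UNIV)
  ultimately show False by simp
qed

lemma koszul_vanishing_iff: "p \<ge> 0 \<Longrightarrow> koszul_vanishing p d K \<longleftrightarrow> koszul_vanishing (p + 1) d Z"
  using koszul_vanishing_ker koszul_vanishing_Suc by blast

lemma koszul_vanishing_0_iff: "koszul_vanishing 0 d Z \<longleftrightarrow> (\<forall>j<b. s j \<noteq> d)"
  using koszul_vanishing_0 no_generator by blast

end

section \<open>Existence of minimal generating systems\<close>

interpretation gvec: vector_space
  "\<lambda>c (v :: nat \<Rightarrow> ('n::finite, 'k::field) mpoly). (\<lambda>i. smult_mpoly c (v i))"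
  by unfold_locales
    (simp_all add: fun_eq_iff mpoly.scale_right_distrib mpoly.scale_left_distrib)

abbreviation lincomb :: "(nat \<Rightarrow> ('n::finite, 'k::field) mpoly) set \<Rightarrow> ((nat \<Rightarrow> ('n, 'k) mpoly) \<Rightarrow> 'k) \<Rightarrow> nat \<Rightarrow> ('n, 'k) mpoly"
  where "lincomb B c \<equiv> (\<Sum>v\<in>B. (\<lambda>i. smult_mpoly (c v) (v i)))"

lemma sum_fun_apply: "(\<Sum>i\<in>A. f i) x = (\<Sum>i\<in>A. f i x)"
  by (induction A rule: infinite_finite_induct) simp_all

lemma finite_monom_deg: "finite {t :: 'n::finite \<Rightarrow>\<^sub>0 nat. monom_deg t = d}"
proof (rule inj_on_finite[where f = lookup])
  show "inj_on lookup {t :: 'n \<Rightarrow>\<^sub>0 nat. monom_deg t = d}"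
    by (auto simp: inj_on_def intro: poly_mapping_eqI)
  have "lookup t i \<le> monom_deg t" for t :: "'n \<Rightarrow>\<^sub>0 nat" and i
    unfolding monom_deg_def by (intro member_le_sum[of i]) auto
  then show "lookup ` {t :: 'n \<Rightarrow>\<^sub>0 nat. monom_deg t = d}
      \<subseteq> {f. \<forall>i. (i \<in> UNIV \<longrightarrow> f i \<in> {..d}) \<and> (i \<notin> UNIV \<longrightarrow> f i = 0)}"
    by auto
  show "finite {f :: 'n \<Rightarrow> nat. \<forall>i. (i \<in> UNIV \<longrightarrow> f i \<in> {..d}) \<and> (i \<notin> UNIV \<longrightarrow> f i = 0)}"
    by (rule finite_set_of_finite_funs) auto
qed

lemma free_gmod_finite_dim:
  "\<exists>T. finite T \<and> (free_gmod a t d :: (nat \<Rightarrow> ('n::finite, 'k::field) mpoly) set) \<subseteq> gvec.span T"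
proof -
  define M where "M j = {m :: 'n \<Rightarrow>\<^sub>0 nat. int (monom_deg m) = d - t j}" for j
  have M: "finite (M j)" for j
    unfolding M_def by (rule finite_subset[OF _ finite_monom_deg[of "nat (d - t j)"]]) auto
  define e :: "nat \<Rightarrow> ('n \<Rightarrow>\<^sub>0 nat) \<Rightarrow> nat \<Rightarrow> ('n, 'k) mpoly"
    where "e j m i = (if i = j then single m 1 else 0)" for j m i
  define T where "T = (\<Union>j<a. e j ` M j)"
  have "v \<in> gvec.span T" if v: "v \<in> free_gmod a t d" for v
  proof -
    have "v = (\<Sum>j<a. \<Sum>m\<in>M j. (\<lambda>i. smult_mpoly (lookup (v j) m) (e j m i)))"
    proof
      fix i
      have *: "(\<Sum>m\<in>M j. smult_mpoly (lookup (v j) m) (e j m i)) = (if j = i then v i else 0)" if "j < a" for j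
      proof (cases "j = i")
        case True
        have "keys (v j) \<subseteq> M j"
          using v that unfolding free_gmod_def M_def homogeneous_def by (auto dest!: spec[of _ j])
        from poly_mapping_sum_single[OF M this] show ?thesis
          using True by (simp add: e_def smult_mpoly_def const_mpoly_def mult_single)
      qed (simp add: e_def)
      have "(\<Sum>j<a. \<Sum>m\<in>M j. (\<lambda>i. smult_mpoly (lookup (v j) m) (e j m i))) i =
        (\<Sum>j<a. \<Sum>m\<in>M j. smult_mpoly (lookup (v j) m) (e j m i))"
        by (simp add: sum_fun_apply)
      also have "\<dots> = (\<Sum>j<a. if j = i then v i else 0)"
        by (intro sum.cong refl *) simp
      also have "\<dots> = v i"
        using v by (auto simp: free_gmod_def)
      finally show "v i = (\<Sum>j<a. \<Sum>m\<in>M j. (\<lambda>i. smult_mpoly (lookup (v j) m) (e j m i))) i" ..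
    qed
    moreover have "\<dots> \<in> gvec.span T"
      by (intro gvec.span_sum gvec.span_scale gvec.span_base) (auto simp: T_def)
    ultimately show ?thesis by simp
  qed
  moreover have "finite T" unfolding T_def using M by auto
  ultimately show ?thesis by blast
qed

text \<open>The part of \<open>\<mm> Z\<close> in degree \<open>d\<close>.\<close>

definition decomposable :: "('n::finite, 'k::field) gmod \<Rightarrow> int \<Rightarrow> (nat \<Rightarrow> ('n, 'k) mpoly) set" where
  "decomposable Z d = gvec.span {(\<lambda>i. p * v i) | e p v. e > 0 \<and> homogeneous e p \<and> v \<in> Z (d - e)}"

lemma gmod_subspace: "graded_submodule Z \<Longrightarrow> gvec.subspace (Z d)"
  using graded_submoduleD(1,5)[where Z = Z and d = d]
    graded_submoduleD(6)[where Z = Z and d = d and e = 0, OF _ _ homogeneous_const]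
  by (intro gvec.subspaceI) (simp_all add: smult_mpoly_def)

lemma decomposable_subset:
  fixes Z :: "('n::finite, 'k::field) gmod"
  assumes "graded_submodule Z"
  shows "decomposable Z d \<subseteq> Z d"
  unfolding decomposable_def
proof (rule gvec.span_minimal[OF _ gmod_subspace[OF assms]], clarify)
  fix e v and p :: "('n, 'k) mpoly" assume "homogeneous e p" "v \<in> Z (d - e)"
  from graded_submoduleD(6)[OF assms this(2,1)] show "(\<lambda>i. p * v i) \<in> Z d" by simp
qed

lemma decomposable_mult:
  "e > 0 \<Longrightarrow> homogeneous e p \<Longrightarrow> v \<in> Z (d - e) \<Longrightarrow> (\<lambda>i. p * v i) \<in> decomposable Z d"
  unfolding decomposable_def by (rule gvec.span_base) blast

lemma koszul_mod_decomposable: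
  assumes "\<And>bs. length bs = length vs \<Longrightarrow> weight bs = 1 \<Longrightarrow> u bs \<in> Z (d - 1)"
  shows "koszul_mod vs u (replicate (length vs) False) \<in> decomposable Z d"
  using assms
proof (induction vs arbitrary: u)
  case Nil
  then show ?case
    by (simp add: koszul_mod_def decomposable_def gvec.span_zero flip: zero_fun_def)
next
  case (Cons v vs)
  let ?z = "replicate (length vs) False"
  have "koszul_mod vs (\<lambda>b. u (False # b)) ?z \<in> decomposable Z d"
    by (rule Cons.IH) (use Cons.prems in auto)
  moreover have "(\<lambda>i. var_mpoly v * u (True # ?z) i) \<in> decomposable Z d"
    by (rule decomposable_mult[of 1]) (use Cons.prems in auto)
  moreover have "koszul_mod (v # vs) u (replicate (length (v # vs)) False) =
      koszul_mod vs (\<lambda>b. u (False # b)) ?z + (\<lambda>i. var_mpoly v * u (True # ?z) i)"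
    by (simp add: koszul_mod_def fun_eq_iff)
  ultimately show ?case
    unfolding decomposable_def by (simp only: gvec.span_add)
qed

lemma koszul_vanishing_0_decomposable:
  assumes Z: "graded_submodule Z" and van: "koszul_vanishing 0 d Z"
  shows "Z d \<subseteq> decomposable (Z :: ('n::finite, 'k::field) gmod) d"
proof
  fix z assume z: "z \<in> Z d"
  let ?vs = "var_list :: 'n list"
  obtain u where u: "koszul_chain ?vs 1 d Z u" "koszul_mod ?vs u (replicate (length ?vs) False) = z"
    using koszul_vanishing_0D[OF Z van z] by blast
  show "z \<in> decomposable Z d"
    unfolding u(2)[symmetric] by (rule koszul_mod_decomposable) (use koszul_chainD1[OF u(1)] in simp)
qed

lemma complement_basis:
  fixes Z :: "('n::finite, 'k::field) gmod"
  assumes Z: "graded_submodule Z" and sub: "Z d \<subseteq> free_gmod a t d"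
  shows "\<exists>B. finite B \<and> B \<subseteq> Z d \<and>
    (\<forall>z\<in>Z d. \<exists>c. z - lincomb B c \<in> decomposable Z d) \<and>
    (\<forall>c. lincomb B c \<in> decomposable Z d \<longrightarrow> (\<forall>v\<in>B. c v = 0))"
proof -
  let ?U = "decomposable Z d"
  obtain A where A: "A \<subseteq> ?U" "gvec.independent A" "?U \<subseteq> gvec.span A"
    using gvec.maximal_independent_subset[of ?U] by blast
  have "A \<subseteq> Z d" using A(1) decomposable_subset[OF Z] by blast
  from gvec.maximal_independent_subset_extend[OF this A(2)]
  obtain C where C: "A \<subseteq> C" "C \<subseteq> Z d" "gvec.independent C" "Z d \<subseteq> gvec.span C"
    by blast
  obtain T :: "(nat \<Rightarrow> ('n, 'k) mpoly) set" where T: "finite T" "free_gmod a t d \<subseteq> gvec.span T"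
    using free_gmod_finite_dim by blast
  have fC: "finite C"
    using gvec.independent_span_bound[OF T(1) C(3)] C(2) sub T(2) by blast
  then have fA: "finite A" using C(1) finite_subset by blast
  define B where "B = C - A"
  have split: "lincomb C c =
      lincomb A c + lincomb B c" for c
    unfolding B_def using fC C(1) by (simp add: sum.subset_diff add.commute)
  have UA: "?U = gvec.span A"
    by (rule gvec.span_subspace[OF A(1,3), symmetric]) (simp add: decomposable_def)
  show ?thesis
  proof (intro exI[of _ B] conjI ballI allI impI)
    show "finite B" using fC by (simp add: B_def)
    show "B \<subseteq> Z d" using C by (auto simp: B_def)
  next
    fix z assume "z \<in> Z d"
    then have "z \<in> gvec.span C" using C by blast
    then obtain c where c: "z = lincomb C c"
      using fC by (auto simp: gvec.span_finite)
    have "z - lincomb B c = lincomb A c"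
      unfolding c split by simp
    also have "\<dots> \<in> ?U"
      unfolding UA by (intro gvec.span_sum gvec.span_scale gvec.span_base)
    finally show "\<exists>c. z - lincomb B c \<in> ?U" by (rule exI[where x = c])
  next
    fix c v assume c: "lincomb B c \<in> ?U" and v: "v \<in> B"
    obtain a where a: "lincomb B c = lincomb A a"
      using c fA by (auto simp: UA gvec.span_finite)
    define h where "h v = (if v \<in> A then - a v else c v)" for v
    have "lincomb C h =
        (\<Sum>v\<in>A. (\<lambda>i. smult_mpoly (- a v) (v i))) + lincomb B c"
      unfolding split by (intro arg_cong2[where f="(+)"] sum.cong) (auto simp: h_def B_def)
    also have "\<dots> = 0"
      unfolding a by (simp add: fun_eq_iff sum_fun_apply mpoly.scale_minus_left sum_negf)
    finally have "h v = 0"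
      using gvec.independentD[OF C(3) fC order_refl] v by (auto simp: B_def)
    then show "c v = 0" using v by (auto simp: h_def B_def)
  qed
qed

lemma minimal_presentation_exists:
  fixes Z :: "('n::finite, 'k::field) gmod"
  assumes Z: "graded_submodule Z" and sub: "\<And>d. Z d \<subseteq> free_gmod a t d"
    and van: "\<And>d. d > D \<Longrightarrow> koszul_vanishing 0 d Z"
  shows "\<exists>b s g. minimal_presentation b s g Z"
proof -
  let ?P = "\<lambda>d B. finite B \<and> B \<subseteq> Z d \<and>
    (\<forall>z\<in>Z d. \<exists>c. z - lincomb B c \<in> decomposable Z d) \<and>
    (\<forall>c. lincomb B c \<in> decomposable Z d \<longrightarrow> (\<forall>v\<in>B. c v = 0))"
  have "\<forall>d. \<exists>B. ?P d B"
    using complement_basis[OF Z sub] by (rule allI)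
  from choice[OF this] obtain B where P: "\<forall>d. ?P d (B d)" by (rule exE)
  have B: "finite (B d)" "B d \<subseteq> Z d"
    "z \<in> Z d \<Longrightarrow> \<exists>c. z - lincomb (B d) c \<in> decomposable Z d"
    "lincomb (B d) c \<in> decomposable Z d \<Longrightarrow> v \<in> B d \<Longrightarrow> c v = 0"
    for d z c v
    using P[rule_format, of d] by simp_all
  define lo where "lo = Min (insert 0 (t ` {..<a}))"
  have lo: "Z d = {0}" if "d < lo" for d
  proof -
    have "v = 0" if v: "v \<in> free_gmod a t d" for v :: "nat \<Rightarrow> ('n, 'k) mpoly"
    proof
      fix j
      show "v j = 0 j"
      proof (cases "j < a")
        case True
        then have "lo \<le> t j" unfolding lo_def by (intro Min_le) auto
        then have "d - t j < 0" using \<open>d < lo\<close> by simp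
        moreover have "homogeneous (d - t j) (v j)"
          using v True unfolding free_gmod_def by (auto dest!: spec[of _ j])
        ultimately have "v j = 0" by (rule homogeneous_neg[rotated])
        then show ?thesis by simp
      next
        case False
        then show ?thesis using v unfolding free_gmod_def by (auto dest!: spec[of _ j])
      qed
    qed
    then show ?thesis using sub[of d] graded_submoduleD(1)[OF Z, of d] by auto
  qed
  have B_empty: "B d = {}" if "Z d \<subseteq> decomposable Z d" for d
  proof (rule ccontr)
    assume "B d \<noteq> {}"
    then obtain v where v: "v \<in> B d" by blast
    have "(\<Sum>w\<in>B d. (\<lambda>i. smult_mpoly (if w = v then 1 else 0) (w i))) = (\<Sum>w\<in>B d. if w = v then v else 0)"
      by (intro sum.cong refl) (auto simp: fun_eq_iff)
    also have "\<dots> = v" using v B(1) by simp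
    also have "v \<in> decomposable Z d" using v B(2) that by blast
    finally have "(if v = v then 1 else 0 :: 'k) = 0"
      by (rule B(4)[where c = "\<lambda>w. if w = v then 1 else 0"]) (rule v)
    then show False by simp
  qed
  have B_hi: "B d = {}" if "d > D" for d
    by (rule B_empty, rule koszul_vanishing_0_decomposable[OF Z van[OF that]])
  have B_lo: "B d = {}" if "d < lo" for d
    by (rule B_empty) (simp add: lo[OF that] decomposable_def gvec.span_zero)
  define T where "T = Sigma {lo..D} B"
  have T: "(d, v) \<in> T \<longleftrightarrow> v \<in> B d" for d v
    using B_lo[of d] B_hi[of d] by (auto simp: T_def not_less[symmetric])
  have "finite T" unfolding T_def by (intro finite_SigmaI B(1)) simp
  then obtain h where h: "bij_betw h {..<card T} T"
    using ex_bij_betw_nat_finite[of T] by (auto simp: atLeast0LessThan)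
  define b s g where "b = card T" and "s j = fst (h j)" and "g i j = snd (h j) i" for i j
  have h': "snd (h j) \<in> B (s j)" if "j < b" for j
    using bij_betwE[OF h] that T by (metis b_def lessThan_iff prod.collapse s_def)
  have col: "(\<lambda>i. g i j) \<in> Z (s j)" if "j < b" for j
    using h'[OF that] B(2) by (auto simp: g_def)
  have mv: "mat_vec b g w = (\<Sum>j<b. (\<lambda>i. w j * g i j))" for w
    by (simp add: mat_vec_def fun_eq_iff sum_fun_apply mult.commute)
  have subZ: "mat_vec b g w \<in> Z d" if w: "w \<in> free_gmod b s d" for w d
    unfolding mv
  proof (rule gvec.subspace_sum[OF gmod_subspace[OF Z]])
    fix j assume "j \<in> {..<b}"
    then have j: "j < b" by simp
    then have "homogeneous (d - s j) (w j)"
      using w unfolding free_gmod_def by (auto dest!: spec[of _ j])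
    from graded_submoduleD(6)[OF Z col[OF j] this] show "(\<lambda>i. w j * g i j) \<in> Z d" by simp
  qed
  let ?Im = "\<lambda>d. mat_vec b g ` free_gmod b s d"
  have Im_mult: "(\<lambda>i. p * v i) \<in> ?Im (d + e)" if p: "homogeneous e p" and v: "v \<in> ?Im d" for p v d e
  proof -
    obtain w where w: "w \<in> free_gmod b s d" "v = mat_vec b g w" using v by blast
    have "(\<lambda>i. p * w i) \<in> free_gmod b s (d + e)"
      by (rule graded_submoduleD(6)[OF graded_submodule_free w(1) p])
    then show ?thesis unfolding w(2) mat_vec_mult[symmetric] by (rule imageI)
  qed
  have Im_subspace: "gvec.subspace (?Im d)" for d
    unfolding gvec.subspace_def
  proof (intro conjI ballI allI)
    show "0 \<in> ?Im d"
      using graded_submoduleD(1)[OF graded_submodule_free[of b s], of d] mat_vec_0[of b g] by (metis imageI)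
    fix x assume x: "x \<in> ?Im d"
    show "(\<lambda>i. smult_mpoly c (x i)) \<in> ?Im d" for c
      using Im_mult[OF homogeneous_const x, of c] by (simp add: smult_mpoly_def)
    fix y assume "y \<in> ?Im d"
    then obtain v w where vw: "v \<in> free_gmod b s d" "w \<in> free_gmod b s d" "x = mat_vec b g v" "y = mat_vec b g w"
      using x by blast
    have "x + y = mat_vec b g (v + w)"
      by (simp add: vw mat_vec_def fun_eq_iff distrib_left sum.distrib)
    then show "x + y \<in> ?Im d"
      using graded_submoduleD(5)[OF graded_submodule_free vw(1,2)] by blast
  qed
  have "Z d \<subseteq> ?Im d" for d
  proof (induction "nat (d - lo + 1)" arbitrary: d rule: less_induct)
    case less
    show ?case
    proof (cases "d < lo")
      case True
      then show ?thesis using lo gvec.subspace_0[OF Im_subspace, of d] by simp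
    next
      case False
      have dec: "decomposable Z d \<subseteq> ?Im d"
        unfolding decomposable_def
      proof (rule gvec.span_minimal[OF _ Im_subspace], clarify)
        fix e v and p :: "('n, 'k) mpoly" assume e: "0 < e" "homogeneous e p" "v \<in> Z (d - e)"
        have "Z (d - e) \<subseteq> ?Im (d - e)"
          by (rule less) (use e False in auto)
        from Im_mult[OF e(2) subsetD[OF this e(3)]] show "(\<lambda>i. p * v i) \<in> ?Im d" by simp
      qed
      have BIm: "v \<in> ?Im d" if v: "v \<in> B d" for v
      proof -
        obtain j where j: "j < b" "h j = (d, v)"
          using T[of d v] v h unfolding bij_betw_def b_def by (metis imageE lessThan_iff)
        let ?e = "\<lambda>i. if i = j then 1 else 0 :: ('n, 'k) mpoly"
        have "?e \<in> free_gmod b s d"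
          using j by (auto simp: free_gmod_def s_def)
        moreover have "v = mat_vec b g ?e"
          using j by (simp add: mat_vec_def fun_eq_iff g_def if_distrib cong: if_cong)
        ultimately show ?thesis by blast
      qed
      show ?thesis
      proof
        fix z assume "z \<in> Z d"
        then obtain c where c: "z - lincomb (B d) c \<in> decomposable Z d"
          using B(3) by blast
        have "lincomb (B d) c \<in> ?Im d"
          by (intro gvec.subspace_sum[OF Im_subspace] gvec.subspace_scale[OF Im_subspace] BIm)
        from gvec.subspace_add[OF Im_subspace subsetD[OF dec c] this] show "z \<in> ?Im d" by simp
      qed
    qed
  qed
  then have cover: "?Im d = Z d" for d using subZ by blast
  have minimal: "lookup (w j) 0 = 0" if w: "w \<in> ker_gmod b s g d" and j: "j < b" for w d j
  proof (cases "s j = d")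
    case False
    have "homogeneous (d - s j) (w j)"
      using w j unfolding ker_gmod_def free_gmod_def by (auto dest!: spec[of _ j])
    then show ?thesis using False by (auto simp: homogeneous_alt)
  next
    case True
    define S where "S = {j. j < b \<and> s j = d}"
    have hom: "homogeneous (d - s i) (w i)" if "i < b" for i
      using w that unfolding ker_gmod_def free_gmod_def by (auto dest!: spec[of _ i])
    have inj: "inj_on (\<lambda>j. snd (h j)) S"
      using h unfolding S_def s_def b_def bij_betw_def inj_on_def by (auto simp: prod_eq_iff)
    have img: "(\<lambda>j. snd (h j)) ` S = B d"
    proof (intro equalityI subsetI)
      fix v assume "v \<in> (\<lambda>j. snd (h j)) ` S"
      then show "v \<in> B d" using h' by (auto simp: S_def)
    next
      fix v assume "v \<in> B d"
      then obtain j where "j < b" "h j = (d, v)"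
        using T[of d v] h unfolding bij_betw_def b_def by (metis imageE lessThan_iff)
      then show "v \<in> (\<lambda>j. snd (h j)) ` S"
        by (auto simp: S_def s_def intro!: image_eqI[of _ _ j])
    qed
    have S: "S \<subseteq> {..<b}" by (auto simp: S_def)
    define c where "c v = lookup (w (the_inv_into S (\<lambda>j. snd (h j)) v)) 0" for v
    have c: "c (snd (h j)) = lookup (w j) 0" if "j \<in> S" for j
      using the_inv_into_f_f[OF inj that] by (simp add: c_def)
    have "lincomb (B d) c = (\<Sum>j\<in>S. (\<lambda>i. smult_mpoly (c (snd (h j))) (g i j)))"
      unfolding img[symmetric] by (subst sum.reindex[OF inj]) (simp add: g_def)
    also have "\<dots> = (\<Sum>j\<in>S. (\<lambda>i. w j * g i j))"
    proof (rule sum.cong[OF refl])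
      fix j assume j: "j \<in> S"
      then have "homogeneous 0 (w j)" using hom[of j] by (simp add: S_def)
      then show "(\<lambda>i. smult_mpoly (c (snd (h j))) (g i j)) = (\<lambda>i. w j * g i j)"
        using homogeneous_degree_0[of "w j"] by (simp add: c[OF j] smult_mpoly_def)
    qed
    also have "\<dots> = (\<Sum>j<b. (\<lambda>i. w j * g i j)) - (\<Sum>j\<in>{..<b} - S. (\<lambda>i. w j * g i j))"
      using S by (simp add: sum.subset_diff)
    also have "(\<Sum>j<b. (\<lambda>i. w j * g i j)) = 0"
      using w by (simp add: ker_gmod_def flip: mv)
    also have "0 - (\<Sum>j\<in>{..<b} - S. (\<lambda>i. w j * g i j)) \<in> decomposable Z d"
      unfolding decomposable_def
    proof (intro gvec.span_diff gvec.span_zero gvec.span_sum, fold decomposable_def)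
      fix i assume "i \<in> {..<b} - S"
      then have i: "i < b" "d - s i \<noteq> 0" by (auto simp: S_def)
      show "(\<lambda>k. w i * g k i) \<in> decomposable Z d"
      proof (cases "d - s i < 0")
        case True
        then have "w i = 0" using hom[OF i(1)] homogeneous_neg by blast
        then show ?thesis using gvec.span_zero by (simp add: decomposable_def zero_fun_def)
      next
        case False
        then show ?thesis
          using i col[OF i(1)] by (intro decomposable_mult[OF _ hom[OF i(1)]]) auto
      qed
    qed
    finally have "c (snd (h j)) = 0"
      by (rule B(4)) (use h'[OF j] True in simp)
    then show ?thesis using c[of j] j True by (simp add: S_def)
  qed
  have "minimal_presentation b s g Z"
    by unfold_locales (use Z cover minimal in auto)
  then show ?thesis by blast
qed

section \<open>Resolutions and regularity\<close>

definition ideal_gmod :: "('n::finite, 'k::field) mpoly set \<Rightarrow> ('n, 'k) gmod" where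
  "ideal_gmod I d = {v. v 0 \<in> I \<and> homogeneous d (v 0) \<and> (\<forall>i>0. v i = 0)}"

lemma graded_submodule_ideal:
  assumes "ideal.subspace I"
  shows "graded_submodule (ideal_gmod I)"
  unfolding graded_submodule_def ideal_gmod_def
  using assms by (auto simp: ideal.subspace_0 ideal.subspace_diff ideal.subspace_scale
      intro!: homogeneous_diff homogeneous_mult_eq)

lemma ideal_gmod_free: "ideal_gmod I d \<subseteq> free_gmod 1 (\<lambda>_. 0) d"
  by (auto simp: ideal_gmod_def free_gmod_def)

definition homogeneous_ideal :: "('n::finite, 'k::field) mpoly set \<Rightarrow> bool" where
  "homogeneous_ideal I \<longleftrightarrow> ideal.subspace I \<and> (\<forall>p\<in>I. \<forall>d. hcomp d p \<in> I)"

lemma in_ideal_span_image: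
  fixes g :: "'i \<Rightarrow> 'a::comm_ring_1"
  assumes "finite A"
  shows "x \<in> ideal.span (g ` A) \<longleftrightarrow> (\<exists>q. x = (\<Sum>j\<in>A. g j * q j))"
proof
  assume "x \<in> ideal.span (g ` A)"
  then show "\<exists>q. x = (\<Sum>j\<in>A. g j * q j)"
  proof (induction rule: ideal.span_induct_alt)
    case base
    show ?case by (rule exI[of _ "\<lambda>_. 0"]) simp
  next
    case (step c y z)
    then obtain q j where q: "z = (\<Sum>j\<in>A. g j * q j)" and j: "j \<in> A" "y = g j" by blast
    have "(\<Sum>i\<in>A. g i * (if i = j then c else 0)) = (\<Sum>i\<in>A. if i = j then g j * c else 0)"
      by (rule sum.cong) auto
    also have "\<dots> = c * y" using assms j by (simp add: mult.commute)
    finally have "c * y + z = (\<Sum>i\<in>A. g i * (q i + (if i = j then c else 0)))"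
      by (simp add: q distrib_left sum.distrib)
    then show ?case by (rule exI[where x = "\<lambda>i. q i + (if i = j then c else 0)"])
  qed
next
  assume "\<exists>q. x = (\<Sum>j\<in>A. g j * q j)"
  then obtain q where "x = (\<Sum>j\<in>A. q j * g j)" by (auto simp: mult.commute)
  moreover have "\<dots> \<in> ideal.span (g ` A)"
    by (intro ideal.span_sum ideal.span_scale ideal.span_base imageI)
  ultimately show "x \<in> ideal.span (g ` A)" by simp
qed

lemma in_homogeneous_span_image:
  fixes g :: "'i \<Rightarrow> ('n::finite, 'k::field) mpoly"
  assumes "finite A" "\<And>j. j \<in> A \<Longrightarrow> homogeneous (s j) (g j)"
    "x \<in> ideal.span (g ` A)"
  shows "\<exists>q. (\<forall>j. homogeneous (d - s j) (q j)) \<and> hcomp d x = (\<Sum>j\<in>A. g j * q j)"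
proof -
  obtain q where "x = (\<Sum>j\<in>A. g j * q j)"
    using assms(3) in_ideal_span_image[OF assms(1)] by blast
  then have "hcomp d x = (\<Sum>j\<in>A. g j * hcomp (d - s j) (q j))"
    by (simp add: hcomp_sum hcomp_mult[OF assms(2)] cong: sum.cong)
  then show ?thesis by (intro exI[of _ "\<lambda>j. hcomp (d - s j) (q j)"]) simp
qed

lemma homogeneous_ideal_span:
  fixes g :: "'i \<Rightarrow> ('n::finite, 'k::field) mpoly"
  assumes "finite A" "\<And>j. j \<in> A \<Longrightarrow> homogeneous (s j) (g j)"
  shows "homogeneous_ideal (ideal.span (g ` A))"
  unfolding homogeneous_ideal_def
proof (intro conjI ballI allI)
  fix p d assume "p \<in> ideal.span (g ` A)"
  from in_homogeneous_span_image[OF assms this, of d]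
  show "hcomp d p \<in> ideal.span (g ` A)"
    using in_ideal_span_image[OF assms(1)] by metis
qed (rule ideal.subspace_span)

definition res_mat ::
    "('n::finite, 'k::field) mpoly graded_free_complex \<Rightarrow> nat \<Rightarrow> nat \<Rightarrow> nat \<Rightarrow> ('n, 'k) mpoly" where
  "res_mat F k = (case k of 0 \<Rightarrow> \<lambda>i j. if i = 0 then aug F j else 0
     | Suc k' \<Rightarrow> \<lambda>i j. if i < rk F k' then diff F k' i j else 0)"

abbreviation res_free ::
    "('n::finite, 'k::field) mpoly graded_free_complex \<Rightarrow> nat \<Rightarrow> ('n, 'k) gmod" where
  "res_free F k \<equiv> free_gmod (rk F k) (shift F k)"

abbreviation res_map ::
    "('n::finite, 'k::field) mpoly graded_free_complex \<Rightarrow> nat \<Rightarrow> (nat \<Rightarrow> ('n, 'k) mpoly) \<Rightarrow> nat \<Rightarrow> ('n, 'k) mpoly" where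
  "res_map F k \<equiv> mat_vec (rk F k) (res_mat F k)"

definition res_gmod ::
    "('n::finite, 'k::field) mpoly graded_free_complex \<Rightarrow> ('n, 'k) mpoly set \<Rightarrow> nat \<Rightarrow> ('n, 'k) gmod" where
  "res_gmod F I k = (case k of 0 \<Rightarrow> ideal_gmod I
     | Suc k' \<Rightarrow> ker_gmod (rk F k') (shift F k') (res_mat F k'))"

lemma mat_vec_aug: "res_map F 0 v = 0 \<longleftrightarrow> (\<Sum>j<rk F 0. aug F j * v j) = 0"
proof -
  have "res_map F 0 v = (\<lambda>i. if i = 0 then \<Sum>j<rk F 0. aug F j * v j else 0)"
    by (auto simp: mat_vec_def res_mat_def fun_eq_iff)
  then show ?thesis by (auto simp: fun_eq_iff)
qed

lemma mat_vec_diff_matrix: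
  "res_map F (Suc k) v = 0 \<longleftrightarrow>
    (\<forall>i<rk F k. (\<Sum>j<rk F (Suc k). diff F k i j * v j) = 0)"
proof -
  have "res_map F (Suc k) v =
      (\<lambda>i. if i < rk F k then \<Sum>j<rk F (Suc k). diff F k i j * v j else 0)"
    by (auto simp: mat_vec_def res_mat_def fun_eq_iff)
  then show ?thesis by (auto simp: fun_eq_iff)
qed

lemma all_nat_split: "(\<forall>k. P k) \<longleftrightarrow> P 0 \<and> (\<forall>k. P (Suc k))"
  by (metis not0_implies_Suc)

lemma exact_over_iff:
  "exact_over F I \<longleftrightarrow> ideal.span (aug F ` {..<rk F 0}) = I \<and>
    (\<forall>k v. res_map F k v = 0 \<longleftrightarrow>
       (\<exists>w. \<forall>i<rk F k. v i = (\<Sum>j<rk F (Suc k). diff F k i j * w j)))"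
proof -
  have "(\<forall>k v. res_map F k v = 0 \<longleftrightarrow>
       (\<exists>w. \<forall>i<rk F k. v i = (\<Sum>j<rk F (Suc k). diff F k i j * w j))) \<longleftrightarrow>
    (\<forall>v. res_map F 0 v = 0 \<longleftrightarrow>
       (\<exists>w. \<forall>i<rk F 0. v i = (\<Sum>j<rk F (Suc 0). diff F 0 i j * w j))) \<and>
    (\<forall>k v. res_map F (Suc k) v = 0 \<longleftrightarrow>
       (\<exists>w. \<forall>i<rk F (Suc k). v i = (\<Sum>j<rk F (Suc (Suc k)). diff F (Suc k) i j * w j)))"
    by (rule all_nat_split)
  then show ?thesis
    by (simp only: exact_over_def mat_vec_aug mat_vec_diff_matrix One_nat_def)
qed

lemma free_gmodD:
  assumes "v \<in> free_gmod b s d"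
  shows "j < b \<Longrightarrow> homogeneous (d - s j) (v j)" "\<not> j < b \<Longrightarrow> v j = 0"
  using assms unfolding free_gmod_def by (auto dest!: spec[of _ j])

lemma resolution_presentation:
  assumes F: "minimal_graded_free_resolution F I" and I: "ideal.subspace I"
  shows "minimal_presentation (rk F k) (shift F k) (res_mat F k) (res_gmod F I k)"
proof -
  have deg0: "homogeneous (shift F 0 j) (aug F j)" if "j < rk F 0" for j
    using F that by (simp add: minimal_graded_free_resolution_def degree_preserving_def)
  have deg: "homogeneous (shift F (Suc k) j - shift F k i) (diff F k i j)"
    if "i < rk F k" "j < rk F (Suc k)" for k i j
    using F that by (simp add: minimal_graded_free_resolution_def degree_preserving_def)
  have span: "ideal.span (aug F ` {..<rk F 0}) = I"
    and exact: "res_map F k v = 0 \<longleftrightarrow>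
       (\<exists>w. \<forall>i<rk F k. v i = (\<Sum>j<rk F (Suc k). diff F k i j * w j))" for k v
    using F by (simp_all add: minimal_graded_free_resolution_def exact_over_iff)
  have minimal: "lookup (diff F k i j) 0 = 0" if "i < rk F k" "j < rk F (Suc k)" for k i j
    using F that by (simp add: minimal_graded_free_resolution_def minimal_complex_def irrelevant_ideal_iff)
  show ?thesis
  proof unfold_locales
    show "graded_submodule (res_gmod F I k)"
      by (cases k) (simp_all add: res_gmod_def graded_submodule_ideal[OF I] graded_submodule_ker)
    fix v d j assume v: "v \<in> ker_gmod (rk F k) (shift F k) (res_mat F k) d" and j: "j < rk F k"
    then obtain w where "\<And>i. i < rk F k \<Longrightarrow> v i = (\<Sum>j<rk F (Suc k). diff F k i j * w j)"
      using exact[of k v] by (auto simp: ker_gmod_def)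
    then show "lookup (v j) 0 = 0"
      using j by (simp add: lookup_sum lookup_mult_0 minimal)
  next
    fix d
    show "res_map F k ` res_free F k d = res_gmod F I k d"
    proof (cases k)
      case 0
      show ?thesis
      proof (intro equalityI subsetI)
        fix x assume "x \<in> res_map F k ` res_free F k d"
        then obtain v where v: "v \<in> res_free F 0 d"
          and x: "x = res_map F 0 v"
          using 0 by blast
        have x0: "x 0 = (\<Sum>j<rk F 0. aug F j * v j)"
          by (simp add: x mat_vec_def res_mat_def)
        then have "x 0 \<in> I"
          unfolding span[symmetric] using in_ideal_span_image[of "{..<rk F 0}" _ "aug F"] by blast
        moreover have "homogeneous d (x 0)"
          unfolding x0 using homogeneous_mult[OF deg0 free_gmodD(1)[OF v]]
          by (intro homogeneous_sum) fastforce
        ultimately show "x \<in> res_gmod F I k d"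
          by (simp add: 0 res_gmod_def ideal_gmod_def) (simp add: x mat_vec_def res_mat_def)
      next
        fix x assume "x \<in> res_gmod F I k d"
        then have x: "x 0 \<in> I" "homogeneous d (x 0)" "\<And>i. i > 0 \<Longrightarrow> x i = 0"
          by (simp_all add: 0 res_gmod_def ideal_gmod_def)
        obtain q where q: "\<And>j. homogeneous (d - shift F 0 j) (q j)"
          "hcomp d (x 0) = (\<Sum>j<rk F 0. aug F j * q j)"
          using in_homogeneous_span_image[of "{..<rk F 0}" "shift F 0" "aug F" "x 0" d] deg0 x(1) span
          by auto
        define v where "v j = (if j < rk F 0 then q j else 0)" for j
        have "v \<in> res_free F 0 d"
          using q(1) by (simp add: free_gmod_def v_def)
        moreover have "x = res_map F 0 v"
        proof
          fix i
          show "x i = res_map F 0 v i"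
            using q(2) x by (cases "i = 0") (simp_all add: mat_vec_def res_mat_def v_def hcomp_homogeneous)
        qed
        ultimately show "x \<in> res_map F k ` res_free F k d"
          using 0 by blast
      qed
    next
      case (Suc k')
      show ?thesis
      proof (intro equalityI subsetI)
        fix x assume "x \<in> res_map F k ` res_free F k d"
        then obtain v where v: "v \<in> res_free F (Suc k') d"
          and x: "x = res_map F (Suc k') v"
          using Suc by blast
        have xi: "x i = (\<Sum>j<rk F (Suc k'). diff F k' i j * v j)" if "i < rk F k'" for i
          using that by (simp add: x mat_vec_def res_mat_def)
        then have "res_map F k' x = 0"
          unfolding exact by blast
        moreover have "x \<in> res_free F k' d"
          unfolding free_gmod_def
        proof (clarsimp, intro conjI impI)
          fix i assume i: "i < rk F k'"
          have "homogeneous (d - shift F k' i) (diff F k' i j * v j)" if "j < rk F (Suc k')" for j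
            by (rule homogeneous_mult_eq[OF deg[OF i that] free_gmodD(1)[OF v that]]) simp
          then show "homogeneous (d - shift F k' i) (x i)"
            unfolding xi[OF i] by (intro homogeneous_sum) simp
        next
          fix i assume "\<not> i < rk F k'"
          then show "x i = 0" by (simp add: x mat_vec_def res_mat_def)
        qed
        ultimately show "x \<in> res_gmod F I k d"
          by (simp add: Suc res_gmod_def ker_gmod_def)
      next
        fix x assume "x \<in> res_gmod F I k d"
        then have x: "x \<in> res_free F k' d" "res_map F k' x = 0"
          by (simp_all add: Suc res_gmod_def ker_gmod_def)
        then obtain w where w: "\<And>i. i < rk F k' \<Longrightarrow> x i = (\<Sum>j<rk F (Suc k'). diff F k' i j * w j)"
          unfolding exact by blast
        define v where "v j = (if j < rk F (Suc k') then hcomp (d - shift F (Suc k') j) (w j) else 0)" for j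
        have "v \<in> res_free F (Suc k') d"
          by (simp add: free_gmod_def v_def)
        moreover have "x = res_map F (Suc k') v"
        proof
          fix i
          show "x i = res_map F (Suc k') v i"
          proof (cases "i < rk F k'")
            case True
            have "x i = hcomp (d - shift F k' i) (x i)"
              using hcomp_homogeneous[OF free_gmodD(1)[OF x(1) True]] by simp
            also have "\<dots> = (\<Sum>j<rk F (Suc k'). diff F k' i j * v j)"
              unfolding w[OF True] hcomp_sum
            proof (rule sum.cong[OF refl])
              fix j assume "j \<in> {..<rk F (Suc k')}"
              then show "hcomp (d - shift F k' i) (diff F k' i j * w j) = diff F k' i j * v j"
                by (simp add: hcomp_mult[OF deg[OF True]] v_def)
            qed
            finally show ?thesis using True by (simp add: mat_vec_def res_mat_def)
          next
            case False
            then show ?thesis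
              using free_gmodD(2)[OF x(1) False] by (simp add: mat_vec_def res_mat_def)
          qed
        qed
        ultimately show "x \<in> res_map F k ` res_free F k d"
          using Suc by blast
      qed
    qed
  qed
qed

lemma resolution_shifts:
  assumes F: "minimal_graded_free_resolution F I" and I: "ideal.subspace I"
  shows "koszul_vanishing (int k) d (ideal_gmod I) \<longleftrightarrow> (\<forall>j<rk F k. shift F k j \<noteq> d)"
proof -
  have *: "koszul_vanishing (p + int k) d (ideal_gmod I) \<longleftrightarrow> koszul_vanishing p d (res_gmod F I k)"
    if "p \<ge> 0" for p
    using that
  proof (induction k arbitrary: p)
    case 0
    then show ?case by (simp add: res_gmod_def)
  next
    case (Suc k)
    interpret minimal_presentation "rk F k" "shift F k" "res_mat F k" "res_gmod F I k"
      by (rule resolution_presentation[OF F I])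
    have "koszul_vanishing (p + int (Suc k)) d (ideal_gmod I) \<longleftrightarrow> koszul_vanishing (p + 1 + int k) d (ideal_gmod I)"
      by (simp add: algebra_simps)
    also have "\<dots> \<longleftrightarrow> koszul_vanishing (p + 1) d (res_gmod F I k)"
      by (rule Suc.IH) (use Suc.prems in simp)
    also have "\<dots> \<longleftrightarrow> koszul_vanishing p d (res_gmod F I (Suc k))"
      using koszul_vanishing_iff[OF Suc.prems] by (simp add: res_gmod_def)
    finally show ?case .
  qed
  interpret minimal_presentation "rk F k" "shift F k" "res_mat F k" "res_gmod F I k"
    by (rule resolution_presentation[OF F I])
  show ?thesis using *[of 0] koszul_vanishing_0_iff by simp
qed

lemma presentation_column:
  assumes "presentation b s g Z" "j < b"
  shows "(\<lambda>i. g i j) \<in> Z (s j)"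
proof -
  interpret presentation b s g Z by fact
  let ?e = "\<lambda>i. if i = j then 1 else 0 :: ('a, 'b) mpoly"
  have "?e \<in> free_gmod b s (s j)"
    using assms(2) by (auto simp: free_gmod_def)
  moreover have "mat_vec b g ?e = (\<lambda>i. g i j)"
    using assms(2) by (simp add: mat_vec_def fun_eq_iff if_distrib cong: if_cong)
  ultimately show ?thesis using cover[of "s j"] by (metis imageI)
qed

text \<open>Exactness of a graded complex may be tested on homogeneous elements.\<close>

lemma graded_exact:
  fixes g :: "nat \<Rightarrow> nat \<Rightarrow> ('n::finite, 'k::field) mpoly"
  assumes g: "\<And>i j. j < b \<Longrightarrow> homogeneous (s j - t i) (g i j)"
    and pres: "presentation b' s' g' (ker_gmod b s g)"
    and v: "mat_vec b g v = 0"
  shows "\<exists>w. \<forall>i<b. v i = (\<Sum>j<b'. g' i j * w j)"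
proof -
  define V where "V d j = (if j < b then hcomp (d - s j) (v j) else 0)" for d j
  define D where "D = (\<Union>j<b. (\<lambda>t. int (monom_deg t) + s j) ` keys (v j))"
  have fD: "finite D" by (simp add: D_def)
  have Vker: "V d \<in> ker_gmod b s g d" for d
    unfolding ker_gmod_def
  proof (intro CollectI conjI)
    show "V d \<in> free_gmod b s d" by (simp add: free_gmod_def V_def)
    show "mat_vec b g (V d) = 0"
    proof
      fix i
      have "mat_vec b g (V d) i = (\<Sum>j<b. hcomp (d - t i) (g i j * v j))"
        unfolding mat_vec_def
      proof (rule sum.cong[OF refl])
        fix j assume "j \<in> {..<b}"
        then show "g i j * V d j = hcomp (d - t i) (g i j * v j)"
          by (simp add: V_def hcomp_mult[OF g])
      qed
      also have "\<dots> = hcomp (d - t i) (mat_vec b g v i)"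
        by (simp add: mat_vec_def hcomp_sum)
      also have "\<dots> = 0 i" using v by simp
      finally show "mat_vec b g (V d) i = 0 i" .
    qed
  qed
  have "\<forall>d. \<exists>w. V d = mat_vec b' g' w"
    using Vker presentation.cover[OF pres] by blast
  then obtain w where w: "\<And>d. V d = mat_vec b' g' (w d)" by metis
  have "v i = (\<Sum>j<b'. g' i j * (\<Sum>d\<in>D. w d j))" if i: "i < b" for i
  proof -
    have "v i = (\<Sum>e\<in>(\<lambda>d. d - s i) ` D. hcomp e (v i))"
    proof (rule hcomp_decompose[symmetric])
      show "(\<lambda>t. int (monom_deg t)) ` keys (v i) \<subseteq> (\<lambda>d. d - s i) ` D"
      proof clarify
        fix t assume "t \<in> keys (v i)"
        then have "int (monom_deg t) + s i \<in> D" using i by (auto simp: D_def)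
        then show "int (monom_deg t) \<in> (\<lambda>d. d - s i) ` D" by (rule image_eqI[rotated]) simp
      qed
    qed (use fD in simp)
    also have "\<dots> = (\<Sum>d\<in>D. V d i)"
      by (subst sum.reindex) (use i in \<open>auto simp: V_def inj_on_def\<close>)
    also have "\<dots> = (\<Sum>d\<in>D. \<Sum>j<b'. g' i j * w d j)"
      by (simp add: w mat_vec_def)
    also have "\<dots> = (\<Sum>j<b'. g' i j * (\<Sum>d\<in>D. w d j))"
      by (subst sum.swap) (simp add: sum_distrib_left)
    finally show ?thesis .
  qed
  then show ?thesis by (intro exI[of _ "\<lambda>j. \<Sum>d\<in>D. w d j"]) simp
qed

lemma resolution_exists:
  fixes I :: "('n::finite, 'k::field) mpoly set"
  assumes I: "homogeneous_ideal I"
    and van: "\<And>k d. d > r + int k \<Longrightarrow> koszul_vanishing (int k) d (ideal_gmod I)"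
  shows "\<exists>F. minimal_graded_free_resolution F I"
proof -
  have sub: "ideal.subspace I" using I by (simp add: homogeneous_ideal_def)
  define K where "K x = (case x of (b, s, g) \<Rightarrow> ker_gmod b s g)"
    for x :: "nat \<times> (nat \<Rightarrow> int) \<times> (nat \<Rightarrow> nat \<Rightarrow> ('n, 'k) mpoly)"
  define MP where "MP x Z = (case x of (b, s, g) \<Rightarrow> minimal_presentation b s g Z)"
    for x :: "nat \<times> (nat \<Rightarrow> int) \<times> (nat \<Rightarrow> nat \<Rightarrow> ('n, 'k) mpoly)" and Z
  define V where "V k Z \<longleftrightarrow> (\<forall>p d. d > r + int k + int p \<longrightarrow> koszul_vanishing (int p) d Z)"
    for k and Z :: "('n, 'k) gmod"
  have step: "V (Suc k) (K x)" if "MP x Z" "V k Z" for k x Z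
    unfolding V_def
  proof (intro allI impI)
    fix p d assume "d > r + int (Suc k) + int p"
    then have "koszul_vanishing (int p + 1) d Z"
      using that(2)[unfolded V_def, rule_format, of "Suc p" d] by (simp add: algebra_simps)
    then show "koszul_vanishing (int p) d (K x)"
      using that(1) minimal_presentation.koszul_vanishing_ker by (fastforce simp: MP_def K_def split: prod.splits)
  qed
  have ex: "\<exists>x. MP x Z" if "graded_submodule Z" "\<And>d. Z d \<subseteq> free_gmod a t d" "V k Z" for Z a t k
  proof -
    have "koszul_vanishing 0 d Z" if "d > r + int k" for d
      using \<open>V k Z\<close>[unfolded V_def, rule_format, of 0 d] that by simp
    from minimal_presentation_exists[OF that(1,2) this]
    show ?thesis by (auto simp: MP_def)
  qed
  have ex': "\<exists>y. MP y (K x)" if V: "V k (K x)" for x k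
  proof (cases x)
    case (fields b s g)
    show ?thesis
    proof (rule ex[OF _ _ V])
      show "graded_submodule (K x)" by (simp add: K_def fields graded_submodule_ker)
      show "K x d \<subseteq> free_gmod b s d" for d by (auto simp: K_def fields ker_gmod_def)
    qed
  qed
  obtain x0 where x0: "MP x0 (ideal_gmod I)"
    using ex[OF graded_submodule_ideal[OF sub] ideal_gmod_free, of 0] van by (auto simp: V_def)
  have "V 0 (ideal_gmod I)" using van by (simp add: V_def)
  then have V0: "V (Suc 0) (K x0)" using step[OF x0] by blast
  obtain X where X: "X 0 = x0" "\<And>k. MP (X (Suc k)) (K (X k))"
  proof -
    have "\<exists>X. \<forall>k. (V (Suc k) (K (X k)) \<and> (k = 0 \<longrightarrow> X k = x0)) \<and> MP (X (Suc k)) (K (X k))"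
    proof (rule dependent_nat_choice)
      show "\<exists>x. V (Suc 0) (K x) \<and> (0 = 0 \<longrightarrow> x = x0)" using V0 by blast
      fix x k assume "V (Suc k) (K x) \<and> (k = 0 \<longrightarrow> x = x0)"
      then obtain y where "MP y (K x)" "V (Suc (Suc k)) (K y)" using ex' step by blast
      then show "\<exists>y. (V (Suc (Suc k)) (K y) \<and> (Suc k = 0 \<longrightarrow> y = x0)) \<and> MP y (K x)" by blast
    qed
    then show thesis using that by blast
  qed
  define b s g where "b k = fst (X k)" and "s k = fst (snd (X k))" and "g k = snd (snd (X k))" for k
  have mp0: "minimal_presentation (b 0) (s 0) (g 0) (ideal_gmod I)"
    using x0 by (simp add: MP_def b_def s_def g_def X(1) case_prod_beta)
  have mp: "minimal_presentation (b (Suc k)) (s (Suc k)) (g (Suc k)) (ker_gmod (b k) (s k) (g k))" for k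
    using X(2)[of k] by (simp add: MP_def K_def b_def s_def g_def case_prod_beta)
  note pres0 = minimal_presentation.axioms(1)[OF mp0] and pres = minimal_presentation.axioms(1)[OF mp]
  note col0 = presentation_column[OF pres0] and col = presentation_column[OF pres]
  define F :: "('n, 'k) mpoly graded_free_complex" where
    "F = \<lparr>rk = b, shift = s, diff = (\<lambda>k. g (Suc k)), aug = g 0 0\<rparr>"
  have F_simps: "rk F = b" "shift F = s" "diff F = (\<lambda>k. g (Suc k))" "aug F = g 0 0"
    by (simp_all add: F_def)
  have res_mat: "mat_vec (b k) (res_mat F k) = mat_vec (b k) (g k)" for k
  proof (intro ext)
    fix v i
    have "res_mat F k i j = g k i j" if "j < b k" for j
    proof (cases k)
      case 0
      then show ?thesis using col0[of j] that by (auto simp: res_mat_def F_simps ideal_gmod_def)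
    next
      case (Suc k')
      then show ?thesis
        using col[of j k'] that free_gmodD(2)[of "\<lambda>i. g k i j" "b k'" _ _ i]
        by (auto simp: res_mat_def F_simps ker_gmod_def)
    qed
    then show "mat_vec (b k) (res_mat F k) v i = mat_vec (b k) (g k) v i"
      by (simp add: mat_vec_def)
  qed
  have deg: "homogeneous (s (Suc k) j - s k i) (g (Suc k) i j)" if "j < b (Suc k)" for k i j
    using col[OF that] by (cases "i < b k") (auto simp: ker_gmod_def dest: free_gmodD)
  have deg0: "homogeneous (s 0 j - 0) (g 0 i j)" if "j < b 0" for i j
    using col0[OF that] by (cases "i = 0") (auto simp: ideal_gmod_def)
  have dp: "degree_preserving F"
    unfolding degree_preserving_def F_simps using deg deg0[of _ 0] by auto
  have mc: "minimal_complex F"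
    unfolding minimal_complex_def F_simps irrelevant_ideal_iff
  proof (intro allI impI)
    fix k i j assume i: "i < b k" and j: "j < b (Suc k)"
    have "minimal_presentation (b k) (s k) (g k) (case k of 0 \<Rightarrow> ideal_gmod I | Suc k' \<Rightarrow> ker_gmod (b k') (s k') (g k'))"
      using mp0 mp by (cases k) auto
    from minimal_presentation.minimal[OF this col[OF j] i]
    show "lookup (g (Suc k) i j) 0 = 0" .
  qed
  have "ideal.span (aug F ` {..<rk F 0}) = I"
  proof (intro equalityI)
    show "ideal.span (aug F ` {..<rk F 0}) \<subseteq> I"
      by (rule ideal.span_minimal[OF _ sub]) (use col0 in \<open>auto simp: F_simps ideal_gmod_def\<close>)
    show "I \<subseteq> ideal.span (aug F ` {..<rk F 0})"
    proof
      fix p assume p: "p \<in> I"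
      have "hcomp d p \<in> ideal.span (aug F ` {..<rk F 0})" for d
      proof -
        have "(\<lambda>i. if i = 0 then hcomp d p else 0) \<in> ideal_gmod I d"
          using I p by (auto simp: ideal_gmod_def homogeneous_ideal_def)
        then obtain v where v: "(\<lambda>i. if i = 0 then hcomp d p else 0) = mat_vec (b 0) (g 0) v"
          using presentation.cover[OF pres0] by blast
        have "hcomp d p = (\<Sum>j<b 0. g 0 0 j * v j)"
          using fun_cong[OF v, of 0] by (simp add: mat_vec_def)
        then show ?thesis using in_ideal_span_image[of "{..<b 0}" "hcomp d p" "g 0 0"] by (auto simp: F_simps)
      qed
      then have "(\<Sum>d\<in>(\<lambda>t. int (monom_deg t)) ` keys p. hcomp d p) \<in> ideal.span (aug F ` {..<rk F 0})"
        by (intro ideal.span_sum)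
      then show "p \<in> ideal.span (aug F ` {..<rk F 0})"
        by (simp add: hcomp_decompose)
    qed
  qed
  moreover have "res_map F k v = 0 \<longleftrightarrow>
       (\<exists>w. \<forall>i<rk F k. v i = (\<Sum>j<rk F (Suc k). diff F k i j * w j))" for k v
    unfolding F_simps res_mat
  proof
    assume v: "mat_vec (b k) (g k) v = 0"
    define t where "t = (case k of 0 \<Rightarrow> \<lambda>_. 0 | Suc k' \<Rightarrow> s k')"
    have "homogeneous (s k j - t i) (g k i j)" if "j < b k" for i j
      using deg deg0 that by (cases k) (auto simp: t_def)
    from graded_exact[OF this pres v]
    show "\<exists>w. \<forall>i<b k. v i = (\<Sum>j<b (Suc k). g (Suc k) i j * w j)" .
  next
    assume "\<exists>w. \<forall>i<b k. v i = (\<Sum>j<b (Suc k). g (Suc k) i j * w j)"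
    then obtain w where w: "\<And>i. i < b k \<Longrightarrow> v i = (\<Sum>j<b (Suc k). g (Suc k) i j * w j)" by blast
    show "mat_vec (b k) (g k) v = 0"
    proof
      fix i
      have zero: "(\<Sum>l<b k. g k i l * g (Suc k) l j) = 0" if "j < b (Suc k)" for j
        using col[OF that] by (simp add: ker_gmod_def mat_vec_def fun_eq_iff)
      have "mat_vec (b k) (g k) v i = (\<Sum>l<b k. \<Sum>j<b (Suc k). g k i l * g (Suc k) l j * w j)"
        by (simp add: mat_vec_def w sum_distrib_left mult.assoc)
      also have "\<dots> = (\<Sum>j<b (Suc k). (\<Sum>l<b k. g k i l * g (Suc k) l j) * w j)"
        by (subst sum.swap) (simp add: sum_distrib_right)
      also have "\<dots> = 0 i" by (simp add: zero)
      finally show "mat_vec (b k) (g k) v i = 0 i" .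
    qed
  qed
  ultimately have "exact_over F I" unfolding exact_over_iff by blast
  with dp mc show ?thesis unfolding minimal_graded_free_resolution_def by blast
qed

lemma regularity_eqI:
  assumes I: "homogeneous_ideal I"
    and van: "\<And>k d. d > r + int k \<Longrightarrow> koszul_vanishing (int k) d (ideal_gmod I)"
    and nonvan: "\<not> koszul_vanishing (int k0) (r + int k0) (ideal_gmod I)"
  shows "regularity I = r"
proof -
  have sub: "ideal.subspace I" using I by (simp add: homogeneous_ideal_def)
  obtain F0 where F0: "minimal_graded_free_resolution F0 I"
    using resolution_exists[OF I van] by blast
  have ub: "max_shift F k - int k \<le> r" if F: "minimal_graded_free_resolution F I" and k: "rk F k > 0" for F k
  proof -
    have "shift F k j \<le> r + int k" if "j < rk F k" for j
    proof (rule ccontr)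
      assume "\<not> shift F k j \<le> r + int k"
      then have "koszul_vanishing (int k) (shift F k j) (ideal_gmod I)" by (intro van) simp
      then show False using resolution_shifts[OF F sub] that by blast
    qed
    moreover have "max_shift F k \<in> shift F k ` {..<rk F k}"
      unfolding max_shift_def by (rule Max_in) (use k in auto)
    ultimately show ?thesis by force
  qed
  have lb: "rk F k0 > 0 \<and> r \<le> max_shift F k0 - int k0" if F: "minimal_graded_free_resolution F I" for F
  proof -
    obtain j where j: "j < rk F k0" "shift F k0 j = r + int k0"
      using resolution_shifts[OF F sub] nonvan by blast
    have "shift F k0 j \<le> max_shift F k0"
      unfolding max_shift_def by (rule Max_ge) (use j(1) in auto)
    then show ?thesis using j by linarith
  qed
  show ?thesis
    unfolding regularity_def
  proof (rule the_equality)
    show "\<exists>F. minimal_graded_free_resolution F I \<and>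
        (\<exists>k. rk F k > 0 \<and> r = max_shift F k - int k) \<and>
        (\<forall>k. rk F k > 0 \<longrightarrow> max_shift F k - int k \<le> r)"
      using F0 ub[OF F0] lb[OF F0] by (metis order_antisym)
    fix r' assume "\<exists>F. minimal_graded_free_resolution F I \<and>
        (\<exists>k. rk F k > 0 \<and> r' = max_shift F k - int k) \<and>
        (\<forall>k. rk F k > 0 \<longrightarrow> max_shift F k - int k \<le> r')"
    then obtain F k where F: "minimal_graded_free_resolution F I"
      and "rk F k > 0" "r' = max_shift F k - int k"
      and "\<forall>k. rk F k > 0 \<longrightarrow> max_shift F k - int k \<le> r'" by blast
    then show "r' = r" using ub[OF F, of k] lb[OF F] by (meson order_antisym order_trans)
  qed
qed

section \<open>Generic arrangements\<close>

lemma homogeneous_var_expand: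
  assumes "homogeneous d p" "d > 0"
  shows "\<exists>q. (\<forall>i. homogeneous (d - 1) (q i)) \<and> p = (\<Sum>i\<in>UNIV. var_mpoly i * q i)"
proof -
  have "p \<in> irrelevant_ideal"
    using assms by (auto simp: irrelevant_ideal_iff homogeneous_alt)
  then have "p \<in> ideal.span (var_mpoly ` UNIV)"
    by (simp add: irrelevant_ideal_def full_SetCompr_eq)
  from in_homogeneous_span_image[OF finite homogeneous_var this, where d = d]
  show ?thesis using assms(1) by (auto simp: hcomp_homogeneous)
qed

definition form_val :: "('n \<Rightarrow> 'k) \<Rightarrow> ('n::finite, 'k::field) mpoly \<Rightarrow> 'k" where
  "form_val \<theta> p = (\<Sum>i\<in>UNIV. \<theta> i * lookup p (single i 1))"

lemma form_val_add: "form_val \<theta> (p + q) = form_val \<theta> p + form_val \<theta> q"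
  by (simp add: form_val_def lookup_add distrib_left sum.distrib)

lemma form_val_const: "form_val \<theta> (const_mpoly c * p) = c * form_val \<theta> p"
proof -
  have "lookup (const_mpoly c * p) t = c * lookup p t" for t
    unfolding const_mpoly_def mult_map_scale_conv_mult[symmetric]
    by transfer (simp add: when_def)
  then show ?thesis by (simp add: form_val_def sum_distrib_left mult_ac)
qed

lemma form_val_sum: "form_val \<theta> (\<Sum>i\<in>A. p i) = (\<Sum>i\<in>A. form_val \<theta> (p i))"
  by (induction A rule: infinite_finite_induct) (simp_all add: form_val_add, simp_all add: form_val_def)

locale generic_forms =
  fixes l :: "nat \<Rightarrow> ('n::finite, 'k::field) mpoly" and m n :: nat
  assumes n_eq: "n = CARD('n)"
    and generic: "generic_arrangement m l"
    and char: "\<not> CHAR('k) dvd m"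
    and card_ge_2: "n \<ge> 2"
    and card_less: "n < m"
begin

definition f :: "('n, 'k) mpoly" where "f = defining_poly m l"
definition P :: "nat \<Rightarrow> ('n, 'k) mpoly" where "P i = (\<Prod>j\<in>{1..m} - {i}. l j)"
abbreviation "J \<equiv> jacobian_ideal f"
abbreviation "II \<equiv> cofactor_ideal m l"

lemma l_hom: "i \<in> {1..m} \<Longrightarrow> homogeneous 1 (l i)"
  and l_nonzero: "i \<in> {1..m} \<Longrightarrow> l i \<noteq> 0"
  and l_not_smult: "i \<in> {1..m} \<Longrightarrow> j \<in> {1..m} \<Longrightarrow> i \<noteq> j \<Longrightarrow> l i \<noteq> smult_mpoly c (l j)"
  using generic by (auto simp: generic_arrangement_def central_arrangement_def)

lemma l_indep:
  assumes "S \<subseteq> {1..m}" "card S = n"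
  shows "inj_on l S" "mpoly.independent (l ` S)"
  using generic assms by (auto simp: generic_arrangement_def n_eq)

lemma l_P: "i \<in> {1..m} \<Longrightarrow> l i * P i = f"
  unfolding f_def P_def defining_poly_def by (subst prod.remove[of _ i]) auto

lemma P_hom: "i \<in> {1..m} \<Longrightarrow> homogeneous (int m - 1) (P i)"
proof -
  assume i: "i \<in> {1..m}"
  have "homogeneous (\<Sum>j\<in>{1..m} - {i}. 1) (P i)"
    unfolding P_def by (rule homogeneous_prod) (use l_hom in auto)
  moreover have "(\<Sum>j\<in>{1..m} - {i}. 1 :: int) = int m - 1" using i by simp
  ultimately show ?thesis by simp
qed

lemma f_nonzero: "f \<noteq> 0"
  unfolding f_def defining_poly_def by (rule mpoly_prod_nonzero) (use l_nonzero in auto)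

lemma dual_basis:
  assumes S: "S \<subseteq> {1..m}" "card S = n"
  shows "\<exists>\<theta>. (\<forall>k\<in>S. \<forall>j\<in>S. form_val (\<theta> k) (l j) = (if j = k then 1 else 0)) \<and>
    (\<forall>p. homogeneous 1 p \<longrightarrow> p = (\<Sum>k\<in>S. const_mpoly (form_val (\<theta> k) p) * l k))"
proof -
  let ?X = "range (var_mpoly :: 'n \<Rightarrow> ('n, 'k) mpoly)"
  have finS: "finite S" using S finite_subset by blast
  note inj = l_indep(1)[OF S] and ind = l_indep(2)[OF S]
  have sub: "l ` S \<subseteq> mpoly.span ?X"
  proof clarify
    fix j assume "j \<in> S"
    then have "homogeneous 1 (l j)" using S l_hom by blast
    then have "l j = (\<Sum>i\<in>UNIV. smult_mpoly (lookup (l j) (single i 1)) (var_mpoly i))"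
      unfolding smult_mpoly_def by (rule linear_form_expand)
    also have "\<dots> \<in> mpoly.span ?X"
      by (intro mpoly.span_sum mpoly.span_scale mpoly.span_base) simp
    finally show "l j \<in> mpoly.span ?X" .
  qed
  have "var_mpoly i \<in> mpoly.span (l ` S)" for i
  proof (rule ccontr)
    assume v: "var_mpoly i \<notin> mpoly.span (l ` S)"
    have "mpoly.independent (insert (var_mpoly i) (l ` S))"
      using mpoly.independent_insertI[OF v ind] .
    then have "card (insert (var_mpoly i) (l ` S)) \<le> card ?X"
      using mpoly.independent_span_bound[of ?X "insert (var_mpoly i) (l ` S)"] sub
      by (simp add: mpoly.span_base)
    also have "\<dots> \<le> n" unfolding n_eq by (rule card_image_le) simp
    finally have "card (insert (var_mpoly i) (l ` S)) \<le> n" .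
    moreover have "var_mpoly i \<notin> l ` S" using v mpoly.span_base by blast
    then have "card (insert (var_mpoly i) (l ` S)) = Suc n"
      using finS S(2) by (simp add: card_image[OF inj])
    ultimately show False by simp
  qed
  then have "\<exists>u. var_mpoly i = (\<Sum>v\<in>l ` S. smult_mpoly (u v) v)" for i
    using mpoly.span_finite[of "l ` S"] finS by auto
  then obtain u where u: "\<And>i. var_mpoly i = (\<Sum>v\<in>l ` S. smult_mpoly (u i v) v)" by metis
  define \<theta> where "\<theta> k i = u i (l k)" for k i
  have exp: "p = (\<Sum>k\<in>S. const_mpoly (form_val (\<theta> k) p) * l k)" if p: "homogeneous 1 p" for p
  proof -
    have var: "var_mpoly i = (\<Sum>k\<in>S. const_mpoly (\<theta> k i) * l k)" for i
      unfolding u[of i] by (subst sum.reindex[OF inj]) (simp add: \<theta>_def smult_mpoly_def)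
    have "p = (\<Sum>i\<in>UNIV. \<Sum>k\<in>S. const_mpoly (\<theta> k i * lookup p (single i 1)) * l k)"
      by (subst linear_form_expand[OF p], subst var)
        (simp add: sum_distrib_left const_mpoly_mult mult_ac)
    also have "\<dots> = (\<Sum>k\<in>S. const_mpoly (form_val (\<theta> k) p) * l k)"
      by (subst sum.swap) (simp add: form_val_def const_mpoly_sum sum_distrib_right)
    finally show ?thesis .
  qed
  have "form_val (\<theta> k) (l j) = (if j = k then 1 else 0)" if k: "k \<in> S" and j: "j \<in> S" for k j
  proof -
    define w where "w v = form_val (\<theta> (the_inv_into S l v)) (l j) - (if v = l j then 1 else 0)" for v
    have w: "w (l k) = form_val (\<theta> k) (l j) - (if k = j then 1 else 0)" if "k \<in> S" for k
      using the_inv_into_f_f[OF inj that] inj_on_eq_iff[OF inj that j] by (simp add: w_def)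
    have "(\<Sum>v\<in>l ` S. smult_mpoly (w v) v) = (\<Sum>k\<in>S. smult_mpoly (w (l k)) (l k))"
      by (subst sum.reindex[OF inj]) simp
    also have "\<dots> = (\<Sum>k\<in>S. const_mpoly (form_val (\<theta> k) (l j)) * l k - (if k = j then l j else 0))"
      by (intro sum.cong) (auto simp: w mpoly.scale_left_diff_distrib, auto simp: smult_mpoly_def)
    also have "\<dots> = l j - l j"
      using exp[of "l j"] l_hom S j finS by (auto simp: sum_subtractf)
    finally have "w (l k) = 0"
      using mpoly.independentD[OF ind, of "l ` S" w "l k"] finS k by simp
    then show ?thesis using w[OF k] by auto
  qed
  then show ?thesis using exp by (intro exI[of _ \<theta>] conjI ballI allI impI)
qed

lemma partial_deriv_f: "partial_deriv i f = (\<Sum>j\<in>{1..m}. const_mpoly (lookup (l j) (single i 1)) * P j)"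
  unfolding f_def defining_poly_def
  by (subst partial_deriv_prod) (auto simp: P_def partial_deriv_linear_form[OF l_hom])

lemma J_subspace: "ideal.subspace J" and II_subspace: "ideal.subspace II"
  by (simp_all add: jacobian_ideal_def cofactor_ideal_def)

lemma J_eq: "J = ideal.span ((\<lambda>i. partial_deriv i f) ` UNIV)"
  by (simp add: jacobian_ideal_def full_SetCompr_eq)

lemma II_eq: "II = ideal.span (P ` {1..m})"
  by (auto simp: cofactor_ideal_def P_def intro!: arg_cong[where f = ideal.span])

lemma partial_deriv_in_J: "partial_deriv i f \<in> J"
  unfolding J_eq by (intro ideal.span_base) simp

lemma J_scale: "p \<in> J \<Longrightarrow> q * p \<in> J" and II_scale: "p \<in> II \<Longrightarrow> q * p \<in> II"
  by (simp_all add: ideal.subspace_scale J_subspace II_subspace)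

lemma P_in_II: "j \<in> {1..m} \<Longrightarrow> P j \<in> II"
  unfolding II_eq by (intro ideal.span_base imageI)

lemma J_subset_II: "J \<subseteq> II"
  unfolding J_eq
proof (rule ideal.span_minimal[OF _ II_subspace], clarify)
  fix i show "partial_deriv i f \<in> II"
    unfolding partial_deriv_f
    by (intro ideal.subspace_sum[OF II_subspace] II_scale P_in_II)
qed

lemma derivation_f:
  "(\<Sum>i\<in>UNIV. const_mpoly (\<theta> i) * partial_deriv i f) = (\<Sum>j\<in>{1..m}. const_mpoly (form_val \<theta> (l j)) * P j)"
proof -
  have "(\<Sum>i\<in>UNIV. const_mpoly (\<theta> i) * partial_deriv i f) =
    (\<Sum>i\<in>UNIV. \<Sum>j\<in>{1..m}. const_mpoly (\<theta> i * lookup (l j) (single i 1)) * P j)"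
    by (simp add: partial_deriv_f sum_distrib_left const_mpoly_mult mult.assoc)
  also have "\<dots> = (\<Sum>j\<in>{1..m}. const_mpoly (form_val \<theta> (l j)) * P j)"
    by (subst sum.swap) (simp add: form_val_def const_mpoly_sum sum_distrib_right)
  finally show ?thesis .
qed

lemma derivation_in_J: "(\<Sum>j\<in>{1..m}. const_mpoly (form_val \<theta> (l j)) * P j) \<in> J"
  unfolding derivation_f[symmetric]
  by (intro ideal.subspace_sum[OF J_subspace] J_scale partial_deriv_in_J)

lemma f_in_J: "f \<in> J"
proof -
  have "(\<Sum>i\<in>UNIV. var_mpoly i * partial_deriv i f) =
      (\<Sum>j\<in>{1..m}. \<Sum>i\<in>UNIV. (const_mpoly (lookup (l j) (single i 1)) * var_mpoly i) * P j)"
    unfolding partial_deriv_f sum_distrib_left by (subst sum.swap) (simp add: mult_ac)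
  also have "\<dots> = (\<Sum>j\<in>{1..m}. f)"
  proof (rule sum.cong[OF refl])
    fix j assume j: "j \<in> {1..m}"
    show "(\<Sum>i\<in>UNIV. (const_mpoly (lookup (l j) (single i 1)) * var_mpoly i) * P j) = f"
      unfolding sum_distrib_right[symmetric] linear_form_expand[OF l_hom[OF j], symmetric]
      by (rule l_P[OF j])
  qed
  also have "\<dots> = const_mpoly (of_nat m) * f"
    by (simp add: const_mpoly_of_nat)
  finally have "const_mpoly (of_nat m) * f \<in> J"
    by (metis (no_types, lifting) J_scale J_subspace ideal.subspace_sum partial_deriv_in_J)
  from J_scale[OF this, of "const_mpoly (inverse (of_nat m))"]
  have "(const_mpoly (inverse (of_nat m)) * const_mpoly (of_nat m)) * f \<in> J"
    by (simp add: mult.assoc)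
  moreover have "(of_nat m :: 'k) \<noteq> 0" using char by (simp add: of_nat_eq_0_iff_char_dvd)
  then have "const_mpoly (inverse (of_nat m)) * const_mpoly (of_nat m) = (1 :: ('n, 'k) mpoly)"
    by (rule const_mpoly_inverse)
  ultimately show ?thesis by simp
qed

text \<open>Modulo \<open>\<langle>l\<^sub>c | c \<in> C\<rangle>\<close>, the products of \<open>d\<close> distinct forms of \<open>S\<close> span the polynomials of degree \<open>d\<close>.
  For the induction, split off the products containing a given form \<open>l\<^sub>s\<close>, and add \<open>s\<close> to \<open>C\<close> for the
  remaining ones.\<close>

lemma products_span:
  assumes "card S = N" "S \<subseteq> {1..m}" "C \<subseteq> {1..m}" "S \<inter> C = {}" "card C \<le> n" "N + card C = n + d"
    "mpoly.subspace X" "\<And>B. B \<subseteq> S \<Longrightarrow> card B = d \<Longrightarrow> (\<Prod>i\<in>B. l i) \<in> X"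
    "\<And>c h. c \<in> C \<Longrightarrow> homogeneous (int d - 1) h \<Longrightarrow> l c * h \<in> X"
    "homogeneous (int d) g"
  shows "g \<in> X"
  using assms
proof (induction N arbitrary: S C d X g)
  case 0
  then have d: "d = 0" by simp
  then have "1 \<in> X" using 0(8)[of "{}"] by simp
  from mpoly.subspace_scale[OF 0(7) this, of "lookup g 0"]
  have "const_mpoly (lookup g 0) \<in> X" by (simp add: smult_mpoly_def)
  then show ?case using homogeneous_degree_0[of g] 0(10) d by simp
next
  case (Suc N)
  show ?case
  proof (cases "d = 0")
    case True
    then have "1 \<in> X" using Suc.prems(8)[of "{}"] by simp
    from mpoly.subspace_scale[OF Suc.prems(7) this, of "lookup g 0"]
    have "const_mpoly (lookup g 0) \<in> X" by (simp add: smult_mpoly_def)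
    then show ?thesis using homogeneous_degree_0[of g] Suc.prems(10) True by simp
  next
    case d: False
    show ?thesis
    proof (cases "card C = n")
      case True
      obtain \<theta> where \<theta>: "\<forall>p. homogeneous 1 p \<longrightarrow> p = (\<Sum>k\<in>C. const_mpoly (form_val (\<theta> k) p) * l k)"
        using dual_basis[OF Suc.prems(3) True] by blast
      obtain q where q: "\<And>i. homogeneous (int d - 1) (q i)" "g = (\<Sum>i\<in>UNIV. var_mpoly i * q i)"
        using homogeneous_var_expand[OF Suc.prems(10)] d by auto
      have "var_mpoly i * q i \<in> X" for i
      proof -
        have "var_mpoly i * q i = (\<Sum>k\<in>C. l k * (const_mpoly (form_val (\<theta> k) (var_mpoly i)) * q i))"
          by (subst \<theta>[rule_format, OF homogeneous_var]) (simp add: sum_distrib_left sum_distrib_right mult_ac)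
        also have "\<dots> \<in> X"
          by (intro mpoly.subspace_sum[OF Suc.prems(7)] Suc.prems(9))
            (auto intro!: homogeneous_mult_eq[OF homogeneous_const q(1)])
        finally show ?thesis .
      qed
      then show ?thesis
        unfolding q(2) by (intro mpoly.subspace_sum[OF Suc.prems(7)])
    next
      case False
      then have Cn: "card C < n" using Suc.prems(5) by simp
      have finS: "finite S" and finC: "finite C"
        using Suc.prems(2,3) finite_subset by blast+
      obtain s where s: "s \<in> S" using Suc.prems(1) by fastforce
      have sC: "s \<notin> C" using s Suc.prems(4) by blast
      have card: "card (S - {s}) = N" using s finS Suc.prems(1) by simp
      show ?thesis
      proof (rule Suc.IH[OF card, of "insert s C" d X])
        show "S - {s} \<subseteq> {1..m}" "insert s C \<subseteq> {1..m}" "(S - {s}) \<inter> insert s C = {}"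
          using Suc.prems s by auto
        show "card (insert s C) \<le> n" "N + card (insert s C) = n + d"
          using Cn sC finC Suc.prems(6) by auto
        show "mpoly.subspace X" "homogeneous (int d) g" by fact+
        show "(\<Prod>i\<in>B. l i) \<in> X" if "B \<subseteq> S - {s}" "card B = d" for B
          using that Suc.prems(8) by blast
        fix c and h :: "('n, 'k) mpoly" assume c: "c \<in> insert s C" and h: "homogeneous (int d - 1) h"
        show "l c * h \<in> X"
        proof (cases "c = s")
          case False
          then show ?thesis using c h Suc.prems(9) by blast
        next
          case True
          have "h \<in> {h. l s * h \<in> X}"
          proof (rule Suc.IH[OF card, of C "d - 1"])
            show "S - {s} \<subseteq> {1..m}" "C \<subseteq> {1..m}" "(S - {s}) \<inter> C = {}" "card C \<le> n"
              "N + card C = n + (d - 1)" "homogeneous (int (d - 1)) h"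
              using Suc.prems d h by (auto simp: of_nat_diff)
            show "mpoly.subspace {h. l s * h \<in> X}"
              using Suc.prems(7) unfolding mpoly.subspace_def
              by (auto simp: distrib_left smult_mpoly_def mult.left_commute)
            fix B assume B: "B \<subseteq> S - {s}" "card B = d - 1"
            then have "finite B" "s \<notin> B" using finS finite_subset by auto
            moreover from this have "(\<Prod>i\<in>insert s B. l i) \<in> X"
              using B s d by (intro Suc.prems(8)) auto
            ultimately show "(\<Prod>i\<in>B. l i) \<in> {h. l s * h \<in> X}" by simp
          next
            fix c and h :: "('n, 'k) mpoly" assume c: "c \<in> C" and h: "homogeneous (int (d - 1) - 1) h"
            have "homogeneous (int d - 1) (l s * h)"
              by (rule homogeneous_mult_eq[OF l_hom h]) (use s d Suc.prems(2) in \<open>auto simp: of_nat_diff\<close>)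
            from Suc.prems(9)[OF c this] show "l c * h \<in> {h. l s * h \<in> X}"
              by (simp add: mult.left_commute)
          qed
          then show ?thesis using True by simp
        qed
      qed
    qed
  qed
qed

lemma form_times_P_in_J_base:
  assumes j: "j \<in> {1..m}" and g: "homogeneous (int (m - n)) g"
  shows "g * P j \<in> J"
proof -
  have "g \<in> {g. g * P j \<in> J}"
  proof (rule products_span[of "{1..m} - {j}" "m - 1" "{j}" "m - n"])
    show "card ({1..m} - {j}) = m - 1" using j by simp
    show "card {j} \<le> n" "m - 1 + card {j} = n + (m - n)" using card_ge_2 card_less by auto
    show "mpoly.subspace {g. g * P j \<in> J}"
      using J_subspace unfolding mpoly.subspace_def ideal.subspace_def
      by (auto simp: distrib_right smult_mpoly_def mult.assoc)
  next
    fix B assume B: "B \<subseteq> {1..m} - {j}" "card B = m - n"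
    define A where "A = {1..m} - {j} - B"
    have finB: "finite B" using B(1) finite_subset by blast
    have "card ({1..m} - {j}) = m - 1" using j by simp
    then have "card A = m - 1 - (m - n)"
      unfolding A_def using B finB by (simp add: card_Diff_subset)
    then have "card A = n - 1" using card_less by simp
    then have "card (insert j A) = n" using card_ge_2 by (simp add: A_def)
    moreover have "insert j A \<subseteq> {1..m}" using j by (auto simp: A_def)
    ultimately obtain \<theta> where \<theta>: "\<forall>k\<in>insert j A. \<forall>i\<in>insert j A.
        form_val (\<theta> k) (l i) = (if i = k then 1 else 0)"
      using dual_basis[of "insert j A"] by blast
    let ?c = "\<lambda>i. const_mpoly (form_val (\<theta> j) (l i)) * P i"
    let ?B = "\<Prod>i\<in>B. l i"
    have "(\<Sum>i\<in>{1..m}. ?c i) = ?c j + (\<Sum>i\<in>{1..m} - {j}. ?c i)"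
      using j by (subst sum.remove[of _ j]) auto
    also have "(\<Sum>i\<in>{1..m} - {j}. ?c i) = (\<Sum>i\<in>B. ?c i)"
    proof (rule sum.mono_neutral_right)
      show "\<forall>i\<in>{1..m} - {j} - B. ?c i = 0"
        using \<theta> by (auto simp: A_def)
    qed (use B in auto)
    also have "?c j = P j" using \<theta> by simp
    finally have "?B * P j = ?B * (\<Sum>i\<in>{1..m}. ?c i) - (\<Sum>i\<in>B. ?B * ?c i)"
      by (simp add: algebra_simps sum_distrib_left)
    also have "\<dots> \<in> J"
    proof (rule ideal.subspace_diff[OF J_subspace J_scale[OF derivation_in_J] ideal.subspace_sum[OF J_subspace]])
      fix i assume i: "i \<in> B"
      then have im: "i \<in> {1..m}" using B by blast
      have "?B * ?c i = ((\<Prod>k\<in>B - {i}. l k) * const_mpoly (form_val (\<theta> j) (l i))) * (l i * P i)"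
        using i finB by (subst prod.remove[of B i]) (auto simp: mult_ac)
      also have "\<dots> \<in> J" unfolding l_P[OF im] by (rule J_scale[OF f_in_J])
      finally show "?B * ?c i \<in> J" .
    qed
    finally show "?B \<in> {g. g * P j \<in> J}" by simp
  next
    fix c and h :: "('n, 'k) mpoly" assume "c \<in> {j}"
    then have "l c * h * P j = h * f" using l_P[OF j] by (simp add: mult_ac)
    then show "l c * h \<in> {g. g * P j \<in> J}" using J_scale[OF f_in_J] by simp
  qed (use j g in auto)
  then show ?thesis by simp
qed

lemma form_times_P_in_J:
  assumes j: "j \<in> {1..m}" and g: "homogeneous d g" and d: "d \<ge> int m - int n"
  shows "g * P j \<in> J"
  using d g
proof (induction d arbitrary: g rule: int_ge_induct)
  case base
  then show ?case using form_times_P_in_J_base[OF j] card_less by (simp add: of_nat_diff)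
next
  case (step d)
  have "d + 1 > 0" using step card_less by simp
  then obtain q where q: "\<And>i. homogeneous d (q i)" "g = (\<Sum>i\<in>UNIV. var_mpoly i * q i)"
    using homogeneous_var_expand[OF step.prems] by auto
  have "g * P j = (\<Sum>i\<in>UNIV. var_mpoly i * (q i * P j))"
    by (simp add: q(2) sum_distrib_right mult.assoc)
  also have "\<dots> \<in> J"
    by (intro ideal.subspace_sum[OF J_subspace] J_scale step.IH q(1))
  finally show ?case .
qed

lemma II_homogeneous_expand:
  assumes "p \<in> II" "homogeneous d p"
  shows "\<exists>q. (\<forall>j. homogeneous (d - (int m - 1)) (q j)) \<and> p = (\<Sum>j\<in>{1..m}. P j * q j)"
  using in_homogeneous_span_image[of "{1..m}" "\<lambda>_. int m - 1" P p d] assms P_hom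
  by (simp add: II_eq hcomp_homogeneous)

lemma II_component_in_J:
  assumes "p \<in> II" "homogeneous d p" "d \<ge> 2 * int m - int n - 1"
  shows "p \<in> J"
proof -
  obtain q where q: "\<And>j. homogeneous (d - (int m - 1)) (q j)" "p = (\<Sum>j\<in>{1..m}. P j * q j)"
    using II_homogeneous_expand[OF assms(1,2)] by blast
  have "q j * P j \<in> J" if "j \<in> {1..m}" for j
    by (rule form_times_P_in_J[OF that q(1)]) (use assms(3) in simp)
  then show ?thesis
    unfolding q(2) by (intro ideal.subspace_sum[OF J_subspace]) (simp add: mult.commute)
qed

lemma partial_deriv_f_hom: "homogeneous (int m - 1) (partial_deriv i f)"
  unfolding partial_deriv_f
  by (intro homogeneous_sum homogeneous_mult_eq[OF homogeneous_const P_hom]) simp_all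

lemma l_not_dvd_1: "k \<in> {1..m} \<Longrightarrow> \<not> l k dvd 1"
proof
  assume k: "k \<in> {1..m}" and "l k dvd 1"
  then obtain h where "1 = l k * h" by (rule_tac dvdE)
  then have "lookup (l k) 0 * lookup h 0 = 1" by (metis lookup_mult_0 lookup_one_zero)
  moreover have "lookup (l k) 0 = 0" using l_hom[OF k] by (auto simp: homogeneous_alt)
  ultimately show False by simp
qed

lemma l_not_dvd_P: 
  assumes k: "k \<in> {1..m}"
  shows "\<not> l k dvd P k"
proof
  assume "l k dvd P k"
  then obtain i where i: "i \<in> {1..m} - {k}" "l k dvd l i"
    using linear_form_dvd_prod[OF l_hom[OF k] l_nonzero[OF k] _ l_not_dvd_1[OF k]]
    unfolding P_def by blast
  then obtain h where h: "l i = l k * h" by (auto elim: dvdE)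
  have "l i = hcomp 1 (l i)" using hcomp_homogeneous[OF l_hom[of i]] i by simp
  also have "\<dots> = l k * hcomp 0 h" unfolding h by (simp add: hcomp_mult[OF l_hom[OF k]])
  also have "\<dots> = smult_mpoly (lookup (hcomp 0 h) 0) (l k)"
    using homogeneous_degree_0[OF homogeneous_hcomp[of 0 h]] by (simp add: smult_mpoly_def mult.commute)
  finally show False using l_not_smult[of i k] i k by blast
qed

lemma P_syzygy:
  assumes "(\<Sum>k\<in>{1..m}. P k * w k) = 0" and k: "k \<in> {1..m}"
  shows "l k dvd w k"
proof -
  have "P k * w k = - (\<Sum>i\<in>{1..m} - {k}. P i * w i)"
    using assms(1) k by (simp add: sum.remove eq_neg_iff_add_eq_0)
  moreover have "l k dvd P i * w i" if "i \<in> {1..m} - {k}" for i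
    unfolding P_def by (intro dvd_mult2 dvd_prodI) (use k that in auto)
  then have "l k dvd (\<Sum>i\<in>{1..m} - {k}. P i * w i)" by (rule dvd_sum)
  ultimately have "l k dvd P k * w k" by simp
  then show ?thesis
    using linear_form_prime[OF l_hom[OF k] l_nonzero[OF k]] l_not_dvd_P[OF k] by blast
qed

end

section \<open>The socle degree\<close>

interpretation line: coeff_hom "\<lambda>c :: 'k::field. [:c:]"
  by unfold_locales (simp_all add: one_pCons)

lemma coeff_subst_line_eq_0:
  fixes p :: "('n::finite, 'k::field) mpoly"
  assumes p: "homogeneous d p" and q: "int q > d" and \<sigma>: "\<And>i. degree (\<sigma> i) \<le> 1"
  shows "coeff (subst_mpoly (\<lambda>c. [:c:]) \<sigma> p) q = 0"
proof -
  have "coeff ([:lookup p t:] * (\<Prod>i\<in>UNIV. \<sigma> i ^ lookup t i)) q = 0" if t: "t \<in> keys p" for t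
  proof -
    have "degree (\<Prod>i\<in>UNIV. \<sigma> i ^ lookup t i) \<le> (\<Sum>i\<in>UNIV. degree (\<sigma> i ^ lookup t i))"
      using degree_prod_sum_le[of UNIV "\<lambda>i. \<sigma> i ^ lookup t i"] by (simp add: o_def)
    also have "\<dots> \<le> (\<Sum>i\<in>UNIV. lookup t i)"
    proof (rule sum_mono)
      fix i
      have "degree (\<sigma> i ^ lookup t i) \<le> degree (\<sigma> i) * lookup t i" by (rule degree_power_le)
      also have "\<dots> \<le> 1 * lookup t i" by (rule mult_le_mono1[OF \<sigma>])
      finally show "degree (\<sigma> i ^ lookup t i) \<le> lookup t i" by simp
    qed
    also have "\<dots> = monom_deg t" by (simp add: monom_deg_def)
    also have "monom_deg t < q" using p q t by (auto simp: homogeneous_def)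
    finally have "degree (\<Prod>i\<in>UNIV. \<sigma> i ^ lookup t i) < q" .
    then show ?thesis by (simp add: coeff_eq_0)
  qed
  then show ?thesis
    unfolding subst_mpoly_def coeff_sum by (intro sum.neutral ballI)
qed

context generic_forms
begin

text \<open>If \<open>x\<^sub>i\<^sup>e P\<^sub>1 \<in> J\<close>, with \<open>e = m - n - 1\<close>, there is a vector field \<open>u\<close> of degree \<open>e\<close>
  such that \<open>l\<^sub>k\<close> divides \<open>u(l\<^sub>k)\<close> for \<open>k \<noteq> 1\<close> and \<open>l\<^sub>1\<close> divides \<open>u(l\<^sub>1) - x\<^sub>i\<^sup>e\<close>. On the plane where
  \<open>l\<^sub>3, \<dots>, l\<^sub>n\<close> vanish, \<open>u\<close> is tangent to the plane and to the \<open>m - n + 1\<close> lines cut out by the forms \<open>l\<^sub>2\<close>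
  and \<open>l\<^sub>n\<^sub>+\<^sub>1, \<dots>, l\<^sub>m\<close>. For degree reasons it is a multiple of the Euler field there, hence also tangent to
  the line \<open>l\<^sub>1 = 0\<close>, on which \<open>x\<^sub>i\<^sup>e\<close> would then vanish.\<close>

lemma socle_element:
  obtains p where "p \<in> II" "homogeneous (2 * int m - int n - 2) p" "p \<notin> J"
proof -
  define S where "S = {1..n}"
  define C where "C = {3..n}"
  have S: "S \<subseteq> {1..m}" "card S = n" using card_less by (auto simp: S_def)
  have S_eq: "S = insert 1 (insert 2 C)" using card_ge_2 by (auto simp: S_def C_def)
  have finC: "finite C" and C12: "1 \<notin> C" "2 \<notin> C" and cardC: "card C = n - 2"
    by (auto simp: C_def)
  have m12: "1 \<in> {1..m}" "2 \<in> {1..m}" using card_ge_2 card_less by auto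
  obtain \<theta> where \<theta>: "\<forall>k\<in>S. \<forall>j\<in>S. form_val (\<theta> k) (l j) = (if j = k then 1 else 0)"
    and expand: "\<forall>p. homogeneous 1 p \<longrightarrow> p = (\<Sum>k\<in>S. const_mpoly (form_val (\<theta> k) p) * l k)"
    using dual_basis[OF S] by blast
  note expand = expand[rule_format]
  define a b where "a = \<theta> 2" and "b = \<theta> 1"
  have ab: "form_val a (l 1) = 0" "form_val a (l 2) = 1" "form_val b (l 1) = 1" "form_val b (l 2) = 0"
    "q \<in> C \<Longrightarrow> form_val a (l q) = 0" "q \<in> C \<Longrightarrow> form_val b (l q) = 0" for q
    using C12 \<theta> by (auto simp: a_def b_def S_eq)
  have val: "form_val \<eta> (l k) = form_val b (l k) * form_val \<eta> (l 1) + form_val a (l k) * form_val \<eta> (l 2)"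
    if k: "k \<in> {1..m}" and \<eta>: "\<And>q. q \<in> C \<Longrightarrow> form_val \<eta> (l q) = 0" for \<eta> k
  proof -
    have "form_val \<eta> (l k) = (\<Sum>q\<in>S. form_val (\<theta> q) (l k) * form_val \<eta> (l q))"
      by (subst expand[OF l_hom[OF k]]) (simp add: form_val_sum form_val_const)
    then show ?thesis using finC C12 \<eta> by (simp add: S_eq a_def b_def)
  qed
  define K where "K = insert 2 {n + 1..m}"
  have K: "K \<subseteq> {1..m}" "finite K" "K \<inter> C = {}" "1 \<notin> K" "card K = m - n + 1"
    using card_ge_2 card_less by (auto simp: K_def C_def)
  have a_nonzero: "form_val a (l k) \<noteq> 0" if k: "k \<in> K" for k
  proof
    assume 0: "form_val a (l k) = 0"
    have T: "insert 1 (insert k C) \<subseteq> {1..m}" "card (insert 1 (insert k C)) = n"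
      using k K C12 cardC finC card_ge_2 card_less by (auto simp: C_def card_insert_if)
    obtain \<eta> where \<eta>: "\<forall>i\<in>insert 1 (insert k C). \<forall>j\<in>insert 1 (insert k C).
        form_val (\<eta> i) (l j) = (if j = i then 1 else 0)"
      using dual_basis[OF T] by blast
    have "k \<notin> C" "k \<noteq> 1" using k K by auto
    then have "form_val (\<eta> k) (l k) = 1" "form_val (\<eta> k) (l 1) = 0" "\<And>q. q \<in> C \<Longrightarrow> form_val (\<eta> k) (l q) = 0"
      using \<eta> by auto
    then show False using val[of k "\<eta> k"] 0 k K by auto
  qed
  have inj: "form_val b (l k) * form_val a (l k') \<noteq> form_val b (l k') * form_val a (l k)"
    if k: "k \<in> K" "k' \<in> K" "k \<noteq> k'" for k k'
  proof
    assume eq: "form_val b (l k) * form_val a (l k') = form_val b (l k') * form_val a (l k)"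
    have kC: "k \<notin> C" "k' \<notin> C" using k K by auto
    have T: "insert k (insert k' C) \<subseteq> {1..m}" "card (insert k (insert k' C)) = n"
      using k K kC cardC finC card_ge_2 card_less by (auto simp: C_def card_insert_if)
    obtain \<eta> where \<eta>: "\<forall>i\<in>insert k (insert k' C). \<forall>j\<in>insert k (insert k' C).
        form_val (\<eta> i) (l j) = (if j = i then 1 else 0)"
      using dual_basis[OF T] by blast
    have \<eta>k: "form_val (\<eta> k) (l k) = 1" "form_val (\<eta> k) (l k') = 0"
      and \<eta>C: "\<And>q. q \<in> C \<Longrightarrow> form_val (\<eta> k) (l q) = 0"
      using \<eta> kC k(3) by auto
    let ?x = "form_val (\<eta> k) (l 1)" and ?y = "form_val (\<eta> k) (l 2)"
    have 1: "1 = form_val b (l k) * ?x + form_val a (l k) * ?y"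
      using val[of k "\<eta> k"] \<eta>k \<eta>C k K by auto
    have 2: "0 = form_val b (l k') * ?x + form_val a (l k') * ?y"
      using val[of k' "\<eta> k"] \<eta>k \<eta>C k K by auto
    have "form_val a (l k') = form_val a (l k') * (form_val b (l k) * ?x + form_val a (l k) * ?y)"
      using 1 by simp
    also have "\<dots> = (form_val b (l k) * form_val a (l k')) * ?x + form_val a (l k) * form_val a (l k') * ?y"
      by (simp add: algebra_simps)
    also have "\<dots> = form_val a (l k) * (form_val b (l k') * ?x + form_val a (l k') * ?y)"
      unfolding eq by (simp add: algebra_simps)
    also have "\<dots> = 0" using 2 by simp
    finally show False using a_nonzero[OF k(2)] by simp
  qed
  obtain i where i: "a i \<noteq> 0"
    using ab(2) by (force simp: form_val_def)
  define e where "e = m - n - 1"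
  have e: "int e = int m - int n - 1" using card_less by (simp add: e_def)
  define g :: "('n, 'k) mpoly" where "g = var_mpoly i ^ e"
  have g: "homogeneous (int e) g" unfolding g_def by (rule homogeneous_var_power)
  have "g * P 1 \<notin> J"
  proof
    assume "g * P 1 \<in> J"
    then have gP: "g * P 1 \<in> ideal.span ((\<lambda>i. partial_deriv i f) ` UNIV)" by (simp add: J_eq)
    from in_homogeneous_span_image[OF finite partial_deriv_f_hom gP, where d = "int e + (int m - 1)"]
    obtain u where u: "\<And>i. homogeneous (int e) (u i)"
      "hcomp (int e + (int m - 1)) (g * P 1) = (\<Sum>i\<in>UNIV. partial_deriv i f * u i)"
      by auto
    have gP_hom: "homogeneous (int e + (int m - 1)) (g * P 1)"
      by (rule homogeneous_mult[OF g P_hom[OF m12(1)]])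
    define U where "U k = (\<Sum>i\<in>UNIV. const_mpoly (lookup (l k) (single i 1)) * u i)" for k
    have U_hom: "homogeneous (int e) (U k)" for k
      unfolding U_def by (intro homogeneous_sum homogeneous_mult_eq[OF homogeneous_const u(1)]) simp
    have "g * P 1 = (\<Sum>i\<in>UNIV. partial_deriv i f * u i)"
      using u(2) hcomp_homogeneous[OF gP_hom, of "int e + (int m - 1)"] by simp
    also have "\<dots> = (\<Sum>k\<in>{1..m}. P k * U k)"
      unfolding partial_deriv_f U_def sum_distrib_right sum_distrib_left
      by (subst sum.swap) (simp add: mult_ac)
    finally have "(\<Sum>k\<in>{1..m}. P k * (U k - (if k = 1 then g else 0))) =
        g * P 1 - (\<Sum>k\<in>{1..m}. if k = 1 then P 1 * g else 0)"
      by (subst (2) sum.cong[OF refl, of _ _ "\<lambda>k. P k * (if k = 1 then g else 0)"])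
        (auto simp: right_diff_distrib sum_subtractf)
    also have "\<dots> = 0" using m12 by (simp add: mult.commute)
    finally have syz: "(\<Sum>k\<in>{1..m}. P k * (U k - (if k = 1 then g else 0))) = 0" .
    have dvd: "l k dvd U k - (if k = 1 then g else 0)" if "k \<in> {1..m}" for k
      by (rule P_syzygy[OF syz that])
    define \<sigma> where "\<sigma> i = [:b i, a i:]" for i
    define s where "s = subst_mpoly (\<lambda>c. [:c:]) \<sigma>"
    have deg_\<sigma>: "degree (\<sigma> i) \<le> 1" for i by (simp add: \<sigma>_def)
    have s_l: "s (l k) = [:form_val b (l k), form_val a (l k):]" if "k \<in> {1..m}" for k
    proof -
      have pC: "(\<Sum>i\<in>A. [:x i, y i:]) = [:\<Sum>i\<in>A. x i, \<Sum>i\<in>A. y i:]" for A and x y :: "'n \<Rightarrow> 'k"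
        by (induction A rule: infinite_finite_induct) simp_all
      show ?thesis
        unfolding s_def line.subst_linear_form[OF l_hom[OF that]] \<sigma>_def
        by (simp add: pC form_val_def mult.commute)
    qed
    have s_dvd: "s (l k) dvd s (U k)" if "k \<in> {1..m}" "k \<noteq> 1" for k
      using dvd[OF that(1)] that(2) unfolding s_def by (auto elim!: dvdE simp: line.subst_mult)
    define \<alpha> \<beta> where "\<alpha> = s (U 2)" and "\<beta> = s (U 1)"
    have s_U: "s (U k) = [:form_val b (l k):] * \<beta> + [:form_val a (l k):] * \<alpha>" if k: "k \<in> {1..m}" for k
    proof -
      have coef: "lookup (l k) (single i 1) = (\<Sum>q\<in>S. form_val (\<theta> q) (l k) * lookup (l q) (single i 1))" for i
      proof -
        let ?\<delta> = "\<lambda>j. if j = i then 1 else (0 :: 'k)"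
        have \<delta>: "form_val ?\<delta> p = lookup p (single i 1)" for p :: "('n, 'k) mpoly"
          by (simp add: form_val_def if_distrib[of "\<lambda>x. x * _"] cong: if_cong)
        have "form_val ?\<delta> (l k) = (\<Sum>q\<in>S. form_val (\<theta> q) (l k) * form_val ?\<delta> (l q))"
          by (subst expand[OF l_hom[OF k]]) (simp add: form_val_sum form_val_const)
        then show ?thesis unfolding \<delta> .
      qed
      have "U k = (\<Sum>q\<in>S. const_mpoly (form_val (\<theta> q) (l k)) * U q)"
        unfolding U_def coef const_mpoly_sum const_mpoly_mult sum_distrib_right sum_distrib_left
        by (subst sum.swap) (simp add: mult.assoc)
      then have "s (U k) = (\<Sum>q\<in>S. [:form_val (\<theta> q) (l k):] * s (U q))"
        unfolding s_def by (simp only: line.subst_sum line.subst_mult line.subst_const)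
      also have "\<dots> = [:form_val b (l k):] * \<beta> + [:form_val a (l k):] * \<alpha> +
          (\<Sum>q\<in>C. [:form_val (\<theta> q) (l k):] * s (U q))"
        using finC C12 by (simp only: S_eq sum.insert finite_insert insert_iff)
          (simp add: \<alpha>_def \<beta>_def a_def b_def add.assoc)
      also have "(\<Sum>q\<in>C. [:form_val (\<theta> q) (l k):] * s (U q)) = 0"
      proof (rule sum.neutral, rule ballI)
        fix q assume q: "q \<in> C"
        have q': "q \<in> {1..m}" "q \<noteq> 1" using q S(1) C12 by (auto simp: S_eq)
        have "s (l q) = 0" using s_l[OF q'(1)] ab(5,6)[OF q] by simp
        then have "s (U q) = 0" using s_dvd[OF q'] by simp
        then show "[:form_val (\<theta> q) (l k):] * s (U q) = 0" by simp
      qed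
      finally show ?thesis by simp
    qed
    define Q where "Q = \<alpha> - [:0, 1:] * \<beta>"
    define r where "r k = - form_val b (l k) / form_val a (l k)" for k
    have coeff_U: "coeff (s (U k)) q = 0" if "q > e" for k q
      unfolding s_def by (rule coeff_subst_line_eq_0[OF U_hom]) (use that deg_\<sigma> in auto)
    have root: "poly Q (r k) = 0" if k: "k \<in> K" for k
    proof -
      have k': "k \<in> {1..m}" "k \<noteq> 1" using k K by auto
      obtain h where h: "s (U k) = s (l k) * h" using s_dvd[OF k'] by (auto elim: dvdE)
      have "poly (s (U k)) (r k) = 0"
        unfolding h s_l[OF k'(1)] using a_nonzero[OF k] by (simp add: r_def)
      then have "form_val b (l k) * poly \<beta> (r k) + form_val a (l k) * poly \<alpha> (r k) = 0"
        by (simp add: s_U[OF k'(1)])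
      then have "form_val a (l k) * poly Q (r k) = 0"
        using a_nonzero[OF k] by (simp add: Q_def r_def field_simps)
      then show ?thesis using a_nonzero[OF k] by simp
    qed
    have "Q = 0"
    proof (rule ccontr)
      assume Q: "Q \<noteq> 0"
      have "inj_on r K"
      proof (rule inj_onI, rule ccontr)
        fix k k' assume k: "k \<in> K" "k' \<in> K" "r k = r k'" "k \<noteq> k'"
        then have "form_val b (l k) * form_val a (l k') = form_val b (l k') * form_val a (l k)"
          using a_nonzero[OF k(1)] a_nonzero[OF k(2)] by (simp add: r_def frac_eq_eq)
        then show False using inj[OF k(1,2,4)] by simp
      qed
      then have "m - n + 1 = card (r ` K)" using K(5) by (simp add: card_image)
      also have "\<dots> \<le> card {x. poly Q x = 0}"
        by (rule card_mono[OF poly_roots_finite[OF Q]]) (use root in auto)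
      also have "\<dots> \<le> degree Q" by (rule card_poly_roots_bound[OF Q])
      also have "\<dots> \<le> e + 1"
      proof (rule degree_le, intro allI impI)
        fix q assume "q > e + 1"
        then show "coeff Q q = 0"
          using coeff_U by (cases q) (simp_all add: Q_def \<alpha>_def \<beta>_def)
      qed
      finally show False using card_less by (simp add: e_def)
    qed
    then have "coeff \<beta> e = coeff \<alpha> (e + 1)" by (simp add: Q_def)
    then have \<beta>0: "coeff \<beta> e = 0" using coeff_U by (simp add: \<alpha>_def)
    obtain h where "U 1 - g = l 1 * h" using dvd[OF m12(1)] by (auto elim: dvdE)
    moreover have "homogeneous (int e) (U 1 - g)" by (rule homogeneous_diff[OF U_hom g])
    ultimately have "U 1 - g = l 1 * hcomp (int e - 1) h"
      by (metis hcomp_homogeneous hcomp_mult l_hom m12(1))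
    then have "\<beta> - s g = s (l 1) * s (hcomp (int e - 1) h)"
      unfolding \<beta>_def s_def by (metis line.subst_diff line.subst_mult)
    moreover have "s (l 1) = 1" using s_l[OF m12(1)] ab by (simp add: one_pCons)
    moreover have "coeff (s (hcomp (int e - 1) h)) e = 0"
      unfolding s_def by (rule coeff_subst_line_eq_0[OF homogeneous_hcomp]) (use deg_\<sigma> in auto)
    ultimately have "coeff (s g) e = 0" using \<beta>0 by (metis coeff_diff diff_zero mult_1 right_minus_eq)
    moreover have "s g = [:b i, a i:] ^ e"
      by (simp add: s_def g_def line.subst_power line.subst_var \<sigma>_def)
    moreover have "coeff ([:b i, a i:] ^ e) e = a i ^ e"
      using lead_coeff_power[of "[:b i, a i:]" e] degree_power_eq[of "[:b i, a i:]" e] i by simp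
    ultimately show False using i by simp
  qed
  moreover have "g * P 1 \<in> II" by (intro II_scale P_in_II m12)
  moreover have "homogeneous (2 * int m - int n - 2) (g * P 1)"
    by (rule homogeneous_mult_eq[OF g P_hom[OF m12(1)]]) (simp add: e)
  ultimately show thesis using that by blast
qed

end

section \<open>Saturation and regularity\<close>

lemma weight_le_length: "weight bs \<le> int (length bs)"
  by (simp add: weight_def)

lemma weight_eq_length: "weight bs = int (length bs) \<longleftrightarrow> bs = replicate (length bs) True"
proof (induction bs)
  case (Cons b bs)
  then show ?case using weight_le_length[of bs] by (cases b) auto
qed simp

lemma koszul_in_ideal:
  assumes I: "ideal.subspace I" and c: "\<And>x b. var_mpoly x * c b \<in> I"
  shows "koszul vs c bs \<in> I"
  using c
proof (induction vs c bs rule: koszul.induct)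
  case (1 v vs c bs)
  then show ?case using ideal.subspace_neg[OF I] by simp
next
  case (2 v vs c bs)
  then show ?case using ideal.subspace_add[OF I] by simp
qed (simp_all add: ideal.subspace_0[OF I])

text \<open>The socle of \<open>R / I\<close> is the top Koszul homology of \<open>R / I\<close>, which is the Koszul homology of \<open>I\<close>
  one step below the top.\<close>

lemma socle_in_ideal:
  fixes I :: "('n::finite, 'k::field) mpoly set"
  assumes I: "ideal.subspace I" and p: "homogeneous e p" and xp: "\<And>x. var_mpoly x * p \<in> I"
    and van: "koszul_vanishing (int CARD('n) - 1) (e + int CARD('n)) (ideal_gmod I)"
  shows "p \<in> I"
proof -
  let ?vs = "var_list :: 'n list" and ?N = "int CARD('n)" and ?F = "free_gmod 1 (\<lambda>_. 0) :: ('n, 'k) gmod"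
  have len: "length ?vs = CARD('n)"
    using distinct_card[OF var_list(1)[where 'n = 'n]] by (simp add: var_list(2))
  define T where "T = replicate CARD('n) True"
  have wT: "weight bs = ?N \<and> length bs = length ?vs \<longleftrightarrow> bs = T" for bs
    using weight_eq_length[of bs] weight_eq_length[of T] by (auto simp: T_def len)
  define c where "c bs i = (if bs = T \<and> i = 0 then p else 0)" for bs and i :: nat
  have c: "koszul_chain ?vs ?N (e + ?N) ?F c"
  proof (rule koszul_chainI)
    show "c bs \<in> ?F (e + ?N - ?N)" for bs
      using p by (simp add: free_gmod_def c_def)
    fix bs assume "\<not> (length bs = length ?vs \<and> weight bs = ?N)"
    then have "bs \<noteq> T" using wT by blast
    then show "c bs = 0" by (simp add: c_def fun_eq_iff)
  qed
  then have dc: "koszul_chain ?vs (?N - 1) (e + ?N) ?F (koszul_mod ?vs c)"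
    by (intro koszul_chain_koszul_mod[OF graded_submodule_free]) simp
  have "koszul_mod ?vs c bs 0 \<in> I" for bs
    unfolding koszul_mod_def
    by (rule koszul_in_ideal[OF I]) (use xp ideal.subspace_0[OF I] in \<open>simp add: c_def\<close>)
  then have "koszul_chain ?vs (?N - 1) (e + ?N) (ideal_gmod I) (koszul_mod ?vs c)"
    using free_gmodD[OF koszul_chainD1[OF dc]] koszul_chainD2[OF dc]
    by (intro koszul_chainI) (force simp: ideal_gmod_def)+
  then obtain u where u: "koszul_chain ?vs (?N - 1 + 1) (e + ?N) (ideal_gmod I) u"
    "\<And>bs. koszul_mod ?vs u bs = koszul_mod ?vs c bs"
    using van unfolding koszul_vanishing_def by (metis koszul_mod_koszul_mod)
  have u': "koszul_chain ?vs ?N (e + ?N) (ideal_gmod I) u" using u(1) by simp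
  have uF: "koszul_chain ?vs ?N (e + ?N) ?F u"
    by (rule koszul_chain_mono[OF u']) (use ideal_gmod_free in blast)
  have "\<exists>v. koszul_chain ?vs (?N + 1) (e + ?N) ?F v \<and> (\<forall>bs. koszul_mod ?vs v bs = c bs - u bs)"
  proof (rule free_exact)
    show "koszul_chain ?vs ?N (e + ?N) ?F (\<lambda>bs. c bs - u bs)"
      by (rule koszul_chain_diff[OF graded_submodule_free c uF])
    show "koszul_mod ?vs (\<lambda>bs. c bs - u bs) bs = 0" for bs
      by (simp add: koszul_mod_diff u(2))
  qed simp
  then obtain v where v: "koszul_chain ?vs (?N + 1) (e + ?N) ?F v"
    "\<And>bs. koszul_mod ?vs v bs = c bs - u bs" by blast
  have "v bs = 0" for bs
  proof (rule koszul_chainD2[OF v(1)])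
    show "\<not> (length bs = length ?vs \<and> weight bs = ?N + 1)"
      using weight_le_length[of bs] by (simp add: len)
  qed
  then have "koszul_mod ?vs v T = 0" by (simp add: koszul_mod_def fun_eq_iff)
  then have "u T 0 = p" using fun_cong[OF v(2)[of T], of 0] by (simp add: c_def)
  moreover have "u T \<in> ideal_gmod I (e + ?N - ?N)"
    by (rule koszul_chainD1[OF u']) (use wT[of T] in auto)
  ultimately show ?thesis by (auto simp: ideal_gmod_def)
qed

lemma koszul_vanishing_trivial:
  assumes "\<And>d. Z d \<subseteq> {0}" "graded_submodule Z"
  shows "koszul_vanishing p d Z"
  unfolding koszul_vanishing_def
proof (intro allI impI)
  fix c assume c: "koszul_chain var_list p d Z c"
  have c0: "c bs = 0" for bs
    using koszul_chainD1[OF c, of bs] koszul_chainD2[OF c, of bs] assms(1)[of "d - p"] by blast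
  show "\<exists>u. koszul_chain var_list (p + 1) d Z u \<and> (\<forall>bs. koszul_mod var_list u bs = c bs)"
    by (rule exI[of _ "\<lambda>_. 0"])
      (simp add: c0 koszul_chain_def graded_submoduleD(1)[OF assms(2)] koszul_mod_def fun_eq_iff)
qed

definition order_ge :: "nat \<Rightarrow> ('n::finite, 'k::field) mpoly \<Rightarrow> bool" where
  "order_ge k q \<longleftrightarrow> (\<forall>t\<in>keys q. k \<le> monom_deg t)"

lemma order_ge_mult:
  assumes "order_ge j p" "order_ge k q"
  shows "order_ge (j + k) (p * q)"
  unfolding order_ge_def
proof
  fix t assume "t \<in> keys (p * q)"
  then obtain a b where "t = a + b" "a \<in> keys p" "b \<in> keys q"
    using keys_mult[of p q] by blast
  then show "j + k \<le> monom_deg t"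
    using assms by (auto simp: order_ge_def monom_deg_add intro: add_mono)
qed

lemma order_ge_0 [simp]: "order_ge 0 p"
  by (simp add: order_ge_def)

lemma order_ge_add: "order_ge k p \<Longrightarrow> order_ge k q \<Longrightarrow> order_ge k (p + q)"
  unfolding order_ge_def using keys_add[of p q] by blast

lemma order_ge_irrelevant: "p \<in> irrelevant_ideal \<Longrightarrow> order_ge 1 p"
  unfolding order_ge_def irrelevant_ideal_iff
  by (metis in_keys_iff less_one monom_deg_eq_0_iff not_less)

lemma ideal_power_order_ge: "q \<in> ideal_power irrelevant_ideal k \<Longrightarrow> order_ge k q"
proof (induction k arbitrary: q)
  case (Suc k)
  then have "q \<in> ideal.span {a * b |a b. a \<in> irrelevant_ideal \<and> b \<in> ideal_power irrelevant_ideal k}"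
    by (simp add: ideal_prod_def)
  then show ?case
  proof (induction rule: ideal.span_induct_alt)
    case base
    show ?case by (simp add: order_ge_def)
  next
    case (step c x y)
    then obtain a b where ab: "x = a * b" "a \<in> irrelevant_ideal" "b \<in> ideal_power irrelevant_ideal k"
      by blast
    have "order_ge (1 + k) (a * b)"
      by (rule order_ge_mult[OF order_ge_irrelevant[OF ab(2)] Suc.IH[OF ab(3)]])
    from order_ge_mult[OF order_ge_0 this, of c] step show ?case
      by (simp add: ab(1) order_ge_add)
  qed
qed simp

lemma in_ideal_if_components:
  assumes "ideal.subspace I" "\<And>d. hcomp d p * q \<in> I"
  shows "p * q \<in> I"
proof -
  have "p * q = (\<Sum>d\<in>(\<lambda>t. int (monom_deg t)) ` keys p. hcomp d p * q)"
    by (simp add: hcomp_decompose flip: sum_distrib_right)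
  also have "\<dots> \<in> I" by (intro ideal.subspace_sum[OF assms(1)] assms(2))
  finally show ?thesis .
qed

lemma hcomp_order_ge: "order_ge k p \<Longrightarrow> d < int k \<Longrightarrow> hcomp d p = 0"
proof (rule poly_mapping_eqI)
  fix t assume "order_ge k p" "d < int k"
  then have "lookup p t \<noteq> 0 \<Longrightarrow> d < int (monom_deg t)"
    by (force simp: order_ge_def in_keys_iff)
  then show "lookup (hcomp d p) t = lookup 0 t"
    by (auto simp: lookup_hcomp)
qed

lemma var_mult_ideal_power:
  "q \<in> ideal_power irrelevant_ideal k \<Longrightarrow> var_mpoly x * q \<in> ideal_power irrelevant_ideal (Suc k)"
proof -
  assume q: "q \<in> ideal_power irrelevant_ideal k"
  have "var_mpoly x \<in> irrelevant_ideal" by (simp add: irrelevant_ideal_iff)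
  with q show ?thesis unfolding ideal_power.simps ideal_prod_def by (intro ideal.span_base) blast
qed

context generic_forms
begin

definition r :: int where "r = 2 * int m - int n - 1"

lemma r_ge: "r \<ge> int m"
  using card_less by (simp add: r_def)

lemma J_homogeneous: "homogeneous_ideal J" and II_homogeneous: "homogeneous_ideal II"
proof -
  show "homogeneous_ideal J"
    unfolding J_eq by (rule homogeneous_ideal_span[OF finite partial_deriv_f_hom])
  show "homogeneous_ideal II"
    unfolding II_eq by (rule homogeneous_ideal_span[where s = "\<lambda>_. int m - 1"]) (simp_all add: P_hom)
qed

definition pres1 :: "nat \<Rightarrow> nat \<Rightarrow> ('n, 'k) mpoly" where
  "pres1 i k = (if i = 0 then P (Suc k) else 0)"

definition pres2 :: "nat \<Rightarrow> nat \<Rightarrow> ('n, 'k) mpoly" where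
  "pres2 i k = (if i = 0 then l 1 else if i = Suc k then - l (Suc i) else 0)"

abbreviation free1 :: "('n, 'k) gmod" where "free1 \<equiv> free_gmod m (\<lambda>_. int m - 1)"
abbreviation free2 :: "('n, 'k) gmod" where "free2 \<equiv> free_gmod (m - 1) (\<lambda>_. int m)"
abbreviation syzygies :: "('n, 'k) gmod" where "syzygies \<equiv> ker_gmod m (\<lambda>_. int m - 1) pres1"

lemma mat_vec_pres1: "mat_vec m pres1 v = (\<lambda>i. if i = 0 then \<Sum>j\<in>{1..m}. P j * v (j - 1) else 0)"
  by (simp add: mat_vec_def pres1_def fun_eq_iff sum.atLeast1_atMost_eq)

lemma mat_vec_pres2:
  "mat_vec (m - 1) pres2 w =
    (\<lambda>i. if i = 0 then l 1 * (\<Sum>k<m - 1. w k) else if i < m then - l (Suc i) * w (i - 1) else 0)"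
proof
  fix i
  show "mat_vec (m - 1) pres2 w i =
    (if i = 0 then l 1 * (\<Sum>k<m - 1. w k) else if i < m then - l (Suc i) * w (i - 1) else 0)"
  proof (cases i)
    case 0
    then show ?thesis by (simp add: mat_vec_def pres2_def sum_distrib_left)
  next
    case (Suc i')
    have "mat_vec (m - 1) pres2 w i = (\<Sum>k<m - 1. if k = i' then - l (Suc i) * w i' else 0)"
      unfolding mat_vec_def by (intro sum.cong) (auto simp: pres2_def Suc)
    then show ?thesis using Suc by auto
  qed
qed

lemmas mat_vec_pres2_simp = mat_vec_pres2[unfolded One_nat_def]

lemma presentation_II: "presentation m (\<lambda>_. int m - 1) pres1 (ideal_gmod II)"
proof
  show "graded_submodule (ideal_gmod II)" by (rule graded_submodule_ideal[OF II_subspace])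
  show "mat_vec m pres1 ` free1 d = ideal_gmod II d" for d
  proof (intro equalityI subsetI)
    fix x assume "x \<in> mat_vec m pres1 ` free1 d"
    then obtain v where v: "v \<in> free1 d" "x = mat_vec m pres1 v" by blast
    have x0: "x 0 = (\<Sum>j\<in>{1..m}. v (j - 1) * P j)" by (simp add: v(2) mat_vec_pres1 mult.commute)
    have "x 0 \<in> II"
      unfolding x0 by (intro ideal.subspace_sum[OF II_subspace] II_scale P_in_II)
    moreover have "homogeneous d (x 0)"
      unfolding x0
      by (intro homogeneous_sum homogeneous_mult_eq[OF free_gmodD(1)[OF v(1)] P_hom]) auto
    ultimately show "x \<in> ideal_gmod II d"
      by (simp add: ideal_gmod_def) (simp add: v(2) mat_vec_pres1)
  next
    fix x assume "x \<in> ideal_gmod II d"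
    then have x: "x 0 \<in> II" "homogeneous d (x 0)" "\<And>i. i > 0 \<Longrightarrow> x i = 0"
      by (auto simp: ideal_gmod_def)
    obtain q where q: "\<And>j. homogeneous (d - (int m - 1)) (q j)" "x 0 = (\<Sum>j\<in>{1..m}. P j * q j)"
      using II_homogeneous_expand[OF x(1,2)] by blast
    define v where "v k = (if k < m then q (Suc k) else 0)" for k
    have "v \<in> free1 d" using q(1) by (simp add: free_gmod_def v_def)
    moreover have "x = mat_vec m pres1 v"
    proof
      fix i
      have "(\<Sum>j\<in>{1..m}. P j * v (j - 1)) = x 0"
        unfolding q(2) by (intro sum.cong) (auto simp: v_def)
      then show "x i = mat_vec m pres1 v i" using x(3)[of i] by (simp add: mat_vec_pres1)
    qed
    ultimately show "x \<in> mat_vec m pres1 ` free1 d" by blast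
  qed
qed

lemma presentation_syzygies:
  "presentation (m - 1) (\<lambda>_. int m) pres2 (syzygies)"
proof
  show "graded_submodule (syzygies)" by (rule graded_submodule_ker)
  fix d
  have m: "m = Suc (m - 1)" using card_less by simp
  have split: "(\<Sum>j\<in>{1..m}. F j) = F 1 + (\<Sum>k<m - 1. F (Suc (Suc k)))" for F :: "nat \<Rightarrow> ('n, 'k) mpoly"
  proof -
    have "(\<Sum>j\<in>{1..m}. F j) = (\<Sum>k<Suc (m - 1). F (Suc k))"
      using m by (simp add: sum.atLeast1_atMost_eq)
    then show ?thesis unfolding sum.lessThan_Suc_shift by simp
  qed
  show "mat_vec (m - 1) pres2 ` free2 d = syzygies d"
  proof (intro equalityI subsetI)
    fix x assume "x \<in> mat_vec (m - 1) pres2 ` free2 d"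
    then obtain w where w: "w \<in> free2 d" "x = mat_vec (m - 1) pres2 w" by blast
    have "P 1 * x 0 = (l 1 * P 1) * (\<Sum>k<m - 1. w k)"
      by (simp add: w(2) mat_vec_pres2_simp mult_ac)
    moreover have "l 1 * P 1 = f" by (rule l_P) (use card_less in auto)
    moreover have "P (Suc (Suc k)) * x (Suc k) = - (f * w k)" if k: "k < m - 1" for k
    proof -
      have "P (Suc (Suc k)) * x (Suc k) = - ((l (Suc (Suc k)) * P (Suc (Suc k))) * w k)"
        using k by (simp add: w(2) mat_vec_pres2_simp less_diff_conv mult_ac)
      also have "l (Suc (Suc k)) * P (Suc (Suc k)) = f" by (rule l_P) (use k in auto)
      finally show ?thesis .
    qed
    ultimately have "(\<Sum>j\<in>{1..m}. P j * x (j - 1)) = 0"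
      unfolding split by (simp add: sum_negf sum_distrib_left)
    then have "mat_vec m pres1 x = 0" by (simp add: mat_vec_pres1 fun_eq_iff)
    moreover have "x \<in> free1 d"
      unfolding free_gmod_def
    proof (clarsimp, intro conjI impI)
      fix i assume i: "i < m"
      have eq: "1 + (d - int m) = d - (int m - 1)" by simp
      show "homogeneous (d - (int m - 1)) (x i)"
      proof (cases "i = 0")
        case True
        have "homogeneous (d - int m) (\<Sum>k<m - 1. w k)"
          by (intro homogeneous_sum free_gmodD(1)[OF w(1)]) simp
        from homogeneous_mult_eq[OF l_hom[of 1] this eq] True i show ?thesis
          by (simp add: w(2) mat_vec_pres2_simp)
      next
        case False
        have "homogeneous (d - int m) (w (i - 1))"
          using free_gmodD(1)[OF w(1), of "i - 1"] i False by simp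
        from homogeneous_mult_eq[OF l_hom[of "Suc i"] this eq] False i show ?thesis
          by (simp add: w(2) mat_vec_pres2_simp)
      qed
    next
      fix i assume "\<not> i < m"
      then show "x i = 0" using m by (simp add: w(2) mat_vec_pres2_simp)
    qed
    ultimately show "x \<in> syzygies d" by (simp add: ker_gmod_def)
  next
    fix v assume "v \<in> syzygies d"
    then have v: "v \<in> free1 d" and mv: "mat_vec m pres1 v = 0"
      by (simp_all add: ker_gmod_def)
    have syz: "(\<Sum>j\<in>{1..m}. P j * v (j - 1)) = 0"
      using fun_cong[OF mv[unfolded mat_vec_pres1], of 0] by simp
    have "\<exists>h. homogeneous (d - int m) h \<and> v (j - 1) = l j * h" if j: "j \<in> {1..m}" for j
    proof -
      obtain h where h: "v (j - 1) = l j * h" using P_syzygy[OF syz j] by (auto elim: dvdE)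
      have "homogeneous (d - (int m - 1)) (v (j - 1))"
        by (rule free_gmodD(1)[OF v]) (use j in auto)
      then have "v (j - 1) = hcomp (d - (int m - 1)) (l j * h)"
        using hcomp_homogeneous[of "d - (int m - 1)" "v (j - 1)" "d - (int m - 1)"] h by simp
      also have "\<dots> = l j * hcomp (d - int m) h"
        by (simp add: hcomp_mult[OF l_hom[OF j]])
      finally show ?thesis by (intro exI[of _ "hcomp (d - int m) h"]) simp
    qed
    then obtain h where h: "\<And>j. j \<in> {1..m} \<Longrightarrow> homogeneous (d - int m) (h j)"
      "\<And>j. j \<in> {1..m} \<Longrightarrow> v (j - 1) = l j * h j" by metis
    have "f * (\<Sum>j\<in>{1..m}. h j) = (\<Sum>j\<in>{1..m}. P j * v (j - 1))"
      unfolding sum_distrib_left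
    proof (rule sum.cong[OF refl])
      fix j assume j: "j \<in> {1..m}"
      show "f * h j = P j * v (j - 1)" unfolding h(2)[OF j] l_P[OF j, symmetric] by (simp add: mult_ac)
    qed
    then have "(\<Sum>j\<in>{1..m}. h j) = 0" using syz f_nonzero mpoly_mult_eq_0 by metis
    then have h1: "h 1 = (\<Sum>k<m - 1. - h (Suc (Suc k)))"
      unfolding split by (simp add: sum_negf eq_neg_iff_add_eq_0)
    define w where "w k = (if k < m - 1 then - h (Suc (Suc k)) else 0)" for k
    have "w \<in> free2 d"
      using h(1) by (auto simp: free_gmod_def w_def)
    moreover have "v = mat_vec (m - 1) pres2 w"
    proof
      fix i
      consider "i = 0" | "i > 0" "i < m" | "i \<ge> m" by linarith
      then show "v i = mat_vec (m - 1) pres2 w i"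
      proof cases
        case 1
        have "(\<Sum>k<m - 1. w k) = h 1" unfolding h1 by (intro sum.cong) (auto simp: w_def)
        then show ?thesis using 1 h(2)[of 1] m by (simp add: mat_vec_pres2_simp)
      next
        case 2
        then show ?thesis using h(2)[of "Suc i"] by (simp add: mat_vec_pres2_simp w_def)
      next
        case 3
        then show ?thesis using free_gmodD(2)[OF v, of i] m by (simp add: mat_vec_pres2_simp)
      qed
    qed
    ultimately show "v \<in> mat_vec (m - 1) pres2 ` free2 d" by blast
  qed
qed

lemma syzygies_free: "ker_gmod (m - 1) (\<lambda>_. int m) pres2 d \<subseteq> {0}"
proof
  fix w assume "w \<in> ker_gmod (m - 1) (\<lambda>_. int m) pres2 d"
  then have w: "w \<in> free2 d" "mat_vec (m - 1) pres2 w = 0"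
    by (auto simp: ker_gmod_def)
  have "w k = 0" for k
  proof (cases "k < m - 1")
    case True
    have "l (Suc (Suc k)) * w k = 0"
      using fun_cong[OF w(2)[unfolded mat_vec_pres2], of "Suc k"] True by (simp add: less_diff_conv)
    moreover have "l (Suc (Suc k)) \<noteq> 0" using True by (intro l_nonzero) auto
    ultimately show ?thesis using mpoly_mult_eq_0 by blast
  next
    case False
    then show ?thesis by (rule free_gmodD(2)[OF w(1)])
  qed
  then show "w \<in> {0}" by (simp add: fun_eq_iff)
qed

lemma koszul_vanishing_II:
  assumes "k \<ge> 2 \<or> d > int m - 1 + int k"
  shows "koszul_vanishing (int k) d (ideal_gmod II)"
proof -
  interpret p1: presentation m "\<lambda>_. int m - 1" pres1 "ideal_gmod II" by (rule presentation_II)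
  interpret p2: presentation "m - 1" "\<lambda>_. int m" pres2 "syzygies"
    by (rule presentation_syzygies)
  consider "k = 0" | "k = 1" | k' where "k = Suc (Suc k')" by (metis One_nat_def not0_implies_Suc)
  then show ?thesis
  proof cases
    case 1
    then show ?thesis using assms p1.koszul_vanishing_0[of d] by simp
  next
    case 2
    have "koszul_vanishing 0 d (syzygies)"
      by (rule p2.koszul_vanishing_0) (use assms 2 in simp)
    from p1.koszul_vanishing_Suc[OF _ this] show ?thesis using 2 by simp
  next
    case 3
    have "koszul_vanishing (int k') d (ker_gmod (m - 1) (\<lambda>_. int m) pres2)"
      by (rule koszul_vanishing_trivial[OF syzygies_free graded_submodule_ker])
    from p2.koszul_vanishing_Suc[OF _ this]
    have "koszul_vanishing (int k' + 1) d (syzygies)" by simp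
    from p1.koszul_vanishing_Suc[OF _ this]
    have "koszul_vanishing (int k' + 1 + 1) d (ideal_gmod II)" by simp
    moreover have "int k' + 1 + 1 = int k" using 3 by simp
    ultimately show ?thesis by simp
  qed
qed

lemma ideal_gmod_J: "d \<ge> r \<Longrightarrow> v \<in> ideal_gmod II d \<Longrightarrow> v \<in> ideal_gmod J d"
  by (auto simp: ideal_gmod_def r_def intro: II_component_in_J)

lemma koszul_vanishing_J:
  assumes d: "d > r + int k"
  shows "koszul_vanishing (int k) d (ideal_gmod J)"
  unfolding koszul_vanishing_def
proof (intro allI impI)
  fix c assume c: "koszul_chain var_list (int k) d (ideal_gmod J) c"
    and cycle: "\<forall>bs. koszul_mod var_list c bs = 0"
  have "koszul_chain var_list (int k) d (ideal_gmod II) c"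
    by (rule koszul_chain_mono[OF c]) (use J_subset_II in \<open>auto simp: ideal_gmod_def\<close>)
  moreover have "koszul_vanishing (int k) d (ideal_gmod II)"
    by (rule koszul_vanishing_II) (use d r_ge in simp)
  ultimately obtain u where u: "koszul_chain var_list (int k + 1) d (ideal_gmod II) u"
    "\<forall>bs. koszul_mod var_list u bs = c bs"
    using cycle unfolding koszul_vanishing_def by blast
  have "koszul_chain var_list (int k + 1) d (ideal_gmod J) u"
    by (rule koszul_chain_mono[OF u(1)], rule ideal_gmod_J) (use d in simp_all)
  with u(2) show "\<exists>u. koszul_chain var_list (int k + 1) d (ideal_gmod J) u \<and>
      (\<forall>bs. koszul_mod var_list u bs = c bs)" by blast
qed

lemma koszul_nonvanishing_J: "\<not> koszul_vanishing (int (n - 1)) (r + int (n - 1)) (ideal_gmod J)"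
proof
  assume van: "koszul_vanishing (int (n - 1)) (r + int (n - 1)) (ideal_gmod J)"
  obtain p where p: "p \<in> II" "homogeneous (2 * int m - int n - 2) p" "p \<notin> J"
    by (rule socle_element)
  have ph: "homogeneous (r - 1) p" using p(2) by (simp add: r_def algebra_simps)
  have xp: "var_mpoly x * p \<in> J" for x
    by (rule II_component_in_J[OF II_scale[OF p(1)] homogeneous_mult[OF homogeneous_var p(2)]]) simp
  have "int (n - 1) = int CARD('n) - 1" "r + (int CARD('n) - 1) = r - 1 + int CARD('n)"
    using card_ge_2 by (simp_all add: n_eq[symmetric] of_nat_diff)
  then have van': "koszul_vanishing (int CARD('n) - 1) (r - 1 + int CARD('n)) (ideal_gmod J)"
    using van by (simp only:)
  have "p \<in> J" by (rule socle_in_ideal[OF J_subspace ph xp van'])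
  then show False using p(3) by simp
qed

lemma regularity_J: "regularity J = r"
  by (rule regularity_eqI[OF J_homogeneous koszul_vanishing_J koszul_nonvanishing_J])

lemma order_ge_mult_P_in_J:
  assumes j: "j \<in> {1..m}" and x: "order_ge (m - n) x"
  shows "x * P j \<in> J"
proof (rule in_ideal_if_components[OF J_subspace])
  fix d
  show "hcomp d x * P j \<in> J"
  proof (cases "d < int (m - n)")
    case True
    then show ?thesis using hcomp_order_ge[OF x] ideal.subspace_0[OF J_subspace] by simp
  next
    case False
    then show ?thesis
      using card_less by (intro form_times_P_in_J[OF j homogeneous_hcomp]) (simp add: of_nat_diff)
  qed
qed

lemma order_ge_mult_II_in_J:
  assumes p: "p \<in> II" and q: "order_ge (m - n) q"
  shows "p * q \<in> J"
proof -
  obtain h where h: "p = (\<Sum>j\<in>{1..m}. P j * h j)"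
    using p in_ideal_span_image[of "{1..m}" p P] by (auto simp: II_eq)
  have "p * q = (\<Sum>j\<in>{1..m}. (h j * q) * P j)"
    by (simp add: h sum_distrib_left sum_distrib_right mult_ac)
  also have "\<dots> \<in> J"
  proof (intro ideal.subspace_sum[OF J_subspace] order_ge_mult_P_in_J)
    show "order_ge (m - n) (h j * q)" for j
      using order_ge_mult[OF order_ge_0 q, of "h j"] by simp
  qed
  finally show ?thesis .
qed

lemma II_saturated:
  assumes n3: "n \<ge> 3" and xp: "\<And>x. var_mpoly x * p \<in> II"
  shows "p \<in> II"
proof -
  have "hcomp d p * 1 \<in> II" for d
  proof -
    have "koszul_vanishing (int (n - 1)) (d + int CARD('n)) (ideal_gmod II)"
      by (rule koszul_vanishing_II) (use n3 in auto)
    then have van: "koszul_vanishing (int CARD('n) - 1) (d + int CARD('n)) (ideal_gmod II)"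
      using card_ge_2 by (simp add: n_eq[symmetric] of_nat_diff)
    have "var_mpoly x * hcomp d p \<in> II" for x
    proof -
      have "hcomp (d + 1) (var_mpoly x * p) \<in> II"
        using II_homogeneous xp by (simp add: homogeneous_ideal_def)
      then show ?thesis by (simp add: hcomp_mult[OF homogeneous_var])
    qed
    from socle_in_ideal[OF II_subspace homogeneous_hcomp this van] show ?thesis by simp
  qed
  from in_ideal_if_components[OF II_subspace this] show ?thesis by simp
qed

lemma colon_power_subset_II:
  assumes n3: "n \<ge> 3" and "\<And>q. q \<in> ideal_power irrelevant_ideal k \<Longrightarrow> p * q \<in> II"
  shows "p \<in> II"
  using assms(2)
proof (induction k)
  case 0
  then show ?case using 0[of 1] by simp
next
  case (Suc k)
  show ?case
  proof (rule Suc.IH)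
    fix q :: "('n, 'k) mpoly" assume q: "q \<in> ideal_power irrelevant_ideal k"
    show "p * q \<in> II"
    proof (rule II_saturated[OF n3])
      fix x
      show "var_mpoly x * (p * q) \<in> II"
        using Suc.prems[OF var_mult_ideal_power[OF q, of x]] by (simp add: mult_ac)
    qed
  qed
qed

lemma saturation_J_eq_II:
  assumes n3: "n \<ge> 3"
  shows "saturation J = II"
proof (intro equalityI subsetI)
  fix p assume "p \<in> saturation J"
  then obtain k where "\<And>q :: ('n, 'k) mpoly. q \<in> ideal_power irrelevant_ideal k \<Longrightarrow> p * q \<in> J"
    by (auto simp: saturation_def ideal_colon_def)
  then show "p \<in> II" using colon_power_subset_II[OF n3, of k p] J_subset_II by blast
next
  fix p assume p: "p \<in> II"
  have "p \<in> ideal_colon J (ideal_power irrelevant_ideal (m - n))"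
    unfolding ideal_colon_def using order_ge_mult_II_in_J[OF p] ideal_power_order_ge by blast
  then show "p \<in> saturation J" by (auto simp: saturation_def)
qed

lemma II_contains_high_degree:
  assumes n2: "n = 2" and g: "homogeneous d g" and d: "d \<ge> int m - 1"
  shows "g \<in> II"
  using d g
proof (induction d arbitrary: g rule: int_ge_induct)
  case base
  have "int m - 1 > 0" using card_less n2 by simp
  from homogeneous_var_expand[OF base this]
  obtain q where q: "\<And>i. homogeneous (int m - 1 - 1) (q i)" "g = (\<Sum>i\<in>UNIV. var_mpoly i * q i)"
    by auto
  have "q i \<in> {h. \<forall>x. var_mpoly x * h \<in> II}" for i
  proof (rule products_span[of "{1..m}" m "{}" "m - 2"])
    show "mpoly.subspace {h. \<forall>x. var_mpoly x * h \<in> II}"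
      using II_subspace unfolding mpoly.subspace_def ideal.subspace_def
      by (auto simp: distrib_left smult_mpoly_def mult.left_commute)
    show "homogeneous (int (m - 2)) (q i)"
      using q(1)[of i] card_less n2 by (simp add: of_nat_diff)
    fix B assume B: "B \<subseteq> {1..m}" "card B = m - 2"
    define A where "A = {1..m} - B"
    have finB: "finite B" using B(1) finite_subset by blast
    have A: "A \<subseteq> {1..m}" "card A = n"
      using B finB card_less n2 by (auto simp: A_def card_Diff_subset)
    obtain \<theta> where \<theta>: "\<forall>p. homogeneous 1 p \<longrightarrow> p = (\<Sum>k\<in>A. const_mpoly (form_val (\<theta> k) p) * l k)"
      using dual_basis[OF A] by blast
    have "l k * (\<Prod>i\<in>B. l i) \<in> II" if k: "k \<in> A" for k
    proof -
      have "card (A - {k}) = 1" using A k n2 finite_subset[OF A(1)] by simp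
      then obtain k' where k': "A - {k} = {k'}" by (rule card_1_singletonE)
      then have "k' \<in> A" by blast
      with k' have "{1..m} - {k'} = insert k B" "k \<notin> B" "k' \<in> {1..m}"
        using B k by (auto simp: A_def)
      then have "l k * (\<Prod>i\<in>B. l i) = P k'" using finB by (simp add: P_def)
      then show ?thesis using P_in_II \<open>k' \<in> {1..m}\<close> by simp
    qed
    note lB = this
    show "(\<Prod>i\<in>B. l i) \<in> {h. \<forall>x. var_mpoly x * h \<in> II}"
    proof (intro CollectI allI)
      fix x
      have "var_mpoly x * (\<Prod>i\<in>B. l i) =
          (\<Sum>k\<in>A. const_mpoly (form_val (\<theta> k) (var_mpoly x)) * (l k * (\<Prod>i\<in>B. l i)))"
        by (subst \<theta>[rule_format, OF homogeneous_var]) (simp add: sum_distrib_right mult.assoc)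
      also have "\<dots> \<in> II" by (intro ideal.subspace_sum[OF II_subspace] II_scale lB)
      finally show "var_mpoly x * (\<Prod>i\<in>B. l i) \<in> II" .
    qed
  qed (use card_less n2 in auto)
  then show ?case unfolding q(2) by (intro ideal.subspace_sum[OF II_subspace]) blast
next
  case (step d)
  have "d + 1 > 0" using step card_less by simp
  then obtain q where q: "\<And>i. homogeneous d (q i)" "g = (\<Sum>i\<in>UNIV. var_mpoly i * q i)"
    using homogeneous_var_expand[OF step.prems] by auto
  show ?case
    unfolding q(2) by (intro ideal.subspace_sum[OF II_subspace] II_scale step.IH q(1))
qed

lemma saturation_J_eq_UNIV:
  assumes n2: "n = 2"
  shows "saturation J = UNIV"
proof -
  have "p \<in> ideal_colon J (ideal_power irrelevant_ideal (nat r))" for p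
    unfolding ideal_colon_def
  proof (intro CollectI ballI)
    fix q :: "('n, 'k) mpoly" assume "q \<in> ideal_power irrelevant_ideal (nat r)"
    from order_ge_mult[OF order_ge_0 ideal_power_order_ge[OF this], of p]
    have ord: "order_ge (nat r) (p * q)" by simp
    have "hcomp d (p * q) * 1 \<in> J" for d
    proof (cases "d < r")
      case True
      then show ?thesis using hcomp_order_ge[OF ord, of d] r_ge ideal.subspace_0[OF J_subspace] by simp
    next
      case False
      have "hcomp d (p * q) \<in> II"
        by (rule II_contains_high_degree[OF n2 homogeneous_hcomp]) (use False r_ge in simp)
      then show ?thesis using II_component_in_J[OF _ homogeneous_hcomp] False by (simp add: r_def)
    qed
    from in_ideal_if_components[OF J_subspace this] show "p * q \<in> J" by simp
  qed
  then show ?thesis by (auto simp: saturation_def)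
qed

lemma II_subset_saturation: "II \<subseteq> saturation J"
  using saturation_J_eq_II saturation_J_eq_UNIV card_ge_2 by (cases "n = 2") auto

lemma graded_component_II: "d \<ge> r \<Longrightarrow> graded_component d II = graded_component d J"
  using J_subset_II II_component_in_J by (auto simp: graded_component_def r_def)

lemma graded_component_saturation:
  assumes "d \<ge> r"
  shows "graded_component d J = graded_component d (saturation J)"
proof (cases "n = 2")
  case True
  have "graded_component d (saturation J) \<subseteq> graded_component d II"
    using II_contains_high_degree[OF True, of d] assms r_ge by (auto simp: graded_component_def)
  then show ?thesis
    using graded_component_II[OF assms] II_subset_saturation by (auto simp: graded_component_def)
next
  case False
  then show ?thesis using graded_component_II[OF assms] saturation_J_eq_II card_ge_2 by simp
qed

lemma satiety_J: "satiety J = r"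
  unfolding satiety_def
proof (rule Least_equality)
  show "\<forall>d\<ge>r. graded_component d J = graded_component d (saturation J)"
    using graded_component_saturation by blast
  fix s assume s: "\<forall>d\<ge>s. graded_component d J = graded_component d (saturation J)"
  show "r \<le> s"
  proof (rule ccontr)
    assume "\<not> r \<le> s"
    then have "graded_component (r - 1) J = graded_component (r - 1) (saturation J)" using s by simp
    moreover obtain p where p: "p \<in> II" "homogeneous (2 * int m - int n - 2) p" "p \<notin> J"
      by (rule socle_element)
    then have "p \<in> graded_component (r - 1) (saturation J)"
      using II_subset_saturation by (auto simp: graded_component_def r_def algebra_simps)
    ultimately show False using p(3) by (auto simp: graded_component_def)
  qed
qed

lemma localized_eq:
  assumes "prime_ideal Q" "Q \<noteq> irrelevant_ideal"
  shows "localized_ideal Q J = localized_ideal Q II"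
proof
  show "localized_ideal Q J \<subseteq> localized_ideal Q II"
    using J_subset_II by (auto simp: localized_ideal_def)
  have Q: "ideal.subspace Q" "Q \<noteq> UNIV" and prime: "\<And>a b. a * b \<in> Q \<Longrightarrow> a \<in> Q \<or> b \<in> Q"
    using assms(1) by (auto simp: prime_ideal_def)
  have Q1: "1 \<notin> Q"
  proof
    assume "1 \<in> Q"
    then have "x * 1 \<in> Q" for x by (rule ideal.subspace_scale[OF Q(1)])
    then show False using Q(2) by auto
  qed
  have "\<exists>i. var_mpoly i \<notin> Q"
  proof (rule ccontr)
    assume "\<not> ?thesis"
    then have sub: "irrelevant_ideal \<subseteq> Q"
      unfolding irrelevant_ideal_def by (intro ideal.span_minimal[OF _ Q(1)]) auto
    have "p \<in> irrelevant_ideal" if p: "p \<in> Q" for p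
    proof (rule ccontr)
      assume "p \<notin> irrelevant_ideal"
      then have c: "lookup p 0 \<noteq> 0" by (simp add: irrelevant_ideal_iff)
      have "p - const_mpoly (lookup p 0) \<in> irrelevant_ideal"
        by (simp add: irrelevant_ideal_iff lookup_minus const_mpoly_def)
      then have "p - (p - const_mpoly (lookup p 0)) \<in> Q"
        by (rule ideal.subspace_diff[OF Q(1) p subsetD[OF sub]])
      then have "const_mpoly (lookup p 0) \<in> Q" by simp
      then have "const_mpoly (inverse (lookup p 0)) * const_mpoly (lookup p 0) \<in> Q"
        by (rule ideal.subspace_scale[OF Q(1)])
      then show False using Q1 by (simp add: const_mpoly_inverse[OF c])
    qed
    then show False using sub assms(2) by blast
  qed
  then obtain i where i: "var_mpoly i \<notin> Q" by blast
  define x :: "('n, 'k) mpoly" where "x = var_mpoly i ^ (m - n)"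
  have "var_mpoly i ^ k \<notin> Q" for k
    by (induction k) (use Q1 i prime in auto)
  then have x: "x \<notin> Q" by (simp add: x_def)
  have mult: "a * b \<notin> Q" if "a \<notin> Q" "b \<notin> Q" for a b using that prime by blast
  have ord: "order_ge (m - n) x"
    using homogeneous_var_power[of "m - n" i] by (auto simp: order_ge_def homogeneous_def x_def)
  show "localized_ideal Q II \<subseteq> localized_ideal Q J"
  proof
    fix y assume "y \<in> localized_ideal Q II"
    then obtain a s where as: "y = loc_rel Q `` {(a, s)}" "a \<in> II" "s \<notin> Q"
      by (auto simp: localized_ideal_def)
    have E: "(\<exists>u. u \<notin> Q \<and> u * (a * t) = u * (b * s)) \<longleftrightarrow>
        (\<exists>u. u \<notin> Q \<and> u * (a * x * t) = u * (b * (s * x)))" for b t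
    proof
      assume "\<exists>u. u \<notin> Q \<and> u * (a * t) = u * (b * s)"
      then obtain u where u: "u \<notin> Q" "u * (a * t) = u * (b * s)" by blast
      have "u * (a * x * t) = x * (u * (a * t))" by (simp add: mult_ac)
      also have "\<dots> = u * (b * (s * x))" unfolding u(2) by (simp add: mult_ac)
      finally show "\<exists>u. u \<notin> Q \<and> u * (a * x * t) = u * (b * (s * x))" using u(1) by blast
    next
      assume "\<exists>u. u \<notin> Q \<and> u * (a * x * t) = u * (b * (s * x))"
      then obtain u where u: "u \<notin> Q" "u * (a * x * t) = u * (b * (s * x))" by blast
      have "u * x * (a * t) = u * (a * x * t)" by (simp add: mult_ac)
      also have "\<dots> = u * x * (b * s)" unfolding u(2) by (simp add: mult_ac)
      finally have "u * x * (a * t) = u * x * (b * s)" .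
      then show "\<exists>u. u \<notin> Q \<and> u * (a * t) = u * (b * s)" using mult[OF u(1) x] by blast
    qed
    have loc: "loc_rel Q `` {(a, s)} = {(b, t). s \<notin> Q \<and> t \<notin> Q \<and> (\<exists>u. u \<notin> Q \<and> u * (a * t) = u * (b * s))}"
      for a s by (auto simp: loc_rel_def)
    have "loc_rel Q `` {(a, s)} = loc_rel Q `` {(a * x, s * x)}"
      unfolding loc E using as(3) mult[OF as(3) x] by simp
    moreover have "a * x \<in> J" by (rule order_ge_mult_II_in_J[OF as(2) ord])
    ultimately show "y \<in> localized_ideal Q J"
      using as(1) mult[OF as(3) x] unfolding localized_ideal_def by blast
  qed
qed

end

theorem theorem1p3:
  fixes l :: "nat \<Rightarrow> ('n::finite, 'k::field) mpoly"
    and n m :: nat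
    and f :: "('n, 'k) mpoly"
    and J II :: "('n, 'k) mpoly set"
  assumes "n = CARD('n)" and "n \<ge> 2" and "m \<ge> n + 1"
    and "infinite (UNIV :: 'k set)"
    and "\<not> CHAR('k) dvd m"
    and "generic_arrangement m l"
    and "f = defining_poly m l"
    and "J = jacobian_ideal f"
    and "II = cofactor_ideal m l"
  shows "graded_component (2 * int m - int n - 1) II = graded_component (2 * int m - int n - 1) J \<and>
    (n \<ge> 3 \<longrightarrow>
       saturation J = II \<and>
       (\<forall>P. prime_ideal P \<and> P \<noteq> irrelevant_ideal \<longrightarrow> localized_ideal P J = localized_ideal P II)) \<and>
    regularity J = satiety J \<and> satiety J = 2 * int m - int n - 1"
proof -
  interpret A: generic_forms l m n
    by unfold_locales (use assms in auto)
  have J: "J = jacobian_ideal A.f" by (simp add: assms(7,8) A.f_def)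
  show ?thesis
    unfolding J assms(9)
    using A.graded_component_II[of A.r] A.saturation_J_eq_II A.localized_eq A.regularity_J A.satiety_J
    by (simp add: A.r_def)
qed

end
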